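(* Let $G$ be a metric graph, let $\mathcal{M}$ be the set of nonzero finite Borel measures on $G$, and let $(\mu_m)_{m\in\mathbb{N}}\subset\mathcal{M}$ be a sequence converging to a measure $\mu\in\mathcal{M}$ in the weak-$\ast$ topology. Fix $k\in\mathbb{N}_0=\{0,1,2,\dots\}$. Then: (i) $\lim_{m\to\infty}\lambda_k(H_{\mu_m})=\lambda_k(H_\mu)$ in $[0,\infty]$. (ii) Assume that $\lambda_k(H_\mu)<\infty$, so that $\lambda_k(H_{\mu_m})<\infty$ for all large $m$ by (i). For such $m$ let $v_m^0,\dots,v_m^k$ be eigenfunctions of $H_{\mu_m}$, orthonormal in $L^2(G,\mu_m)$, for the eigenvalues $\lambda_0(H_{\mu_m}),\dots,\lambda_k(H_{\mu_m})$, respectively. Then, upon passing to a subsequence, $v_m^0,\dots,v_m^k$ converge uniformly on $G$ to eigenfunctions $v^0,\dots,v^k$ of $H_\mu$, orthonormal in $L^2(G,\mu)$, for the eigenvalues $\lambda_0(H_\mu),\dots,\lambda_k(H_\mu)$, respectively.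
   Context: A metric graph $G=(V,E,\ell)$ is given by a finite connected graph $(V,E)$ (loops and multiple edges allowed) and edge lengths $\ell:E\to(0,\infty)$: each edge $e$ is (after choosing an orientation) identified with the interval $[0,\ell(e)]$, and $G$ is the compact topological space obtained by gluing endpoints of edges corresponding to the same vertex. $dx$ is the Lebesgue measure on $G$. $H^1(G)$ is the space of continuous $f:G\to\mathbb{R}$ whose restriction to every open edge lies in the Sobolev space $H^1((0,\ell(e)))$; $q(f,g)=\int_G f'g'\,dx$ and $q(f)=q(f,f)$. A function $f\in H^1(G)$ is harmonic on an open set $O\subset G$ if $q(f,g)=0$ for all $g\in H^1(G)$ with $g\equiv 0$ on $G\setminus O$. For a nonzero finite Borel measure $\mu$ on $G$, let $H^1(G,\mu)=\{f\in H^1(G): f \text{ harmonic on } G\setminus\operatorname{supp}\mu\}$. The natural map $H^1(G,\mu)\to L^2(G,\mu)$ is injective and $H^1(G,\mu)$ is regarded as a dense subspace of $L^2(G,\mu)$. $H_\mu$ is the non-negative self-adjoint operator in $L^2(G,\mu)$ associated with the closed form $q|_{H^1(G,\mu)}$: $f\in\operatorname{dom}(H_\mu)$ and $H_\mu f=g$ iff $f\in H^1(G,\mu)$ and $q(f,\varphi)=\int_G g\varphi\,d\mu$ for all $\varphi\in H^1(G,\mu)$. Its spectrum is discrete; its eigenvalues, counted with multiplicity, are $0=\lambda_0(H_\mu)<\lambda_1(H_\mu)\le\lambda_2(H_\mu)\le\cdots$, with the convention $\lambda_k(H_\mu):=+\infty$ for $k\ge\dim L^2(G,\mu)$. Eigenfunctions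 are elements of $H^1(G,\mu)$, hence continuous functions on all of $G$. Weak-$\ast$ convergence $\mu_m\to\mu$ means $\int_G f\,d\mu_m\to\int_G f\,d\mu$ for all $f\in C(G)$. *)

theory Defs
  imports "HOL-Analysis.Analysis" "Graph_Theory.Graph_Theory"
begin

section \<open>Metric graphs\<close>

text \<open>
  The combinatorial graph is a finite multi-digraph (loops and parallel arcs allowed); the
  direction of an arc is only the choice of orientation used to identify the edge with
  an interval. Connectedness is that of the underlying undirected graph and includes having
  a vertex.
\<close>

record ('v, 'e) metric_graph =
  dgraph :: "('v, 'e) pre_digraph"
  len :: "'e \<Rightarrow> real"

definition is_metric_graph :: "('v, 'e) metric_graph \<Rightarrow> bool" where
  "is_metric_graph G \<longleftrightarrow>
     fin_digraph (dgraph G) \<and> Digraph_Component.connected (dgraph G) \<and>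
     (\<forall>e\<in>arcs (dgraph G). 0 < len G e)"

datatype ('v, 'e) point = Vertex 'v | Inner 'e real

definition points :: "('v, 'e) metric_graph \<Rightarrow> ('v, 'e) point set" where
  "points G = Vertex ` verts (dgraph G) \<union> {Inner e t | e t. e \<in> arcs (dgraph G) \<and> 0 < t \<and> t < len G e}"

definition edge_point :: "('v, 'e) metric_graph \<Rightarrow> 'e \<Rightarrow> real \<Rightarrow> ('v, 'e) point" where
  "edge_point G e t =
     (if t \<le> 0 then Vertex (tail (dgraph G) e)
      else if len G e \<le> t then Vertex (head (dgraph G) e)
      else Inner e t)"

text \<open>
  The gluing (quotient) topology: the finest topology making all maps
  \<open>edge_point G e : [0, len G e] \<rightarrow> points G\<close> continuous.
\<close>

definition graph_topology :: "('v, 'e) metric_graph \<Rightarrow> ('v, 'e) point topology" where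
  "graph_topology G = topology (\<lambda>U. U \<subseteq> points G \<and>
     (\<forall>e\<in>arcs (dgraph G).
        openin (top_of_set {0..len G e}) {t \<in> {0..len G e}. edge_point G e t \<in> U}))"

lemma openin_graph_topology:
  "openin (graph_topology G) U \<longleftrightarrow> U \<subseteq> points G \<and>
     (\<forall>e\<in>arcs (dgraph G).
        openin (top_of_set {0..len G e}) {t \<in> {0..len G e}. edge_point G e t \<in> U})"
proof -
  have "istopology (\<lambda>U. U \<subseteq> points G \<and>
     (\<forall>e\<in>arcs (dgraph G).
        openin (top_of_set {0..len G e}) {t \<in> {0..len G e}. edge_point G e t \<in> U}))"
    (is "istopology (\<lambda>U. U \<subseteq> _ \<and> (\<forall>e\<in>_. openin (?X e) (?pre e U)))")
    unfolding istopology_def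
  proof (intro conjI allI impI ballI)
    fix S T e
    assume S: "S \<subseteq> points G \<and> (\<forall>e\<in>arcs (dgraph G). openin (?X e) (?pre e S))"
      and T: "T \<subseteq> points G \<and> (\<forall>e\<in>arcs (dgraph G). openin (?X e) (?pre e T))"
    show "S \<inter> T \<subseteq> points G" using S by blast
    assume "e \<in> arcs (dgraph G)"
    then have "openin (?X e) (?pre e S \<inter> ?pre e T)" using S T by (intro openin_Int) auto
    moreover have "?pre e S \<inter> ?pre e T = ?pre e (S \<inter> T)" by blast
    ultimately show "openin (?X e) (?pre e (S \<inter> T))" by simp
  next
    fix K
    assume K: "\<forall>S\<in>K. S \<subseteq> points G \<and> (\<forall>e\<in>arcs (dgraph G). openin (?X e) (?pre e S))"
    show "\<Union>K \<subseteq> points G" using K by blast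
    fix e
    assume "e \<in> arcs (dgraph G)"
    then have "openin (?X e) (\<Union>(?pre e ` K))" using K by (intro openin_Union) blast
    moreover have "\<Union>(?pre e ` K) = ?pre e (\<Union>K)" by blast
    ultimately show "openin (?X e) (?pre e (\<Union>K))" by simp
  qed
  then show ?thesis by (simp add: graph_topology_def)
qed

lemma topspace_graph_topology:
  assumes "is_metric_graph G"
  shows "topspace (graph_topology G) = points G"
proof (rule subset_antisym)
  show "topspace (graph_topology G) \<subseteq> points G"
    using openin_topspace[of "graph_topology G"] unfolding openin_graph_topology by blast
  have "edge_point G e t \<in> points G" if "e \<in> arcs (dgraph G)" for e t
  proof -
    interpret fin_digraph "dgraph G" using assms by (simp add: is_metric_graph_def)
    show ?thesis using that by (auto simp: edge_point_def points_def)
  qed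
  then have "{t \<in> {0..len G e}. edge_point G e t \<in> points G} = {0..len G e}"
    if "e \<in> arcs (dgraph G)" for e using that by blast
  then have "openin (graph_topology G) (points G)"
    unfolding openin_graph_topology by (metis openin_subtopology_self order_refl)
  then show "points G \<subseteq> topspace (graph_topology G)" by (rule openin_subset)
qed


section \<open>Square-integrable functions, the Sobolev space, and the energy form\<close>

text \<open>
  Functions defined on \<open>points G\<close> are represented by total functions; no notion below
  depends on values outside \<open>points G\<close>. Elements of $L^2$ are represented by functions, and
  equality in $L^2$ is equality almost everywhere.
\<close>

definition L2 :: "'a measure \<Rightarrow> ('a \<Rightarrow> real) set" where
  "L2 M = {f \<in> borel_measurable M. integrable M (\<lambda>x. (f x)\<^sup>2)}"

definition interval_measure_on :: "real \<Rightarrow> real measure" where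
  "interval_measure_on l = restrict_space lborel {0<..<l}"

definition test_function :: "real \<Rightarrow> (real \<Rightarrow> real) \<Rightarrow> bool" where
  "test_function l \<phi> \<longleftrightarrow>
     (\<forall>n x. ((deriv ^^ n) \<phi>) field_differentiable (at x)) \<and>
     (\<exists>a b. 0 < a \<and> b < l \<and> (\<forall>x. x \<notin> {a..b} \<longrightarrow> \<phi> x = 0))"

definition has_weak_deriv :: "real \<Rightarrow> (real \<Rightarrow> real) \<Rightarrow> (real \<Rightarrow> real) \<Rightarrow> bool" where
  "has_weak_deriv l u g \<longleftrightarrow>
     (\<forall>\<phi>. test_function l \<phi> \<longrightarrow>
        integral\<^sup>L (interval_measure_on l) (\<lambda>t. u t * deriv \<phi> t) =
        - integral\<^sup>L (interval_measure_on l) (\<lambda>t. g t * \<phi> t))"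

definition sobolev_H1 :: "real \<Rightarrow> (real \<Rightarrow> real) set" where
  "sobolev_H1 l =
     {u \<in> L2 (interval_measure_on l). \<exists>g\<in>L2 (interval_measure_on l). has_weak_deriv l u g}"

text \<open>Weak derivatives are unique only up to null sets; any choice gives the same \<open>energy\<close>.\<close>

definition weak_deriv :: "real \<Rightarrow> (real \<Rightarrow> real) \<Rightarrow> real \<Rightarrow> real" where
  "weak_deriv l u = (SOME g. g \<in> L2 (interval_measure_on l) \<and> has_weak_deriv l u g)"

definition H1 :: "('v, 'e) metric_graph \<Rightarrow> (('v, 'e) point \<Rightarrow> real) set" where
  "H1 G = {f. continuous_map (graph_topology G) euclideanreal f \<and>
     (\<forall>e\<in>arcs (dgraph G). (\<lambda>t. f (edge_point G e t)) \<in> sobolev_H1 (len G e))}"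

definition energy ::
    "('v, 'e) metric_graph \<Rightarrow> (('v, 'e) point \<Rightarrow> real) \<Rightarrow> (('v, 'e) point \<Rightarrow> real) \<Rightarrow> real" where
  "energy G f g = (\<Sum>e\<in>arcs (dgraph G).
     integral\<^sup>L (interval_measure_on (len G e))
       (\<lambda>t. weak_deriv (len G e) (\<lambda>s. f (edge_point G e s)) t *
            weak_deriv (len G e) (\<lambda>s. g (edge_point G e s)) t))"

definition harmonic_on ::
    "('v, 'e) metric_graph \<Rightarrow> ('v, 'e) point set \<Rightarrow> (('v, 'e) point \<Rightarrow> real) \<Rightarrow> bool" where
  "harmonic_on G O' f \<longleftrightarrow>
     f \<in> H1 G \<and> (\<forall>g\<in>H1 G. (\<forall>x\<in>points G - O'. g x = 0) \<longrightarrow> energy G f g = 0)"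


section \<open>Measures and the associated operators\<close>

definition nonzero_finite_measures :: "('v, 'e) metric_graph \<Rightarrow> ('v, 'e) point measure set" where
  "nonzero_finite_measures G = {\<mu>.
     sets \<mu> = sigma_sets (points G) {U. openin (graph_topology G) U} \<and>
     finite_measure \<mu> \<and> emeasure \<mu> (space \<mu>) \<noteq> 0}"

definition weak_star_conv ::
    "('v, 'e) metric_graph \<Rightarrow> (nat \<Rightarrow> ('v, 'e) point measure) \<Rightarrow> ('v, 'e) point measure \<Rightarrow> bool" where
  "weak_star_conv G \<mu>s \<mu> \<longleftrightarrow>
     (\<forall>f. continuous_map (graph_topology G) euclideanreal f \<longrightarrow>
        (\<lambda>m. integral\<^sup>L (\<mu>s m) f) \<longlonglongrightarrow> integral\<^sup>L \<mu> f)"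

definition supp :: "('v, 'e) metric_graph \<Rightarrow> ('v, 'e) point measure \<Rightarrow> ('v, 'e) point set" where
  "supp G \<mu> = {x \<in> points G. \<forall>U. openin (graph_topology G) U \<and> x \<in> U \<longrightarrow> 0 < emeasure \<mu> U}"

definition H1_mu ::
    "('v, 'e) metric_graph \<Rightarrow> ('v, 'e) point measure \<Rightarrow> (('v, 'e) point \<Rightarrow> real) set" where
  "H1_mu G \<mu> = {f \<in> H1 G. harmonic_on G (points G - supp G \<mu>) f}"

text \<open>
  The graph of the operator: \<open>H_op G \<mu> f g\<close> means $f \in \mathrm{dom}(H_\mu)$ and $H_\mu f = g$, where
  the $L^2$-class in the domain is represented by its unique representative in \<open>H1_mu G \<mu>\<close>.
\<close>

definition H_op ::
    "('v, 'e) metric_graph \<Rightarrow> ('v, 'e) point measure \<Rightarrow>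
     (('v, 'e) point \<Rightarrow> real) \<Rightarrow> (('v, 'e) point \<Rightarrow> real) \<Rightarrow> bool" where
  "H_op G \<mu> f g \<longleftrightarrow> f \<in> H1_mu G \<mu> \<and> g \<in> L2 \<mu> \<and>
     (\<forall>\<phi>\<in>H1_mu G \<mu>. energy G f \<phi> = integral\<^sup>L \<mu> (\<lambda>x. g x * \<phi> x))"

definition eigenfunction ::
    "('v, 'e) metric_graph \<Rightarrow> ('v, 'e) point measure \<Rightarrow> real \<Rightarrow> (('v, 'e) point \<Rightarrow> real) \<Rightarrow> bool" where
  "eigenfunction G \<mu> a f \<longleftrightarrow> H_op G \<mu> f (\<lambda>x. a * f x) \<and> \<not> (AE x in \<mu>. f x = 0)"

text \<open>
  Dimension in $L^2(M)$, i.e. modulo almost everywhere equality, of a linear space \<open>S\<close> of functions: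
  the supremum of the sizes of its linearly independent families.
\<close>

definition L2_independent :: "'a measure \<Rightarrow> nat \<Rightarrow> (nat \<Rightarrow> 'a \<Rightarrow> real) \<Rightarrow> bool" where
  "L2_independent M n f \<longleftrightarrow>
     (\<forall>c :: nat \<Rightarrow> real. (AE x in M. (\<Sum>i<n. c i * f i x) = 0) \<longrightarrow> (\<forall>i<n. c i = 0))"

definition L2_dim :: "'a measure \<Rightarrow> ('a \<Rightarrow> real) set \<Rightarrow> enat" where
  "L2_dim M S = Sup {enat n | n. \<exists>f. (\<forall>i<n. f i \<in> S) \<and> L2_independent M n f}"

definition eigen_mult :: "('v, 'e) metric_graph \<Rightarrow> ('v, 'e) point measure \<Rightarrow> real \<Rightarrow> enat" where
  "eigen_mult G \<mu> a = L2_dim \<mu> {f. H_op G \<mu> f (\<lambda>x. a * f x)}"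

text \<open>
  The \<open>k\<close>-th eigenvalue, counted from \<open>0\<close> in increasing order with multiplicity, is the least
  \<open>a\<close> such that the total multiplicity of the eigenvalues \<open>\<le> a\<close> exceeds \<open>k\<close>. The total multiplicity is
  taken along finite sets because an infinite \<open>sum\<close> would silently be \<open>0\<close>;
  non-eigenvalues in such a set have multiplicity \<open>0\<close>.
\<close>

definition eigval :: "('v, 'e) metric_graph \<Rightarrow> ('v, 'e) point measure \<Rightarrow> nat \<Rightarrow> ereal" where
  "eigval G \<mu> k =
     (if L2_dim \<mu> (L2 \<mu>) \<le> enat k then \<infinity>
      else Inf {ereal a | a. \<exists>F. finite F \<and> F \<subseteq> {..a} \<and> enat k < (\<Sum>\<nu>\<in>F. eigen_mult G \<mu> \<nu>)})"

text \<open>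
  \<open>v 0, \<dots>, v k\<close> are eigenfunctions for the eigenvalues number \<open>0, \<dots>, k\<close>, orthonormal in $L^2(\mu)$.
  Used only when \<open>eigval G \<mu> k < \<infinity>\<close>, so that the conversion to reals is harmless.
\<close>

definition orthonormal_eigenfunctions ::
    "('v, 'e) metric_graph \<Rightarrow> ('v, 'e) point measure \<Rightarrow> nat \<Rightarrow>
     (nat \<Rightarrow> ('v, 'e) point \<Rightarrow> real) \<Rightarrow> bool" where
  "orthonormal_eigenfunctions G \<mu> k v \<longleftrightarrow>
     (\<forall>j\<le>k. eigenfunction G \<mu> (real_of_ereal (eigval G \<mu> j)) (v j)) \<and>
     (\<forall>i\<le>k. \<forall>j\<le>k. integral\<^sup>L \<mu> (\<lambda>x. v i x * v j x) = (if i = j then 1 else 0))"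

end

theory Submission
  imports Defs "HOL-Complex_Analysis.Great_Picard"
begin

text \<open>
  A function $f$ with eigenvalue $a$ for $H_\mu$ satisfies $q(f,\varphi) = a \int f \varphi \, d\mu$
  for \<^emph>\<open>all\<close> $\varphi \in H^1(G)$, not only for those in $H^1(G,\mu)$, since both sides vanish when
  $\varphi = 0$ on the support of $\mu$. In this form the equation does not mention the support, and it
  passes to the limit: bounded eigenvalues bound energies, hence eigenfunctions are equicontinuous and
  subconverge uniformly; inserting differences of eigenfunctions into the equations shows
  that they are then Cauchy in energy, so the limit lies in $H^1(G)$ and solves the limit equation.
  This gives lower semicontinuity of $\lambda_k$; upper semicontinuity follows from the
  variational principle with the eigenfunctions of $H_\mu$ as test functions for $H_{\mu_m}$.
  The existence of eigenfunctions and the variational principle come from successive minimisation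
  of the energy.
\<close>

section \<open>Smooth step functions\<close>

text \<open>Weak derivatives are given only through test functions, and \<open>weak_deriv\<close>
  picks an arbitrary representative, so pointwise information has to be earned. Explicit smooth
  steps, used as test functions, express u t - u s as an integral of the weak derivative; from this
  follow uniqueness almost everywhere, a Hoelder bound with exponent 1/2 and, by connectedness,
  control of the oscillation over the whole graph by the energy. That bound makes Arzela-Ascoli
  available and stands in for Sobolev embedding and weak compactness. Where compactness is used,
  uniform convergence comes first; the Cauchy property in energy is then forced, by the
  parallelogram identity for minimisers and by the equations for eigenfunctions, and closedness of
  the form does the rest. Eigenvalues are defined by adding multiplicities, so the variational
  theory is also a counting argument: orthonormal eigenfunctions bound multiplicities from below,
  the minimum property bounds them from above, and the number of support points tells how many
  minimisations can be carried out.\<close>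

definition smooth :: "(real \<Rightarrow> real) \<Rightarrow> bool" where
  "smooth f \<longleftrightarrow> (\<forall>n x. ((deriv ^^ n) f) field_differentiable (at x))"

text \<open>Computing iterated \<open>deriv\<close> of an explicit function is replaced by
  exhibiting a family closed under differentiation: \<open>deriv\<close> of a member is again a
  member, at every order.\<close>

lemma smooth_coinduct:
  assumes "P f"
    and step: "\<And>f. P f \<Longrightarrow> \<exists>f'. P f' \<and> (\<forall>x. (f has_real_derivative f' x) (at x))"
  shows "smooth f"
  unfolding smooth_def
proof (intro allI)
  fix n x
  have step': "P (deriv h) \<and> (\<forall>x. (h has_real_derivative deriv h x) (at x))" if h: "P h" for h
  proof -
    obtain h' where h': "P h'" "\<And>x. (h has_real_derivative h' x) (at x)" using step[OF h] by blast
    have "deriv h = h'" using h'(2) by (intro ext DERIV_imp_deriv)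
    then show ?thesis using h' by simp
  qed
  have "P ((deriv ^^ n) f)" by (induction n) (use assms(1) step' in auto)
  then show "((deriv ^^ n) f) field_differentiable at x"
    using step' by (auto simp: field_differentiable_def)
qed

lemma smooth_has_derivative: "smooth f \<Longrightarrow> (f has_real_derivative deriv f x) (at x)"
  unfolding smooth_def by (metis DERIV_deriv_iff_field_differentiable funpow_0)

lemma smooth_deriv: "smooth f \<Longrightarrow> smooth (deriv f)"
  unfolding smooth_def
proof (intro allI)
  fix n x assume "\<forall>n x. (deriv ^^ n) f field_differentiable at x"
  then have "(deriv ^^ Suc n) f field_differentiable at x" by blast
  then show "(deriv ^^ n) (deriv f) field_differentiable at x" by (simp add: funpow_swap1)
qed

lemma smooth_if_smooth_deriv:
  assumes "smooth f'" and "\<And>x. (f has_real_derivative f' x) (at x)"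
  shows "smooth f"
proof (rule smooth_coinduct[where P = "\<lambda>h. h = f \<or> smooth h"])
  fix h assume "h = f \<or> smooth h"
  then show "\<exists>h'. (h' = f \<or> smooth h') \<and> (\<forall>x. (h has_real_derivative h' x) (at x))"
    using assms smooth_deriv smooth_has_derivative by blast
qed simp

text \<open>This is the shape of the test functions built below. The coefficient \<open>c\<close> of
  the coinductive family absorbs the factor \<open>m\<close> that the chain rule produces at each
  differentiation.\<close>

lemma smooth_diff_affine:
  assumes "smooth f"
  shows "smooth (\<lambda>x. f (m * (x - a)) - f (m * (x - b)))"
proof (rule smooth_coinduct[where P =
      "\<lambda>h. \<exists>g c. smooth g \<and> h = (\<lambda>x. c * g (m * (x - a)) - c * g (m * (x - b)))"])
  show "\<exists>g c. smooth g \<and> (\<lambda>x. f (m * (x - a)) - f (m * (x - b))) =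
      (\<lambda>x. c * g (m * (x - a)) - c * g (m * (x - b)))"
    using assms by (intro exI[of _ f] exI[of _ 1]) auto
next
  fix h assume "\<exists>g c. smooth g \<and> h = (\<lambda>x. c * g (m * (x - a)) - c * g (m * (x - b)))"
  then obtain g c where g: "smooth g" "h = (\<lambda>x. c * g (m * (x - a)) - c * g (m * (x - b)))" by blast
  have "((\<lambda>x. g (m * (x - d))) has_real_derivative deriv g (m * (x - d)) * m) (at x)" for x d
    by (rule DERIV_chain2[OF smooth_has_derivative[OF g(1)]]) (auto intro!: derivative_eq_intros)
  note this[derivative_intros]
  have "(h has_real_derivative
      (c * m) * deriv g (m * (x - a)) - (c * m) * deriv g (m * (x - b))) (at x)" for x
    unfolding g(2) by (auto intro!: derivative_eq_intros)
  then show "\<exists>h'. (\<exists>g c. smooth g \<and> h' = (\<lambda>x. c * g (m * (x - a)) - c * g (m * (x - b)))) \<and>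
      (\<forall>x. (h has_real_derivative h' x) (at x))"
    using smooth_deriv[OF g(1)] by blast
qed

text \<open>Serves at the points where the bump is glued to zero. The bound at \<open>y = x\<close>
  already forces \<open>f x = 0\<close>, so the difference quotient is at most linear in the
  distance.\<close>

lemma DERIV_zero_quadratic:
  fixes f :: "real \<Rightarrow> real"
  assumes "\<And>y. \<bar>f y\<bar> \<le> C * (y - x)^2"
  shows "(f has_real_derivative 0) (at x)"
proof -
  have fx: "f x = 0" using assms[of x] by simp
  have "((\<lambda>y. (f y - f x) / (y - x)) \<longlongrightarrow> 0) (at x)"
  proof (rule Lim_null_comparison)
    show "\<forall>\<^sub>F y in at x. norm ((f y - f x) / (y - x)) \<le> C * \<bar>y - x\<bar>"
    proof (rule eventually_at_topological[THEN iffD2], intro exI[of _ UNIV] conjI ballI impI)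
      fix y assume "y \<noteq> x"
      then show "norm ((f y - f x) / (y - x)) \<le> C * \<bar>y - x\<bar>"
        using assms[of y] fx by (simp add: divide_le_eq power2_eq_square mult.assoc flip: abs_mult)
    qed auto
    show "((\<lambda>y. C * \<bar>y - x\<bar>) \<longlongrightarrow> 0) (at x)"
      by (rule tendsto_eq_intros | simp)+
  qed
  then show ?thesis by (simp add: has_field_derivative_iff)
qed

text \<open>This family is closed under differentiation.\<close>

definition bump :: "real poly \<Rightarrow> nat \<Rightarrow> real \<Rightarrow> real" where
  "bump p k x = (if 0 < x \<and> x < 1
     then poly p x / (x * (1 - x)) ^ k * exp (- (1 / (x * (1 - x)))) else 0)"

text \<open>A single term of the series of \<open>exp (1 / w)\<close> is a lower bound for
  it.\<close>

lemma exp_minus_inverse_le: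
  assumes "0 < (w::real)"
  shows "exp (- (1 / w)) \<le> fact n * w ^ n"
proof -
  have "(\<Sum>k\<in>{n}. (1/w) ^ k /\<^sub>R fact k) \<le> (\<Sum>k. (1/w) ^ k /\<^sub>R fact k)"
    using assms sums_summable[OF exp_converges, of "1/w"] by (intro sum_le_suminf) auto
  then have "(1 / w) ^ n / fact n \<le> exp (1 / w)"
    using sums_unique[OF exp_converges, of "1/w"] by (simp add: divide_inverse mult.commute)
  then show ?thesis using assms
    by (simp add: exp_minus field_simps power_divide)
qed

text \<open>The exponential beats the pole of order \<open>k\<close> with two powers of x (1 - x) to
  spare; the spare square is what \<open>DERIV_zero_quadratic\<close> consumes.\<close>

lemma bump_quadratic_bound: "\<exists>C. \<forall>x. \<bar>bump p k x\<bar> \<le> C * (x * (1 - x))^2 \<and> 0 \<le> C"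
proof -
  have "compact (poly p ` {0..1})"
    by (intro compact_continuous_image continuous_intros) auto
  then have "bounded (poly p ` {0..1})" by (rule compact_imp_bounded)
  then obtain M where M: "\<And>x. x \<in> {0..1} \<Longrightarrow> \<bar>poly p x\<bar> \<le> M"
    unfolding bounded_iff by (metis imageI real_norm_def)
  have M0: "0 \<le> M" using M[of 0] by simp
  have "\<bar>bump p k x\<bar> \<le> (M * fact (k + 2)) * (x * (1 - x))^2" for x
  proof (cases "0 < x \<and> x < 1")
    case True
    define w where "w = x * (1 - x)"
    have w: "0 < w" using True by (simp add: w_def)
    have "\<bar>bump p k x\<bar> = \<bar>poly p x\<bar> * exp (- (1 / w)) / w ^ k"
      using True w by (simp add: bump_def w_def[symmetric] abs_mult)
    also have "\<dots> \<le> M * (fact (k + 2) * w ^ (k + 2)) / w ^ k"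
      using M[of x] True w M0 exp_minus_inverse_le[OF w, of "k+2"]
      by (intro divide_right_mono mult_mono) auto
    also have "\<dots> = M * fact (k + 2) * w^2" using w by (simp add: power_add power2_eq_square)
    finally show ?thesis by (simp add: w_def)
  qed (use M0 in \<open>auto simp: bump_def\<close>)
  moreover have "0 \<le> M * fact (k + 2)" using M0 by simp
  ultimately show ?thesis by blast
qed

text \<open>With w = x (1 - x), coded as \<open>[:0, 1, -1:]\<close>, and w' coded as
  \<open>[:1, -2:]\<close>, differentiating p / w^k exp (-1/w) gives (p' w^2 - k p w' w + p w') /
  w^(k+2) exp (-1/w). Outside the open unit interval the quadratic bound takes over.\<close>

lemma bump_has_derivative:
  "(bump p k has_real_derivative
     bump (pderiv p * [:0, 1, -1:]^2 - of_nat k * p * [:1, -2:] * [:0, 1, -1:] + p * [:1, -2:]) (k + 2) x) (at x)"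
    (is "(_ has_real_derivative bump ?p' _ _) _")
proof (cases "0 < x \<and> x < 1")
  case True
  define w where "w = x * (1 - x)"
  have w: "0 < w" using True by (simp add: w_def)
  define W where "W x = x * (1 - x)" for x :: real
  have dW: "(W has_real_derivative 1 - 2 * x) (at x)"
    unfolding W_def by (auto intro!: derivative_eq_intros)
  have Wx: "W x = w" by (simp add: W_def w_def)
  have dE: "((\<lambda>x. exp (- (1 / W x))) has_real_derivative exp (- (1 / w)) * ((1 - 2 * x) / (w * w))) (at x)"
    using w by (auto intro!: derivative_eq_intros dW simp: Wx diff_divide_distrib algebra_simps)
  have dQ: "((\<lambda>x. poly p x / W x ^ k) has_real_derivative
     (poly (pderiv p) x * w ^ k - poly p x * (of_nat k * (1 - 2 * x) * w ^ (k - 1))) / (w ^ k * w ^ k)) (at x)"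
    using w by (auto intro!: derivative_eq_intros dW poly_DERIV simp: Wx)
  have 1: "((\<lambda>x. poly p x / (x * (1 - x)) ^ k * exp (- (1 / (x * (1 - x))))) has_real_derivative
     ((poly (pderiv p) x * w ^ k - poly p x * (of_nat k * (1 - 2 * x) * w ^ (k - 1))) / (w ^ k * w ^ k)) * exp (- (1 / w))
      + exp (- (1 / w)) * ((1 - 2 * x) / (w * w)) * (poly p x / w ^ k)) (at x)"
    using DERIV_mult[OF dQ dE] unfolding W_def by (simp add: w_def[symmetric])
  have 2: "((poly (pderiv p) x * w ^ k - poly p x * (of_nat k * (1 - 2 * x) * w ^ (k - 1))) / (w ^ k * w ^ k)) * exp (- (1 / w))
      + exp (- (1 / w)) * ((1 - 2 * x) / (w * w)) * (poly p x / w ^ k) = bump ?p' (k + 2) x"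
  proof -
    have pw: "poly [:0, 1, -1:] x = w" "poly [:1, -2:] x = 1 - 2 * x" by (auto simp: w_def algebra_simps)
    have p': "poly ?p' x = poly (pderiv p) x * w^2 - of_nat k * poly p x * (1 - 2*x) * w + poly p x * (1 - 2*x)"
      by (simp only: poly_add poly_diff poly_mult poly_power pw of_nat_poly poly_0 poly_1)
        (simp add: of_nat_poly)
    have k: "of_nat k * (1 - 2 * x) * w ^ (k - 1) = of_nat k * (1 - 2 * x) * w ^ k / w"
      using w by (cases k) auto
    have eq: "poly ?p' x / w ^ (k + 2) =
      (poly (pderiv p) x * w ^ k - poly p x * (of_nat k * (1 - 2 * x) * w ^ (k - 1))) / (w ^ k * w ^ k)
      + ((1 - 2 * x) / (w * w)) * (poly p x / w ^ k)"
      unfolding p' k using w by (simp add: field_simps power2_eq_square power_add)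
    have "bump ?p' (k + 2) x = poly ?p' x / w ^ (k + 2) * exp (- (1 / w))"
      using True by (simp only: bump_def w_def if_True simp_thms)
    then show ?thesis by (simp only: eq distrib_right) (simp only: mult_ac)
  qed
  show ?thesis
    by (rule has_field_derivative_transform_within_open[OF 1[unfolded 2], of "{0<..<1}"])
       (use True in \<open>auto simp: bump_def\<close>)
next
  case False
  obtain C where C: "\<And>x. \<bar>bump p k x\<bar> \<le> C * (x * (1 - x))^2" "0 \<le> C"
    using bump_quadratic_bound by blast
  have "(bump p k has_real_derivative 0) (at x)"
  proof (rule DERIV_zero_quadratic)
    fix y
    show "\<bar>bump p k y\<bar> \<le> C * (y - x)^2"
    proof (cases "0 < y \<and> y < 1")
      case True
      have pos: "0 \<le> y * (1 - y)" using True by simp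
      \<comment> \<open>The product is at most the distance from \<open>y\<close> to either end of
        the unit interval, and \<open>x\<close> lies at or beyond one of these ends.\<close>
      have "\<bar>y * (1 - y)\<bar> \<le> \<bar>y - x\<bar>"
      proof (cases "x \<le> 0")
        case True': True
        have "y * (1 - y) \<le> y * 1" using True by (intro mult_left_mono) auto
        then show ?thesis using pos True' by linarith
      next
        case False': False
        have "y * (1 - y) \<le> 1 * (1 - y)" using True by (intro mult_right_mono) auto
        then show ?thesis using pos False' False by (simp add: not_less)
      qed
      then have "(y * (1 - y))^2 \<le> (y - x)^2" by (simp add: abs_le_square_iff)
      then show ?thesis using C(1)[of y] C(2) by (meson mult_left_mono order_trans)
    qed (use C(2) in \<open>auto simp: bump_def\<close>)
  qed
  moreover have "bump q n x = 0" for q n using False by (auto simp: bump_def)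
  ultimately show ?thesis by (simp only:)
qed

lemma smooth_bump: "smooth (bump p k)"
  by (rule smooth_coinduct[where P = "\<lambda>h. \<exists>p k. h = bump p k"]) (use bump_has_derivative in blast)+

text \<open>The step is the normalised antiderivative of the bump exp (-1 / (x (1 - x))).\<close>

lemma smooth_step_exists:
  obtains B :: "real \<Rightarrow> real" where "smooth B" "\<And>x. x \<le> 0 \<Longrightarrow> B x = 0" "\<And>x. 1 \<le> x \<Longrightarrow> B x = 1"
    "\<And>x. 0 \<le> deriv B x" "\<And>x. 0 \<le> B x \<and> B x \<le> 1" "\<And>x. x \<notin> {0..1} \<Longrightarrow> deriv B x = 0"
proof -
  have cont: "isCont (bump 1 0) x" for x
    using bump_has_derivative DERIV_isCont by blast
  obtain F where F: "\<And>x. (F has_real_derivative bump 1 0 x) (at x)"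
    using einterval_antiderivative[of "-\<infinity>" \<infinity> "bump 1 0"] cont
    by (auto simp: has_real_derivative_iff_has_vector_derivative)
  have nn: "0 \<le> bump 1 0 x" for x by (simp add: bump_def)
  have mono: "F x \<le> F y" if "x \<le> y" for x y
    using DERIV_nonneg_imp_nondecreasing[OF that] F nn by blast
  \<comment> \<open>The bump vanishes at 0 and 1, so strict growth is taken on the middle half,
    where it is positive up to the endpoints, and extended by monotonicity.\<close>
  have lt: "F 0 < F 1"
  proof -
    have "F (1/4) < F (3/4)"
    proof (rule DERIV_pos_imp_increasing[where f = F])
      fix x :: real assume x: "1/4 \<le> x" "x \<le> 3/4"
      then have "0 < bump 1 0 x" by (simp add: bump_def)
      then show "\<exists>y. (F has_real_derivative y) (at x) \<and> 0 < y" using F by blast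
    qed simp
    then show ?thesis using mono[of 0 "1/4"] mono[of "3/4" 1] by simp
  qed
  define B where "B x = (F x - F 0) / (F 1 - F 0)" for x
  \<comment> \<open>The normalising factor is moved into the polynomial, so that the derivative is
    again a member of the family \<open>bump\<close>.\<close>
  have dB: "(B has_real_derivative bump [:1 / (F 1 - F 0):] 0 x) (at x)" for x
    unfolding B_def using lt
    by (auto intro!: derivative_eq_intros F simp: bump_def one_pCons)
  have dB': "deriv B x = bump [:1 / (F 1 - F 0):] 0 x" for x by (rule DERIV_imp_deriv[OF dB])
  have "smooth B" using smooth_if_smooth_deriv[OF smooth_bump dB] .
  moreover have B0: "B x = 0" if "x \<le> 0" for x
  proof (cases "x = 0")
    case False
    then have x: "x < 0" using that by simp
    obtain z where z: "z > x" "z < 0" "B 0 - B x = (0 - x) * bump [:1 / (F 1 - F 0):] 0 z"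
      using MVT2[OF x, of B] dB by meson
    then show ?thesis by (simp add: bump_def B_def)
  qed (simp add: B_def)
  moreover have B1: "B x = 1" if "1 \<le> x" for x
  proof (cases "x = 1")
    case False
    then have x: "1 < x" using that by simp
    obtain z where z: "z > 1" "z < x" "B x - B 1 = (x - 1) * bump [:1 / (F 1 - F 0):] 0 z"
      using MVT2[OF x, of B] dB by meson
    then show ?thesis using lt by (simp add: bump_def B_def)
  qed (use lt in \<open>simp add: B_def\<close>)
  moreover have "0 \<le> deriv B x" for x unfolding dB' using lt by (simp add: bump_def)
  moreover have "0 \<le> B x \<and> B x \<le> 1" for x
  proof -
    have "B (min x 0) \<le> B x" "B x \<le> B (max x 1)"
      using mono lt by (auto simp: B_def intro!: divide_right_mono)
    then show ?thesis using B0[of "min x 0"] B1[of "max x 1"] by simp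
  qed
  moreover have "deriv B x = 0" if "x \<notin> {0..1}" for x unfolding dB' using that by (auto simp: bump_def)
  ultimately show thesis using that by blast
qed

section \<open>Square-integrable functions\<close>

text \<open>A nonnegative quadratic has nonpositive discriminant. Besides the Cauchy-Schwarz
  inequalities this yields the first-order conditions for minimisers: for \<open>a = 0\<close> it
  forces \<open>b = 0\<close>.\<close>

lemma quadratic_nonneg_imp_le:
  fixes a b c :: real
  assumes nn: "\<And>t. 0 \<le> a + 2 * t * b + t^2 * c" and c: "0 \<le> c"
  shows "b^2 \<le> a * c"
proof (cases "c = 0")
  case True
  have "b = 0"
  proof (rule ccontr)
    assume "b \<noteq> 0"
    then have "2 * (- (a + 1) / (2 * b)) * b = - (a + 1)" by simp
    with nn[of "- (a + 1) / (2 * b)"] have "0 \<le> a + - (a + 1)" using True by (simp only: mult_zero_right add_0_right)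
    then show False using nn[of "- (a + 1) / (2 * b)"] True by simp
  qed
  then show ?thesis using True by simp
next
  case False
  then have "0 \<le> (a + 2 * (- b / c) * b + (- b / c)^2 * c) * c" using nn[of "- b / c"] c by simp
  also have "\<dots> = a * c - b^2" using False by (simp add: field_simps power2_eq_square)
  finally show ?thesis by simp
qed

lemma L2_D [dest]: "f \<in> L2 M \<Longrightarrow> f \<in> borel_measurable M" "f \<in> L2 M \<Longrightarrow> integrable M (\<lambda>x. (f x)^2)"
  by (auto simp: L2_def)

lemma L2_mult_integrable:
  assumes "f \<in> L2 M" "g \<in> L2 M"
  shows "integrable M (\<lambda>x. f x * g x)"
proof (rule Bochner_Integration.integrable_bound)
  show "integrable M (\<lambda>x. (f x)^2 + (g x)^2)" using assms by auto
  show "(\<lambda>x. f x * g x) \<in> borel_measurable M" using assms by (auto intro!: borel_measurable_times)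
  have "\<bar>a * b\<bar> \<le> a^2 + b^2" for a b :: real
  proof -
    have "2 * \<bar>a * b\<bar> \<le> a^2 + b^2"
      using sum_squares_bound[of "\<bar>a\<bar>" "\<bar>b\<bar>"] by (simp add: abs_mult mult.assoc)
    then show ?thesis by (smt (verit) abs_ge_zero)
  qed
  then show "AE x in M. norm (f x * g x) \<le> norm ((f x)^2 + (g x)^2)" by simp
qed

lemma L2_lincomb:
  assumes "f \<in> L2 M" "g \<in> L2 M"
  shows "(\<lambda>x. a * f x + b * g x) \<in> L2 M"
proof -
  have [measurable]: "f \<in> borel_measurable M" "g \<in> borel_measurable M" using assms by auto
  have "integrable M (\<lambda>x. a^2 * (f x)^2 + b^2 * (g x)^2 + (2 * a * b) * (f x * g x))"
    using assms L2_mult_integrable[OF assms]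
    by (intro Bochner_Integration.integrable_add Bochner_Integration.integrable_mult_right) (auto simp: L2_def)
  then have "integrable M (\<lambda>x. (a * f x + b * g x)^2)"
    by (simp add: power2_eq_square algebra_simps)
  then show ?thesis by (simp add: L2_def)
qed

lemma L2_diff:
  fixes f g :: "'a \<Rightarrow> real"
  shows "f \<in> L2 M \<Longrightarrow> g \<in> L2 M \<Longrightarrow> (\<lambda>x. f x - g x) \<in> L2 M"
  using L2_lincomb[of f _ g 1 "-1"] by simp

lemma L2_integral_square_lincomb:
  assumes "f \<in> L2 M" "g \<in> L2 M"
  shows "(\<integral>x. (f x + t * g x)^2 \<partial>M) =
    (\<integral>x. (f x)^2 \<partial>M) + 2 * t * (\<integral>x. f x * g x \<partial>M) + t^2 * (\<integral>x. (g x)^2 \<partial>M)"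
proof -
  have "(\<integral>x. (f x + t * g x)^2 \<partial>M) = (\<integral>x. (f x)^2 + (2 * t) * (f x * g x) + t^2 * (g x)^2 \<partial>M)"
    by (intro Bochner_Integration.integral_cong) (auto simp: power2_eq_square algebra_simps)
  also have "\<dots> = (\<integral>x. (f x)^2 \<partial>M) + 2 * t * (\<integral>x. f x * g x \<partial>M) + t^2 * (\<integral>x. (g x)^2 \<partial>M)"
    using assms L2_mult_integrable[OF assms] by (auto simp: L2_def)
  finally show ?thesis .
qed

lemma L2_Cauchy_Schwarz:
  assumes "f \<in> L2 M" "g \<in> L2 M"
  shows "(\<integral>x. f x * g x \<partial>M)^2 \<le> (\<integral>x. (f x)^2 \<partial>M) * (\<integral>x. (g x)^2 \<partial>M)"
proof (rule quadratic_nonneg_imp_le)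
  fix t
  have "0 \<le> (\<integral>x. (f x + t * g x)^2 \<partial>M)" by simp
  then show "0 \<le> (\<integral>x. (f x)^2 \<partial>M) + 2 * t * (\<integral>x. f x * g x \<partial>M) + t^2 * (\<integral>x. (g x)^2 \<partial>M)"
    using L2_integral_square_lincomb[OF assms] by simp
qed simp

lemma L2_square_integral_add_le:
  assumes "f \<in> L2 M" "g \<in> L2 M"
  shows "(\<integral>x. (f x + g x)^2 \<partial>M) \<le> 2 * (\<integral>x. (f x)^2 \<partial>M) + 2 * (\<integral>x. (g x)^2 \<partial>M)"
  using L2_integral_square_lincomb[OF assms, of 1] L2_integral_square_lincomb[OF assms, of "-1"]
    Bochner_Integration.integral_nonneg[of M "\<lambda>x. (f x + (-1) * g x)^2"] by simp

context finite_measure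
begin

lemma bounded_in_L2:
  assumes "f \<in> borel_measurable M" "\<And>x. x \<in> space M \<Longrightarrow> \<bar>f x\<bar> \<le> B"
  shows "f \<in> L2 M"
proof -
  have "integrable M (\<lambda>x. (f x)^2)"
    using assms
    by (intro integrable_const_bound[of _ "B^2"] AE_I2) (auto simp: abs_le_square_iff[symmetric] intro: order_trans[OF _ abs_ge_self])
  then show ?thesis using assms by (simp add: L2_def)
qed

lemma L2_const: "(\<lambda>x. c) \<in> L2 M" by (rule bounded_in_L2[of _ "\<bar>c\<bar>"]) auto

lemma L2_integrable: "f \<in> L2 M \<Longrightarrow> integrable M f"
  using L2_mult_integrable[OF _ L2_const[of 1]] by simp

lemma L2_abs: "f \<in> L2 M \<Longrightarrow> (\<lambda>x. \<bar>f x\<bar>) \<in> L2 M" by (auto simp: L2_def)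

lemma L1_le_L2: "f \<in> L2 M \<Longrightarrow> (\<integral>x. \<bar>f x\<bar> \<partial>M)^2 \<le> (\<integral>x. (f x)^2 \<partial>M) * measure M (space M)"
  using L2_Cauchy_Schwarz[OF L2_abs L2_const[of 1]] by simp

text \<open>Since the mass is finite, a Cauchy sequence in mean square is Cauchy in mean, so a
  subsequence converges almost everywhere. Fatou's lemma along that subsequence bounds the distance
  of the whole sequence to its limit.\<close>

lemma L2_complete:
  fixes g :: "nat \<Rightarrow> 'a \<Rightarrow> real"
  assumes g: "\<And>n. g n \<in> L2 M"
    and Cauchy: "\<And>e. 0 < e \<Longrightarrow> \<exists>N. \<forall>m\<ge>N. \<forall>n\<ge>N. (\<integral>x. (g m x - g n x)^2 \<partial>M) < e"
  obtains h where "h \<in> L2 M" "(\<lambda>n. \<integral>x. (g n x - h x)^2 \<partial>M) \<longlonglongrightarrow> 0"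
proof -
  have [measurable]: "g n \<in> borel_measurable M" for n using g by auto
  obtain r where r: "strict_mono r" "AE x in M. Cauchy (\<lambda>i. g (r i) x)"
  proof (rule cauchy_L1_AE_cauchy_subseq[of M g])
    show "integrable M (g n)" for n using g L2_integrable by blast
    fix e :: real assume e: "0 < e"
    \<comment> \<open>The summand 1 keeps the divisor positive when the measure is zero.\<close>
    define V where "V = measure M (space M) + 1"
    have V: "0 < V" by (simp add: V_def add_nonneg_pos)
    obtain N where N: "\<And>m n. N \<le> m \<Longrightarrow> N \<le> n \<Longrightarrow> (\<integral>x. (g m x - g n x)^2 \<partial>M) < e^2 / V"
      using Cauchy[of "e^2 / V"] e V by auto
    have "(\<integral>x. norm (g m x - g n x) \<partial>M) < e" if "N \<le> m" "N \<le> n" for m n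
    proof (rule power_less_imp_less_base[of _ 2])
      have "(\<integral>x. norm (g m x - g n x) \<partial>M)^2 \<le> (\<integral>x. (g m x - g n x)^2 \<partial>M) * measure M (space M)"
        using L1_le_L2[OF L2_diff[OF g g]] by simp
      also have "\<dots> \<le> (\<integral>x. (g m x - g n x)^2 \<partial>M) * V"
        by (intro mult_left_mono) (auto simp: V_def)
      also have "\<dots> < e^2" using N[OF that] V by (simp add: field_simps)
      finally show "(\<integral>x. norm (g m x - g n x) \<partial>M)^2 < e^2" .
    qed (use e in auto)
    then show "\<exists>N. \<forall>i\<ge>N. \<forall>j\<ge>N. (\<integral>x. norm (g i x - g j x) \<partial>M) < e" by blast
  qed auto
  define h where "h x = lim (\<lambda>i. g (r i) x)" for x
  have [measurable]: "h \<in> borel_measurable M" unfolding h_def by measurable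
  have lim: "AE x in M. (\<lambda>i. g (r i) x) \<longlonglongrightarrow> h x"
    using r(2) by eventually_elim (auto simp: h_def Cauchy_convergent_iff convergent_LIMSEQ_iff)
  \<comment> \<open>The nonnegative integral makes sense before \<open>h\<close> is known to be
    square-integrable.\<close>
  define D where "D n = (\<integral>\<^sup>+x. ennreal ((g n x - h x)^2) \<partial>M)" for n
  have bound: "\<exists>N. \<forall>n\<ge>N. D n \<le> ennreal e" if e: "0 < e" for e
  proof -
    obtain N where N: "\<And>m n. N \<le> m \<Longrightarrow> N \<le> n \<Longrightarrow> (\<integral>x. (g m x - g n x)^2 \<partial>M) < e"
      using Cauchy[OF e] by auto
    have "D n \<le> ennreal e" if n: "N \<le> n" for n
    proof -
      have "D n =
          (\<integral>\<^sup>+x. liminf (\<lambda>i. ennreal ((g n x - g (r i) x)^2)) \<partial>M)"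
        unfolding D_def
      proof (rule nn_integral_cong_AE)
        show "AE x in M. ennreal ((g n x - h x)^2) = liminf (\<lambda>i. ennreal ((g n x - g (r i) x)^2))"
          using lim
        proof eventually_elim
          fix x assume "(\<lambda>i. g (r i) x) \<longlonglongrightarrow> h x"
          then have "(\<lambda>i. ennreal ((g n x - g (r i) x)^2)) \<longlonglongrightarrow> ennreal ((g n x - h x)^2)"
            by (intro tendsto_intros)
          then show "ennreal ((g n x - h x)^2) = liminf (\<lambda>i. ennreal ((g n x - g (r i) x)^2))"
            using lim_imp_Liminf[OF trivial_limit_sequentially] by metis
        qed
      qed
      also have "\<dots> \<le> liminf (\<lambda>i. \<integral>\<^sup>+x. ennreal ((g n x - g (r i) x)^2) \<partial>M)"
        by (rule nn_integral_liminf) simp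
      also have "\<dots> \<le> limsup (\<lambda>i. \<integral>\<^sup>+x. ennreal ((g n x - g (r i) x)^2) \<partial>M)"
        by (simp add: Liminf_le_Limsup)
      also have "\<dots> \<le> ennreal e"
      proof (rule Limsup_bounded)
        show "\<forall>\<^sub>F i in sequentially. (\<integral>\<^sup>+x. ennreal ((g n x - g (r i) x)^2) \<partial>M) \<le> ennreal e"
          using eventually_ge_at_top[of N]
        proof eventually_elim
          fix i assume "N \<le> i"
          then have "N \<le> r i" using seq_suble[OF r(1), of i] by simp
          then have "(\<integral>x. (g n x - g (r i) x)^2 \<partial>M) < e" using N n by blast
          moreover have "integrable M (\<lambda>x. (g n x - g (r i) x)^2)" using L2_diff[OF g g] by blast
          ultimately show "(\<integral>\<^sup>+x. ennreal ((g n x - g (r i) x)^2) \<partial>M) \<le> ennreal e"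
            by (simp add: nn_integral_eq_integral ennreal_leI)
        qed
      qed
      finally show ?thesis .
    qed
    then show ?thesis by blast
  qed
  have diff: "(\<lambda>x. g n x - h x) \<in> L2 M" if "D n \<le> ennreal e" for n e
  proof -
    have "D n < \<infinity>" using that by (metis ennreal_less_top infinity_ennreal_def le_less_trans)
    then have "integrable M (\<lambda>x. (g n x - h x)^2)" unfolding D_def by (intro integrableI_nonneg) auto
    then show ?thesis by (simp add: L2_def)
  qed
  obtain n where "D n \<le> ennreal 1" using bound[of 1] by auto
  then have n: "(\<lambda>x. g n x - h x) \<in> L2 M" by (rule diff)
  have h: "h \<in> L2 M" using L2_diff[OF g n, of n] by simp
  have "(\<lambda>n. \<integral>x. (g n x - h x)^2 \<partial>M) \<longlonglongrightarrow> 0"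
  proof (rule LIMSEQ_I)
    fix e :: real assume e: "0 < e"
    obtain N where N: "\<And>n. N \<le> n \<Longrightarrow> D n \<le> ennreal (e / 2)"
      using bound[of "e/2"] e by auto
    have "norm ((\<integral>x. (g n x - h x)^2 \<partial>M) - 0) < e" if "N \<le> n" for n
    proof -
      have "ennreal (\<integral>x. (g n x - h x)^2 \<partial>M) \<le> ennreal (e / 2)"
        using N[OF that] diff[OF N[OF that]] unfolding D_def by (subst nn_integral_eq_integral[symmetric]) auto
      then show ?thesis using e by (simp add: ennreal_le_iff)
    qed
    then show "\<exists>N. \<forall>n\<ge>N. norm ((\<integral>x. (g n x - h x)^2 \<partial>M) - 0) < e" by blast
  qed
  with h that show thesis by blast
qed

end

section \<open>Weak derivatives on an interval\<close>

abbreviation IM :: "real \<Rightarrow> real measure" where "IM \<equiv> interval_measure_on"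

lemma space_IM [simp]: "space (IM l) = {0<..<l}"
  by (simp add: interval_measure_on_def space_restrict_space)

lemma finite_measure_IM: "finite_measure (IM l)"
proof
  have "emeasure lborel {0<..<l} < \<infinity>" by (intro emeasure_bounded_finite) simp
  then show "emeasure (IM l) (space (IM l)) \<noteq> \<infinity>"
    unfolding space_IM by (simp add: interval_measure_on_def emeasure_restrict_space)
qed

lemma borel_measurable_IM:
  assumes "continuous_on {0<..<l} u"
  shows "u \<in> borel_measurable (IM l)"
proof -
  have "sets (IM l) = sets (restrict_space borel {0<..<l})"
    unfolding interval_measure_on_def by (rule sets_restrict_space_cong) simp
  then show ?thesis
    using borel_measurable_continuous_on_restrict[OF assms] measurable_cong_sets by blast
qed

lemma continuous_Icc_bounded:
  assumes "continuous_on {0..l::real} (u :: real \<Rightarrow> real)"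
  obtains K where "0 \<le> K" "\<And>x. x \<in> {0..l} \<Longrightarrow> \<bar>u x\<bar> \<le> K"
proof -
  have "bounded (u ` {0..l})" using assms by (intro compact_imp_bounded compact_continuous_image) auto
  then obtain K where "\<And>x. x \<in> {0..l} \<Longrightarrow> \<bar>u x\<bar> \<le> K" unfolding bounded_iff by (metis imageI real_norm_def)
  then show thesis using that[of "max K 0"] by fastforce
qed

lemma continuous_in_L2:
  assumes "continuous_on {0..l} u"
  shows "u \<in> L2 (IM l)"
proof -
  interpret finite_measure "IM l" by (rule finite_measure_IM)
  obtain K where "\<And>x. x \<in> {0..l} \<Longrightarrow> \<bar>u x\<bar> \<le> K" using continuous_Icc_bounded[OF assms] by blast
  then show ?thesis
    by (intro bounded_in_L2[of _ K] borel_measurable_IM continuous_on_subset[OF assms]) auto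
qed

lemma integral_IM:
  fixes f :: "real \<Rightarrow> real"
  assumes [measurable]: "f \<in> borel_measurable borel"
  shows "integral\<^sup>L (IM l) f = (\<integral>x. f x * indicator {0..l} x \<partial>lborel)"
proof -
  have "integral\<^sup>L (IM l) f = (\<integral>x. indicator {0<..<l} x *\<^sub>R f x \<partial>lborel)"
    unfolding interval_measure_on_def by (rule integral_restrict_space) auto
  also have "\<dots> = (\<integral>x. f x * indicator {0..l} x \<partial>lborel)"
  proof (rule Bochner_Integration.integral_cong_AE)
    have "AE x in lborel. x \<noteq> 0 \<and> x \<noteq> l" by (simp add: AE_lborel_singleton)
    then show "AE x in lborel. indicator {0<..<l} x *\<^sub>R f x = f x * indicator {0..l} x"
      by eventually_elim (auto simp: indicator_def)
  qed auto
  finally show ?thesis .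
qed

lemma integral_IM_FTC:
  assumes "0 < l" and F: "\<And>x. (F has_real_derivative f x) (at x)" and f: "\<And>x. isCont f x"
  shows "integral\<^sup>L (IM l) f = F l - F 0"
proof -
  have "f \<in> borel_measurable borel"
    using f by (intro borel_measurable_continuous_onI continuous_at_imp_continuous_on) auto
  then show ?thesis using assms by (subst integral_IM) (auto intro!: integral_FTC_Icc_real)
qed

lemma test_function_smooth: "test_function l \<phi> \<Longrightarrow> smooth \<phi>"
  by (auto simp: test_function_def smooth_def)

lemma smooth_isCont: "smooth f \<Longrightarrow> isCont f x"
  by (rule DERIV_isCont[OF smooth_has_derivative])

lemma isCont_continuous_on: "(\<And>x. isCont f x) \<Longrightarrow> continuous_on A f"
  by (simp add: continuous_at_imp_continuous_on)

lemma test_function_continuous: "test_function l \<phi> \<Longrightarrow> continuous_on A \<phi>"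
  by (intro isCont_continuous_on smooth_isCont test_function_smooth)

lemma test_function_deriv_continuous: "test_function l \<phi> \<Longrightarrow> continuous_on A (deriv \<phi>)"
  by (intro isCont_continuous_on smooth_isCont smooth_deriv test_function_smooth)

lemma test_function_L2: "test_function l \<phi> \<Longrightarrow> \<phi> \<in> L2 (IM l')" "test_function l \<phi> \<Longrightarrow> deriv \<phi> \<in> L2 (IM l')"
  by (simp_all add: continuous_in_L2 test_function_continuous test_function_deriv_continuous)

lemma has_weak_deriv_lincomb:
  assumes u: "u \<in> L2 (IM l)" "v \<in> L2 (IM l)" "g \<in> L2 (IM l)" "h \<in> L2 (IM l)"
    and w: "has_weak_deriv l u g" "has_weak_deriv l v h"
  shows "has_weak_deriv l (\<lambda>x. a * u x + b * v x) (\<lambda>x. a * g x + b * h x)"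
  unfolding has_weak_deriv_def
proof (intro allI impI)
  fix \<phi> assume t: "test_function l \<phi>"
  have lin: "(\<integral>x. (a * p x + b * q x) * r x \<partial>IM l) = a * (\<integral>x. p x * r x \<partial>IM l) + b * (\<integral>x. q x * r x \<partial>IM l)"
    if "p \<in> L2 (IM l)" "q \<in> L2 (IM l)" "r \<in> L2 (IM l)" for p q r
  proof -
    have "(\<integral>x. (a * p x + b * q x) * r x \<partial>IM l) = (\<integral>x. a * (p x * r x) + b * (q x * r x) \<partial>IM l)"
      by (simp add: algebra_simps)
    then show ?thesis using L2_mult_integrable[OF that(1,3)] L2_mult_integrable[OF that(2,3)] by simp
  qed
  show "(\<integral>x. (a * u x + b * v x) * deriv \<phi> x \<partial>IM l) = - (\<integral>x. (a * g x + b * h x) * \<phi> x \<partial>IM l)"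
    using w t u test_function_L2[OF t] by (simp add: lin has_weak_deriv_def)
qed

text \<open>Integration by parts; the boundary terms vanish with the test function. Through this,
  interpolating polynomials enter the Sobolev space.\<close>

lemma has_weak_deriv_C1:
  assumes l: "0 < l" and p: "\<And>x. (p has_real_derivative p' x) (at x)" and p': "\<And>x. isCont p' x"
  shows "has_weak_deriv l p p'"
  unfolding has_weak_deriv_def
proof (intro allI impI)
  fix \<phi> assume t: "test_function l \<phi>"
  have pL: "p \<in> L2 (IM l)" "p' \<in> L2 (IM l)"
    by (intro continuous_in_L2 isCont_continuous_on DERIV_isCont[OF p] p')+
  have d: "(\<phi> has_real_derivative deriv \<phi> x) (at x)" "isCont (deriv \<phi>) x" for x
    using test_function_smooth[OF t] by (simp_all add: smooth_has_derivative smooth_isCont smooth_deriv)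
  have z: "\<phi> l = 0" "\<phi> 0 = 0" using t by (auto simp: test_function_def)
  have "(\<integral>x. p' x * \<phi> x + p x * deriv \<phi> x \<partial>IM l) = p l * \<phi> l - p 0 * \<phi> 0"
    by (rule integral_IM_FTC[OF l, of "\<lambda>x. p x * \<phi> x"])
      (auto intro!: derivative_eq_intros p d continuous_intros p' DERIV_isCont[OF p] DERIV_isCont[OF d(1)])
  then show "(\<integral>x. p x * deriv \<phi> x \<partial>IM l) = - (\<integral>x. p' x * \<phi> x \<partial>IM l)"
    using L2_mult_integrable[OF pL(1) test_function_L2(2)[OF t]]
      L2_mult_integrable[OF pL(2) test_function_L2(1)[OF t]] z by simp
qed

lemma C1_in_sobolev_H1:
  assumes l: "0 < l" and p: "\<And>x. (p has_real_derivative p' x) (at x)" and p': "\<And>x. isCont p' x"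
  shows "p \<in> sobolev_H1 l"
proof -
  have "p \<in> L2 (IM l)" "p' \<in> L2 (IM l)"
    by (intro continuous_in_L2 isCont_continuous_on DERIV_isCont[OF p] p')+
  then show ?thesis unfolding sobolev_H1_def using has_weak_deriv_C1[OF assms] by blast
qed

section \<open>Continuous functions as integrals of their weak derivatives\<close>

lemma indicator_IM_measurable [measurable]: "A \<in> sets borel \<Longrightarrow> (indicator A :: real \<Rightarrow> real) \<in> borel_measurable (IM l)"
  unfolding interval_measure_on_def by (intro measurable_restrict_space1) simp

lemma L2_mult_indicator:
  assumes "g \<in> L2 (IM l)" "A \<in> sets borel"
  shows "(\<lambda>x. g x * indicator A x) \<in> L2 (IM l)"
proof -
  have [measurable]: "g \<in> borel_measurable (IM l)" using assms by auto
  note indicator_IM_measurable[OF assms(2), measurable]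
  have "integrable (IM l) (\<lambda>x. (g x * indicator A x)^2)"
  proof (rule Bochner_Integration.integrable_bound[OF L2_D(2)[OF assms(1)]])
    show "(\<lambda>x. (g x * indicator A x)^2) \<in> borel_measurable (IM l)" by measurable
    show "AE x in IM l. norm ((g x * indicator A x)^2) \<le> norm ((g x)^2)"
      by (auto simp: indicator_def)
  qed
  then show ?thesis by (simp add: L2_def)
qed

text \<open>The test functions are differences of two rescaled smooth steps, which converge to the indicator
  of \<open>{s<..t}\<close> while their derivatives concentrate at \<open>s\<close> and \<open>t\<close>.\<close>

lemma has_weak_deriv_FTC_interior:
  assumes u: "continuous_on {0..l} u" and g: "g \<in> L2 (IM l)" and w: "has_weak_deriv l u g"
    and s: "0 < s" "s < t" "t < l"
  shows "u t - u s = (\<integral>x. g x * indicator {s<..t} x \<partial>IM l)"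
proof -
  interpret finite_measure "IM l" by (rule finite_measure_IM)
  obtain B :: "real \<Rightarrow> real" where B: "smooth B" "\<And>x. x \<le> 0 \<Longrightarrow> B x = 0" "\<And>x. 1 \<le> x \<Longrightarrow> B x = 1"
    "\<And>x. 0 \<le> deriv B x" "\<And>x. 0 \<le> B x \<and> B x \<le> 1" "\<And>x. x \<notin> {0..1} \<Longrightarrow> deriv B x = 0"
    using smooth_step_exists by blast
  have Bc: "isCont B x" "isCont (deriv B) x" for x
    using B(1) by (simp_all add: smooth_isCont smooth_deriv)
  have dB: "((\<lambda>x. B (m * (x - c))) has_real_derivative m * deriv B (m * (x - c))) (at x)" for m c x
  proof -
    have "((\<lambda>x. m * (x - c)) has_real_derivative m) (at x)" by (auto intro!: derivative_eq_intros)
    from DERIV_chain2[OF smooth_has_derivative[OF B(1)] this] show ?thesis by (simp add: mult.commute)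
  qed
  \<comment> \<open>Starting the scales at \<open>N\<close> keeps the support
    \<open>{s..t + 1 / m n}\<close> of every test function inside the open interval.\<close>
  obtain N where N: "0 < N" "t + 1 / real N < l"
  proof -
    obtain N where "1 / real (Suc N) < l - t" using s nat_approx_posE[of "l - t"] by auto
    then show thesis using that[of "Suc N"] by simp
  qed
  define m where "m n = real (n + N)" for n
  have m: "0 < m n" "t + 1 / m n < l" for n
  proof -
    show "0 < m n" using N(1) by (simp add: m_def)
    have "1 / m n \<le> 1 / real N" using N(1) by (simp add: m_def frac_le)
    then show "t + 1 / m n < l" using N(2) by simp
  qed
  have m_lim: "filterlim m at_top sequentially"
    unfolding m_def using filterlim_real_sequentially
    by (rule filterlim_compose) (rule filterlim_add_const_nat_at_top)
  define \<phi> where "\<phi> n x = B (m n * (x - s)) - B (m n * (x - t))" for n x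
  have \<phi>d: "(\<phi> n has_real_derivative m n * deriv B (m n * (x - s)) - m n * deriv B (m n * (x - t))) (at x)" for n x
    unfolding \<phi>_def by (intro DERIV_diff dB)
  have \<phi>: "test_function l (\<phi> n)" for n
    unfolding test_function_def
  proof (intro conjI)
    show "\<forall>k x. (deriv ^^ k) (\<phi> n) field_differentiable at x"
      using smooth_diff_affine[OF B(1), of "m n" s t] unfolding smooth_def \<phi>_def .
    have "\<phi> n x = 0" if "x \<notin> {s..t + 1 / m n}" for x
    proof (cases "x < s")
      case True
      then show ?thesis using s m(1)[of n] by (simp add: \<phi>_def B(2) mult_nonneg_nonpos)
    next
      case False
      then have x: "t + 1 / m n < x" using that by auto
      then have "1 \<le> m n * (x - t)" using m(1)[of n] by (simp add: field_simps)
      moreover have "m n * (x - t) \<le> m n * (x - s)" using s m(1)[of n] by simp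
      ultimately show ?thesis by (simp add: \<phi>_def B(3))
    qed
    then show "\<exists>a b. 0 < a \<and> b < l \<and> (\<forall>x. x \<notin> {a..b} \<longrightarrow> \<phi> n x = 0)" using s m(2)[of n] by blast
  qed
  \<comment> \<open>The weight \<open>m n * deriv B (m n * (x - c))\<close> is nonnegative, has
    integral one and is concentrated on \<open>{c..c + 1 / m n}\<close>, so it is an approximate
    identity at \<open>c\<close>.\<close>
  have point: "(\<lambda>n. \<integral>x. u x * (m n * deriv B (m n * (x - c))) \<partial>IM l) \<longlonglongrightarrow> u c"
    if c: "0 < c" "c \<le> t" for c
  proof (rule LIMSEQ_I)
    fix e :: real assume e: "0 < e"
    have "isCont u c" using u c s by (simp add: continuous_on_interior)
    then obtain d where d: "0 < d" "\<And>x. \<bar>x - c\<bar> < d \<Longrightarrow> \<bar>u x - u c\<bar> < e / 2"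
      using e unfolding continuous_at_eps_delta dist_real_def by (metis half_gt_zero)
    have "\<forall>\<^sub>F n in sequentially. 1 / d < m n" using m_lim by (simp add: filterlim_at_top_dense)
    then obtain n0 where n0: "\<And>n. n0 \<le> n \<Longrightarrow> 1 / d < m n" by (auto simp: eventually_sequentially)
    have "norm ((\<integral>x. u x * (m n * deriv B (m n * (x - c))) \<partial>IM l) - u c) < e" if n: "n0 \<le> n" for n
    proof -
      define \<rho> where "\<rho> x = m n * deriv B (m n * (x - c))" for x
      have \<rho>0: "0 \<le> \<rho> x" for x unfolding \<rho>_def using m(1)[of n] B(4) by simp
      have \<rho>c: "isCont \<rho> x" for x
        unfolding \<rho>_def by (intro continuous_intros isCont_o2[OF _ Bc(2)])
      have \<rho>L: "\<rho> \<in> L2 (IM l)" using \<rho>c by (intro continuous_in_L2 continuous_at_imp_continuous_on) auto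
      have uL: "u \<in> L2 (IM l)" using continuous_in_L2[OF u] .
      have "m n * (0 - c) \<le> 0" using c m(1)[of n] by simp
      moreover have "1 \<le> m n * (l - c)"
      proof -
        have "1 / m n \<le> l - c" using m(2)[of n] c by simp
        then show ?thesis using m(1)[of n] by (simp add: field_simps)
      qed
      ultimately have I: "integral\<^sup>L (IM l) \<rho> = 1"
        using integral_IM_FTC[of l "\<lambda>x. B (m n * (x - c))" \<rho>] \<rho>c dB s B(2)[of "m n * (0 - c)"] B(3)[of "m n * (l - c)"]
        by (simp add: \<rho>_def[abs_def])
      have small: "\<bar>u x - u c\<bar> * \<rho> x \<le> e / 2 * \<rho> x" for x
      proof (cases "\<bar>x - c\<bar> < d")
        case True
        then show ?thesis using d(2)[of x] \<rho>0[of x] by (intro mult_right_mono) auto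
      next
        case False
        have "m n * (x - c) \<notin> {0..1}"
        proof
          assume "m n * (x - c) \<in> {0..1}"
          then have "0 \<le> x - c" "x - c \<le> 1 / m n" using m(1)[of n] by (auto simp: zero_le_mult_iff field_simps)
          moreover have "1 / m n < d" using n0[OF n] d(1) m(1)[of n] by (simp add: field_simps)
          ultimately show False using False by simp
        qed
        then show ?thesis using B(6) by (simp add: \<rho>_def)
      qed
      have int: "integrable (IM l) (\<lambda>x. u x * \<rho> x)" "integrable (IM l) \<rho>"
        using L2_mult_integrable[OF uL \<rho>L] L2_integrable[OF \<rho>L] .
      have eq: "(\<integral>x. u x * \<rho> x \<partial>IM l) - u c = (\<integral>x. (u x - u c) * \<rho> x \<partial>IM l)"
        using int I by (simp add: left_diff_distrib)
      have "\<bar>\<integral>x. (u x - u c) * \<rho> x \<partial>IM l\<bar> \<le> (\<integral>x. \<bar>(u x - u c) * \<rho> x\<bar> \<partial>IM l)"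
        by (rule integral_abs_bound)
      also have "\<dots> \<le> (\<integral>x. e / 2 * \<rho> x \<partial>IM l)"
      proof (rule integral_mono)
          show "integrable (IM l) (\<lambda>x. \<bar>(u x - u c) * \<rho> x\<bar>)" "integrable (IM l) (\<lambda>x. e / 2 * \<rho> x)"
            using int by (auto simp: left_diff_distrib)
          show "\<bar>(u x - u c) * \<rho> x\<bar> \<le> e / 2 * \<rho> x" for x
            using small[of x] \<rho>0[of x] by (simp only: abs_mult abs_of_nonneg)
        qed
      also have "\<dots> = e / 2" using I by simp
      finally show ?thesis using eq e unfolding \<rho>_def by simp
    qed
    then show "\<exists>n0. \<forall>n\<ge>n0. norm ((\<integral>x. u x * (m n * deriv B (m n * (x - c))) \<partial>IM l) - u c) < e" by blast
  qed
  have lhs: "(\<lambda>n. \<integral>x. u x * deriv (\<phi> n) x \<partial>IM l) \<longlonglongrightarrow> u s - u t"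
  proof -
    have "(\<integral>x. u x * deriv (\<phi> n) x \<partial>IM l) =
        (\<integral>x. u x * (m n * deriv B (m n * (x - s))) \<partial>IM l) - (\<integral>x. u x * (m n * deriv B (m n * (x - t))) \<partial>IM l)" for n
    proof -
      have "integrable (IM l) (\<lambda>x. u x * (m n * deriv B (m n * (x - c))))" for c
        by (intro L2_mult_integrable continuous_in_L2 u continuous_at_imp_continuous_on ballI
            continuous_intros isCont_o2[OF _ Bc(2)])
      then show ?thesis using DERIV_imp_deriv[OF \<phi>d] by (simp add: right_diff_distrib)
    qed
    then show ?thesis using tendsto_diff[OF point[of s] point[of t]] s by simp
  qed
  have [measurable]: "g \<in> borel_measurable (IM l)" using g by auto
  have rhs: "(\<lambda>n. \<integral>x. g x * \<phi> n x \<partial>IM l) \<longlonglongrightarrow> (\<integral>x. g x * indicator {s<..t} x \<partial>IM l)"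
  proof (rule integral_dominated_convergence)
    show "(\<lambda>x. g x * \<phi> n x) \<in> borel_measurable (IM l)" for n
      using test_function_L2[OF \<phi>] by (auto intro!: borel_measurable_times)
    show "(\<lambda>x. g x * indicator {s<..t} x) \<in> borel_measurable (IM l)"
      using L2_mult_indicator[OF g] by auto
    show "integrable (IM l) (\<lambda>x. \<bar>g x\<bar>)" using L2_integrable[OF g] by simp
    show "AE x in IM l. norm (g x * \<phi> n x) \<le> \<bar>g x\<bar>" for n
    proof (rule AE_I2)
      fix x
      have "\<bar>\<phi> n x\<bar> \<le> 1" unfolding \<phi>_def using B(5)[of "m n * (x - s)"] B(5)[of "m n * (x - t)"] by linarith
      then show "norm (g x * \<phi> n x) \<le> \<bar>g x\<bar>" by (simp add: abs_mult mult_left_le)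
    qed
    show "AE x in IM l. (\<lambda>n. g x * \<phi> n x) \<longlonglongrightarrow> g x * indicator {s<..t} x"
    proof (rule AE_I2)
      fix x
      \<comment> \<open>At \<open>x = c\<close> the value is \<open>B 0 = 0\<close> for every
        \<open>n\<close>; hence the limit is the indicator of the open ray, and the limiting
        intervals are closed on the right only.\<close>
      have step: "(\<lambda>n. B (m n * (x - c))) \<longlonglongrightarrow> indicator {c<..} x" for c
      proof (cases "c < x")
        case True
        have "\<forall>\<^sub>F n in sequentially. 1 / (x - c) < m n" using m_lim by (simp add: filterlim_at_top_dense)
        then have "\<forall>\<^sub>F n in sequentially. B (m n * (x - c)) = indicator {c<..} x"
        proof eventually_elim
          fix n assume "1 / (x - c) < m n"
          then have "1 \<le> m n * (x - c)" using True by (simp add: field_simps)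
          then show "B (m n * (x - c)) = indicator {c<..} x" using True B(3) by simp
        qed
        then show ?thesis by (rule tendsto_eventually)
      next
        case False
        then show ?thesis using m(1) by (simp add: B(2) mult_nonneg_nonpos less_imp_le)
      qed
      have "(\<lambda>n. \<phi> n x) \<longlonglongrightarrow> indicator {s<..} x - indicator {t<..} x"
        unfolding \<phi>_def by (intro tendsto_diff step)
      also have "indicator {s<..} x - indicator {t<..} x = (indicator {s<..t} x :: real)"
        using s by (auto simp: indicator_def)
      finally show "(\<lambda>n. g x * \<phi> n x) \<longlonglongrightarrow> g x * indicator {s<..t} x" by (intro tendsto_intros)
    qed
  qed
  have "(\<lambda>n. \<integral>x. u x * deriv (\<phi> n) x \<partial>IM l) \<longlonglongrightarrow> - (\<integral>x. g x * indicator {s<..t} x \<partial>IM l)"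
    using tendsto_minus[OF rhs] w \<phi> by (simp add: has_weak_deriv_def)
  then show ?thesis using LIMSEQ_unique[OF lhs] by fastforce
qed

text \<open>Continuity of \<open>u\<close> up to the ends of the interval lets the interior identity
  pass to the limit along shrunken intervals.\<close>

lemma has_weak_deriv_FTC:
  assumes u: "continuous_on {0..l} u" and g: "g \<in> L2 (IM l)" and w: "has_weak_deriv l u g"
    and s: "0 \<le> s" "s \<le> t" "t \<le> l"
  shows "u t - u s = (\<integral>x. g x * indicator {s<..<t} x \<partial>IM l)"
proof (cases "s = t")
  case False
  then have st: "s < t" using s by simp
  interpret finite_measure "IM l" by (rule finite_measure_IM)
  \<comment> \<open>The offset 3 makes already the first margin smaller than half the length, so the
    shrunken endpoints stay in order.\<close>
  define d where "d n = (t - s) / real (n + 3)" for n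
  have d: "0 < d n" "d n < (t - s) / 2" for n
    using st divide_strict_left_mono[of 2 "real (n + 3)" "t - s"] by (auto simp: d_def)
  have d0: "d \<longlonglongrightarrow> 0"
    unfolding d_def by (rule LIMSEQ_ignore_initial_segment[OF lim_const_over_n])
  have FTC: "u (t - d n) - u (s + d n) = (\<integral>x. g x * indicator {s + d n<..t - d n} x \<partial>IM l)" for n
    using d[of n] s by (intro has_weak_deriv_FTC_interior[OF u g w]) auto
  have [measurable]: "g \<in> borel_measurable (IM l)" using g by auto
  have 1: "(\<lambda>n. u (t - d n) - u (s + d n)) \<longlonglongrightarrow> u t - u s"
  proof (intro tendsto_diff)
    have mem: "t - d n \<in> {0..l}" "s + d n \<in> {0..l}" for n using s d[of n] by auto
    have "(\<lambda>n. t - d n) \<longlonglongrightarrow> t" "(\<lambda>n. s + d n) \<longlonglongrightarrow> s"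
      using tendsto_diff[OF tendsto_const d0, of t] tendsto_add[OF tendsto_const d0, of s] by simp_all
    then show "(\<lambda>n. u (t - d n)) \<longlonglongrightarrow> u t" "(\<lambda>n. u (s + d n)) \<longlonglongrightarrow> u s"
      using mem s by (auto intro!: continuous_on_tendsto_compose[OF u])
  qed
  have 2: "(\<lambda>n. \<integral>x. g x * indicator {s + d n<..t - d n} x \<partial>IM l) \<longlonglongrightarrow> (\<integral>x. g x * indicator {s<..<t} x \<partial>IM l)"
  proof (rule integral_dominated_convergence)
    show "(\<lambda>x. g x * indicator {s<..<t} x) \<in> borel_measurable (IM l)" by measurable
    show "(\<lambda>x. g x * indicator {s + d n<..t - d n} x) \<in> borel_measurable (IM l)" for n by measurable
    show "integrable (IM l) (\<lambda>x. \<bar>g x\<bar>)" using L2_integrable[OF g] by simp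
    show "AE x in IM l. norm (g x * indicator {s + d n<..t - d n} x) \<le> \<bar>g x\<bar>" for n
      by (auto simp: indicator_def)
    show "AE x in IM l. (\<lambda>n. g x * indicator {s + d n<..t - d n} x) \<longlonglongrightarrow> g x * indicator {s<..<t} x"
    proof (rule AE_I2)
      fix x
      have "\<forall>\<^sub>F n in sequentially. (indicator {s + d n<..t - d n} x :: real) = indicator {s<..<t} x"
      proof (cases "s < x \<and> x < t")
        case True
        then have "\<forall>\<^sub>F n in sequentially. d n < min (x - s) (t - x)"
          by (intro order_tendstoD[OF d0]) auto
        then show ?thesis by eventually_elim (use True d(1) in \<open>auto simp: indicator_def\<close>)
      next
        case False
        then have "(indicator {s + d n<..t - d n} x :: real) = indicator {s<..<t} x" for n
          using d(1)[of n] by (auto simp: indicator_def)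
        then show ?thesis by simp
      qed
      then show "(\<lambda>n. g x * indicator {s + d n<..t - d n} x) \<longlonglongrightarrow> g x * indicator {s<..<t} x"
        by (intro tendsto_intros tendsto_eventually)
    qed
  qed
  show ?thesis using LIMSEQ_unique[OF 1] 2 unfolding FTC by blast
qed simp

text \<open>Cauchy-Schwarz for the weak derivative against the indicator of the interval. This
  estimate is the source of the equicontinuity and of the sup bounds below.\<close>

lemma has_weak_deriv_Hoelder:
  assumes u: "continuous_on {0..l} u" and g: "g \<in> L2 (IM l)" and w: "has_weak_deriv l u g"
    and s: "0 \<le> s" "s \<le> t" "t \<le> l"
  shows "(u t - u s)^2 \<le> (t - s) * (\<integral>x. (g x)^2 \<partial>IM l)"
proof -
  have i: "(\<integral>x. indicator {s<..<t} x \<partial>IM l) = t - s"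
  proof -
    have "(\<integral>x. indicator {s<..<t} x \<partial>IM l) = (\<integral>x. indicator {0<..<l} x *\<^sub>R (indicator {s<..<t} x :: real) \<partial>lborel)"
      unfolding interval_measure_on_def by (rule integral_restrict_space) auto
    also have "\<dots> = (\<integral>x. indicator {s<..<t} x \<partial>lborel)"
      using s by (intro Bochner_Integration.integral_cong) (auto simp: indicator_def)
    also have "\<dots> = t - s" using s by simp
    finally show ?thesis .
  qed
  have iL: "indicator {s<..<t} \<in> L2 (IM l)"
    using L2_mult_indicator[of "\<lambda>x. 1" l "{s<..<t}"] finite_measure.L2_const[OF finite_measure_IM] by simp
  have "(u t - u s)^2 \<le> (\<integral>x. (g x)^2 \<partial>IM l) * (\<integral>x. (indicator {s<..<t} x)^2 \<partial>IM l)"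
    unfolding has_weak_deriv_FTC[OF assms] by (rule L2_Cauchy_Schwarz[OF g iL])
  also have "(\<integral>x. (indicator {s<..<t} x)^2 \<partial>IM l) = t - s"
    unfolding i[symmetric] by (intro Bochner_Integration.integral_cong) (auto simp: indicator_def)
  finally show ?thesis by (simp add: mult.commute)
qed

text \<open>The integral formula for the zero function says that the integrals of \<open>g\<close>
  over initial intervals vanish. These intervals generate the Borel sets and are stable under
  intersection, so all Borel integrals vanish, and with them \<open>g\<close> almost
  everywhere.\<close>

lemma weak_deriv_zero_AE:
  assumes l: "0 < l" and g: "g \<in> L2 (IM l)" and w: "has_weak_deriv l (\<lambda>x. 0) g"
  shows "AE x in IM l. g x = 0"
proof -
  define h where "h x = indicator {0<..<l} x *\<^sub>R g x" for x
  interpret finite_measure "IM l" by (rule finite_measure_IM)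
  have int: "integrable lborel h"
    using L2_integrable[OF g] unfolding h_def interval_measure_on_def
    by (simp add: integrable_restrict_space)
  have [measurable]: "h \<in> borel_measurable borel" using borel_measurable_integrable[OF int] by simp
  have zero: "(\<integral>x. g x * indicator {0<..<t} x \<partial>IM l) = 0" if "0 \<le> t" "t \<le> l" for t
    using has_weak_deriv_FTC[OF _ g w, of 0 t] that by simp
  have h_eq: "(\<integral>x. indicator A x * h x \<partial>lborel) = (\<integral>x. g x * indicator A x \<partial>IM l)" for A
  proof -
    have "(\<integral>x. g x * indicator A x \<partial>IM l) = (\<integral>x. indicator {0<..<l} x *\<^sub>R (g x * indicator A x) \<partial>lborel)"
      unfolding interval_measure_on_def by (rule integral_restrict_space) auto
    then show ?thesis by (simp add: h_def mult_ac)
  qed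
  have atMost: "(\<integral>x. indicator {..t} x * h x \<partial>lborel) = 0" for t
  proof -
    have "AE x in lborel. x \<noteq> t" by (simp add: AE_lborel_singleton)
    \<comment> \<open>\<open>h\<close> lives on \<open>{0<..<l}\<close>, so a ray cuts out an
      initial interval, with \<open>t\<close> clipped to the edge; the two sides can differ only at
      \<open>x = t\<close>.\<close>
    then have ae: "AE x in lborel. indicator {..t} x * h x = indicator {0<..<max 0 (min t l)} x * h x"
      by eventually_elim (auto simp: h_def indicator_def)
    have "(\<integral>x. indicator {..t} x * h x \<partial>lborel) = (\<integral>x. indicator {0<..<max 0 (min t l)} x * h x \<partial>lborel)"
      by (rule Bochner_Integration.integral_cong_AE) (use ae in auto)
    also have "\<dots> = 0" using l by (subst h_eq) (auto intro!: zero)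
    finally show ?thesis .
  qed
  have int': "integrable lborel (\<lambda>x. indicator A x * h x)" if "A \<in> sets borel" for A
    using integrable_mult_indicator[OF _ int, of A] that by simp
  have whole: "(\<integral>x. h x \<partial>lborel) = 0"
  proof -
    have "(\<lambda>x. indicator {..l} x * h x) = h" by (auto simp: h_def indicator_def)
    then show ?thesis using atMost[of l] by simp
  qed
  have "(\<integral>x. indicator A x * h x \<partial>lborel) = 0" if "A \<in> sets borel" for A
  proof -
    have "Int_stable (range (\<lambda>a::real. {..a}))"
      by (auto simp: Int_stable_def min_def intro: exI[of _ "min _ _"])
    moreover have "range (\<lambda>a::real. {..a}) \<subseteq> Pow UNIV" by simp
    moreover have "A \<in> sigma_sets UNIV (range (\<lambda>a::real. {..a}))"
      using that unfolding borel_eq_atMost by simp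
    ultimately show ?thesis
    proof (induction rule: sigma_sets_induct_disjoint)
      case (basic A)
      then show ?case using atMost by auto
    next
      case empty
      then show ?case by simp
    next
      case (compl A)
      then have A: "A \<in> sets borel" unfolding borel_eq_atMost by simp
      have "(\<integral>x. indicator (UNIV - A) x * h x \<partial>lborel) = (\<integral>x. h x - indicator A x * h x \<partial>lborel)"
        by (intro Bochner_Integration.integral_cong) (auto simp: indicator_def)
      then show ?case using int int'[OF A] whole compl by simp
    next
      case (union A)
      have A: "A i \<in> sets borel" for i using union(2) unfolding borel_eq_atMost by auto
      have "(\<integral>x. indicator (\<Union>i. A i) x *\<^sub>R h x \<partial>lborel) = (\<Sum>i. \<integral>x. indicator (A i) x *\<^sub>R h x \<partial>lborel)"
        using lebesgue_integral_countable_add[where M = lborel and A = A and f = h] A union(1) int'[of "\<Union>i. A i"]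
        by (auto simp: set_integrable_def set_lebesgue_integral_def disjoint_family_on_def)
      then show ?case using union(3) by simp
    qed
  qed
  then have "AE x in lborel. h x = 0"
    by (intro density_unique_real[of lborel h "\<lambda>x. 0"] int)
      (auto simp: set_lebesgue_integral_def)
  then show ?thesis
    unfolding interval_measure_on_def by (subst AE_restrict_space_iff) (auto simp: h_def)
qed

lemma weak_deriv_unique_AE:
  assumes l: "0 < l" and u: "u \<in> L2 (IM l)" and g: "g \<in> L2 (IM l)" "has_weak_deriv l u g"
    and h: "h \<in> L2 (IM l)" "has_weak_deriv l u h"
  shows "AE x in IM l. g x = h x"
proof -
  have "has_weak_deriv l (\<lambda>x. 1 * u x + (-1) * u x) (\<lambda>x. 1 * g x + (-1) * h x)"
    by (rule has_weak_deriv_lincomb) (use assms in auto)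
  then have "AE x in IM l. g x - h x = 0" using weak_deriv_zero_AE[OF l L2_diff[OF g(1) h(1)]] by simp
  then show ?thesis by simp
qed

lemma weak_deriv_props:
  assumes "u \<in> sobolev_H1 l"
  shows "u \<in> L2 (IM l)" "weak_deriv l u \<in> L2 (IM l)" "has_weak_deriv l u (weak_deriv l u)"
proof -
  show "u \<in> L2 (IM l)" using assms by (simp add: sobolev_H1_def)
  have "\<exists>g. g \<in> L2 (IM l) \<and> has_weak_deriv l u g" using assms by (auto simp: sobolev_H1_def)
  from someI_ex[OF this] show "weak_deriv l u \<in> L2 (IM l)" "has_weak_deriv l u (weak_deriv l u)"
    by (simp_all add: weak_deriv_def)
qed

lemma sobolev_H1_lincomb:
  assumes "u \<in> sobolev_H1 l" "v \<in> sobolev_H1 l"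
  shows "(\<lambda>x. a * u x + b * v x) \<in> sobolev_H1 l"
  using has_weak_deriv_lincomb[OF weak_deriv_props(1)[OF assms(1)] weak_deriv_props(1)[OF assms(2)]
      weak_deriv_props(2)[OF assms(1)] weak_deriv_props(2)[OF assms(2)]
      weak_deriv_props(3)[OF assms(1)] weak_deriv_props(3)[OF assms(2)], of a b]
  unfolding sobolev_H1_def using L2_lincomb weak_deriv_props assms by blast

lemma weak_deriv_AE_eq:
  assumes "0 < l" "u \<in> L2 (IM l)" "g \<in> L2 (IM l)" "has_weak_deriv l u g"
  shows "AE x in IM l. weak_deriv l u x = g x"
proof -
  have "u \<in> sobolev_H1 l" using assms by (auto simp: sobolev_H1_def)
  then show ?thesis using assms weak_deriv_props weak_deriv_unique_AE by blast
qed

lemma weak_deriv_lincomb_AE: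
  assumes "0 < l" "u \<in> sobolev_H1 l" "v \<in> sobolev_H1 l"
  shows "AE x in IM l. weak_deriv l (\<lambda>x. a * u x + b * v x) x = a * weak_deriv l u x + b * weak_deriv l v x"
  by (intro weak_deriv_AE_eq assms L2_lincomb has_weak_deriv_lincomb weak_deriv_props)

section \<open>The energy form on a single edge\<close>

definition edge_energy :: "real \<Rightarrow> (real \<Rightarrow> real) \<Rightarrow> (real \<Rightarrow> real) \<Rightarrow> real" where
  "edge_energy l u v = (\<integral>x. weak_deriv l u x * weak_deriv l v x \<partial>IM l)"

abbreviation edge_sq :: "real \<Rightarrow> (real \<Rightarrow> real) \<Rightarrow> real" where
  "edge_sq l u \<equiv> edge_energy l u u"

lemma edge_energy_commute: "edge_energy l u v = edge_energy l v u"
  by (simp add: edge_energy_def mult.commute)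

lemma edge_energy_nonneg: "0 \<le> edge_sq l u"
  by (simp add: edge_energy_def)

text \<open>The representatives chosen by \<open>weak_deriv\<close> depend linearly on the function
  only almost everywhere; under the integral this is enough.\<close>

lemma edge_energy_lincomb:
  assumes l: "0 < l" and u: "u \<in> sobolev_H1 l" "v \<in> sobolev_H1 l" "w \<in> sobolev_H1 l"
  shows "edge_energy l (\<lambda>x. a * u x + b * v x) w = a * edge_energy l u w + b * edge_energy l v w"
proof -
  have W: "weak_deriv l u \<in> L2 (IM l)" "weak_deriv l v \<in> L2 (IM l)" "weak_deriv l w \<in> L2 (IM l)"
    "weak_deriv l (\<lambda>x. a * u x + b * v x) \<in> L2 (IM l)"
    using u sobolev_H1_lincomb weak_deriv_props by blast+
  have [measurable]: "weak_deriv l u \<in> borel_measurable (IM l)" "weak_deriv l v \<in> borel_measurable (IM l)"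
    "weak_deriv l w \<in> borel_measurable (IM l)" "weak_deriv l (\<lambda>x. a * u x + b * v x) \<in> borel_measurable (IM l)"
    using W by auto
  have "edge_energy l (\<lambda>x. a * u x + b * v x) w =
     (\<integral>x. a * (weak_deriv l u x * weak_deriv l w x) + b * (weak_deriv l v x * weak_deriv l w x) \<partial>IM l)"
    unfolding edge_energy_def
  proof (rule Bochner_Integration.integral_cong_AE)
    show "AE x in IM l. weak_deriv l (\<lambda>x. a * u x + b * v x) x * weak_deriv l w x =
       a * (weak_deriv l u x * weak_deriv l w x) + b * (weak_deriv l v x * weak_deriv l w x)"
      using weak_deriv_lincomb_AE[OF l u(1,2), of a b] by eventually_elim (simp add: algebra_simps)
  qed auto
  also have "\<dots> = a * edge_energy l u w + b * edge_energy l v w"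
    using L2_mult_integrable[OF W(1,3)] L2_mult_integrable[OF W(2,3)] by (simp add: edge_energy_def)
  finally show ?thesis .
qed

lemma edge_energy_Hoelder:
  assumes "continuous_on {0..l} u" "u \<in> sobolev_H1 l" "0 \<le> s" "s \<le> t" "t \<le> l"
  shows "(u t - u s)^2 \<le> (t - s) * edge_sq l u"
  using has_weak_deriv_Hoelder[OF assms(1) weak_deriv_props(2,3)[OF assms(2)] assms(3-5)]
  by (simp add: edge_energy_def power2_eq_square)

text \<open>Closedness of the energy form on an edge. The weak derivatives converge in mean square
  by completeness, and the defining identity passes to the limit: uniformly on the side of the
  functions, by Cauchy-Schwarz on the side of the derivatives.\<close>

lemma sobolev_H1_closed:
  assumes l: "0 < l" and c: "\<And>n. continuous_on {0..l} (u n)" and u: "\<And>n. u n \<in> sobolev_H1 l"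
    and lim: "uniform_limit {0..l} u v sequentially"
    and Cauchy: "\<And>e. 0 < e \<Longrightarrow>
      \<exists>N. \<forall>m\<ge>N. \<forall>n\<ge>N. edge_sq l (\<lambda>x. u m x - u n x) < e"
  shows "v \<in> sobolev_H1 l"
    and "(\<lambda>n. edge_sq l (\<lambda>x. u n x - v x)) \<longlonglongrightarrow> 0"
proof -
  interpret finite_measure "IM l" by (rule finite_measure_IM)
  define D where "D n = weak_deriv l (u n)" for n
  have D: "D n \<in> L2 (IM l)" "has_weak_deriv l (u n) (D n)" for n
    using weak_deriv_props[OF u] by (auto simp: D_def)
  \<comment> \<open>The energy of a difference may be computed from any weak derivatives, not only
    from those that \<open>weak_deriv\<close> selects.\<close>
  have energy_eq: "edge_sq l (\<lambda>x. p x - q x) = (\<integral>x. (g x - h x)^2 \<partial>IM l)"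
    if "p \<in> L2 (IM l)" "q \<in> L2 (IM l)" "g \<in> L2 (IM l)" "h \<in> L2 (IM l)"
      "has_weak_deriv l p g" "has_weak_deriv l q h" for p q g h
  proof -
    have w: "has_weak_deriv l (\<lambda>x. p x - q x) (\<lambda>x. g x - h x)"
      using has_weak_deriv_lincomb[OF that, of 1 "-1"] by simp
    have S: "(\<lambda>x. p x - q x) \<in> sobolev_H1 l"
      unfolding sobolev_H1_def using w L2_diff that by blast
    have [measurable]: "weak_deriv l (\<lambda>x. p x - q x) \<in> borel_measurable (IM l)"
      "g \<in> borel_measurable (IM l)" "h \<in> borel_measurable (IM l)"
      using weak_deriv_props[OF S] that by auto
    show ?thesis
      unfolding edge_energy_def
    proof (rule Bochner_Integration.integral_cong_AE)
      show "AE x in IM l. weak_deriv l (\<lambda>x. p x - q x) x * weak_deriv l (\<lambda>x. p x - q x) x = (g x - h x)^2"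
        using weak_deriv_AE_eq[OF l L2_diff[OF that(1,2)] L2_diff[OF that(3,4)] w]
        by eventually_elim (simp add: power2_eq_square)
    qed auto
  qed
  have "edge_sq l (\<lambda>x. u m x - u n x) = (\<integral>x. (D m x - D n x)^2 \<partial>IM l)" for m n
    by (intro energy_eq weak_deriv_props(1)[OF u] D)
  then have "\<exists>N. \<forall>m\<ge>N. \<forall>n\<ge>N. (\<integral>x. (D m x - D n x)^2 \<partial>IM l) < e" if "0 < e" for e
    using Cauchy[OF that] by simp
  then obtain g where g: "g \<in> L2 (IM l)" "(\<lambda>n. \<integral>x. (D n x - g x)^2 \<partial>IM l) \<longlonglongrightarrow> 0"
    using L2_complete[of D] D by blast
  have vc: "continuous_on {0..l} v" by (rule uniform_limit_theorem[OF _ lim]) (use c in auto)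
  have vL: "v \<in> L2 (IM l)" by (rule continuous_in_L2[OF vc])
  have "has_weak_deriv l v g"
    unfolding has_weak_deriv_def
  proof (intro allI impI)
    fix \<phi> assume t: "test_function l \<phi>"
    have 1: "(\<lambda>n. \<integral>x. u n x * deriv \<phi> x \<partial>IM l) \<longlonglongrightarrow> (\<integral>x. v x * deriv \<phi> x \<partial>IM l)"
    proof (rule LIMSEQ_I)
      fix e :: real assume e: "0 < e"
      have int: "integrable (IM l) (\<lambda>x. \<bar>deriv \<phi> x\<bar>)"
        using L2_integrable[OF test_function_L2(2)[OF t]] by simp
      \<comment> \<open>The summand 1 allows division by \<open>K\<close> when the test function has
        zero derivative.\<close>
      define K where "K = (\<integral>x. \<bar>deriv \<phi> x\<bar> \<partial>IM l) + 1"
      have K: "0 < K" unfolding K_def by (simp add: add_nonneg_pos)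
      obtain N where N: "\<And>n x. N \<le> n \<Longrightarrow> x \<in> {0..l} \<Longrightarrow> \<bar>u n x - v x\<bar> < e / K"
        using uniform_limitD[OF lim, of "e / K"] e K
        unfolding eventually_sequentially dist_real_def by (meson divide_pos_pos)
      have "norm ((\<integral>x. u n x * deriv \<phi> x \<partial>IM l) - (\<integral>x. v x * deriv \<phi> x \<partial>IM l)) < e" if "N \<le> n" for n
      proof -
        have i: "integrable (IM l) (\<lambda>x. u n x * deriv \<phi> x)" "integrable (IM l) (\<lambda>x. v x * deriv \<phi> x)"
          using L2_mult_integrable[OF _ test_function_L2(2)[OF t]] vL weak_deriv_props(1)[OF u] by blast+
        have "\<bar>\<integral>x. u n x * deriv \<phi> x - v x * deriv \<phi> x \<partial>IM l\<bar> \<le> (\<integral>x. \<bar>u n x * deriv \<phi> x - v x * deriv \<phi> x\<bar> \<partial>IM l)"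
          by (rule integral_abs_bound)
        also have "\<dots> \<le> (\<integral>x. e / K * \<bar>deriv \<phi> x\<bar> \<partial>IM l)"
        proof (rule integral_mono)
          fix x assume "x \<in> space (IM l)"
          then have "\<bar>u n x - v x\<bar> * \<bar>deriv \<phi> x\<bar> \<le> e / K * \<bar>deriv \<phi> x\<bar>"
            using N[OF that, of x] by (intro mult_right_mono) auto
          then show "\<bar>u n x * deriv \<phi> x - v x * deriv \<phi> x\<bar> \<le> e / K * \<bar>deriv \<phi> x\<bar>"
            by (simp add: abs_mult[symmetric] left_diff_distrib)
        qed (use i int in auto)
        also have "\<dots> = e / K * (K - 1)" by (simp add: K_def)
        also have "\<dots> < e" using e K by (simp add: field_simps)
        finally show ?thesis using i by simp
      qed
      then show "\<exists>N. \<forall>n\<ge>N. norm ((\<integral>x. u n x * deriv \<phi> x \<partial>IM l) - (\<integral>x. v x * deriv \<phi> x \<partial>IM l)) < e" by blast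
    qed
    have 2: "(\<lambda>n. \<integral>x. D n x * \<phi> x \<partial>IM l) \<longlonglongrightarrow> (\<integral>x. g x * \<phi> x \<partial>IM l)"
    proof -
      have "(\<lambda>n. (\<integral>x. D n x * \<phi> x \<partial>IM l) - (\<integral>x. g x * \<phi> x \<partial>IM l)) \<longlonglongrightarrow> 0"
      proof (rule Lim_null_comparison)
        have "norm ((\<integral>x. D n x * \<phi> x \<partial>IM l) - (\<integral>x. g x * \<phi> x \<partial>IM l)) \<le>
           sqrt ((\<integral>x. (D n x - g x)^2 \<partial>IM l) * (\<integral>x. (\<phi> x)^2 \<partial>IM l))" for n
        proof -
          have "(\<integral>x. D n x * \<phi> x \<partial>IM l) - (\<integral>x. g x * \<phi> x \<partial>IM l) = (\<integral>x. (D n x - g x) * \<phi> x \<partial>IM l)"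
            using L2_mult_integrable[OF D(1) test_function_L2(1)[OF t]] L2_mult_integrable[OF g(1) test_function_L2(1)[OF t]]
            by (simp add: left_diff_distrib)
          then show ?thesis
            using L2_Cauchy_Schwarz[OF L2_diff[OF D(1) g(1)] test_function_L2(1)[OF t]]
            by (simp add: real_le_rsqrt abs_le_square_iff)
        qed
        then show "\<forall>\<^sub>F n in sequentially. norm ((\<integral>x. D n x * \<phi> x \<partial>IM l) - (\<integral>x. g x * \<phi> x \<partial>IM l)) \<le>
           sqrt ((\<integral>x. (D n x - g x)^2 \<partial>IM l) * (\<integral>x. (\<phi> x)^2 \<partial>IM l))" by simp
        show "(\<lambda>n. sqrt ((\<integral>x. (D n x - g x)^2 \<partial>IM l) * (\<integral>x. (\<phi> x)^2 \<partial>IM l))) \<longlonglongrightarrow> 0"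
          using tendsto_real_sqrt[OF tendsto_mult_left_zero[OF g(2)]] by simp
      qed
      then show ?thesis by (simp add: LIM_zero_iff)
    qed
    have "(\<lambda>n. \<integral>x. u n x * deriv \<phi> x \<partial>IM l) \<longlonglongrightarrow> - (\<integral>x. g x * \<phi> x \<partial>IM l)"
      using tendsto_minus[OF 2] D(2) t by (simp add: has_weak_deriv_def)
    then show "(\<integral>x. v x * deriv \<phi> x \<partial>IM l) = - (\<integral>x. g x * \<phi> x \<partial>IM l)"
      using LIMSEQ_unique[OF 1] by blast
  qed
  then show "v \<in> sobolev_H1 l" using vL g(1) by (auto simp: sobolev_H1_def)
  have "edge_sq l (\<lambda>x. u n x - v x) = (\<integral>x. (D n x - g x)^2 \<partial>IM l)" for n
    by (intro energy_eq weak_deriv_props(1)[OF u] D vL g \<open>has_weak_deriv l v g\<close>)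
  then show "(\<lambda>n. edge_sq l (\<lambda>x. u n x - v x)) \<longlonglongrightarrow> 0" using g(2) by simp
qed

section \<open>The Sobolev space of a metric graph\<close>

lemma sobolev_H1_cong:
  assumes "\<And>x. 0 < x \<Longrightarrow> x < l \<Longrightarrow> u x = v x"
  shows "u \<in> sobolev_H1 l \<longleftrightarrow> v \<in> sobolev_H1 l"
proof -
  have "u \<in> L2 (IM l) \<longleftrightarrow> v \<in> L2 (IM l)"
  proof -
    have "u \<in> borel_measurable (IM l) \<longleftrightarrow> v \<in> borel_measurable (IM l)"
      by (rule measurable_cong) (use assms in auto)
    moreover have "integrable (IM l) (\<lambda>x. (u x)^2) \<longleftrightarrow> integrable (IM l) (\<lambda>x. (v x)^2)"
      by (rule Bochner_Integration.integrable_cong) (use assms in auto)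
    ultimately show ?thesis by (simp add: L2_def)
  qed
  moreover have "(\<integral>x. u x * h x \<partial>IM l) = (\<integral>x. v x * h x \<partial>IM l)" for h
    by (rule Bochner_Integration.integral_cong) (use assms in auto)
  then have "has_weak_deriv l u g \<longleftrightarrow> has_weak_deriv l v g" for g
    by (simp add: has_weak_deriv_def)
  ultimately show ?thesis by (simp add: sobolev_H1_def)
qed

text \<open>Newton's scheme: a new node is met by adding a multiple of a polynomial that vanishes at
  the old ones. Polynomials are used because they are smooth enough to lie in the Sobolev
  space.\<close>

lemma real_polynomial_interpolation:
  fixes y :: "real \<Rightarrow> real"
  assumes "finite T"
  obtains p where "real_polynomial_function p" "\<And>t. t \<in> T \<Longrightarrow> p t = y t"
proof -
  have "\<exists>p. real_polynomial_function p \<and> (\<forall>t\<in>T. p t = y t)"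
    using assms
  proof (induction T)
    case empty
    then show ?case using real_polynomial_function.intros(2)[of 0] by blast
  next
    case (insert s T)
    then obtain p where p: "real_polynomial_function p" "\<And>t. t \<in> T \<Longrightarrow> p t = y t" by blast
    define q where "q t = (\<Prod>r\<in>T. t - r)" for t :: real
    have q: "real_polynomial_function q"
      unfolding q_def by (intro real_polynomial_function_prod real_polynomial_function_diff)
        (use insert.hyps in \<open>auto intro: real_polynomial_function.intros bounded_linear_ident\<close>)
    have q0: "q t = 0" if "t \<in> T" for t using insert.hyps(1) that by (auto simp: q_def)
    have qs: "q s \<noteq> 0" using insert.hyps by (auto simp: q_def)
    define h where "h t = p t + ((y s - p s) / q s) * q t" for t
    have "real_polynomial_function h"
      unfolding h_def by (intro real_polynomial_function.intros p q)
    moreover have "\<forall>t\<in>insert s T. h t = y t" using p q0 qs by (auto simp: h_def)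
    ultimately show ?case by blast
  qed
  then show thesis using that by blast
qed

text \<open>Repeated extraction; stability under further thinning (\<open>sub\<close>) preserves
  what earlier extractions achieved.\<close>

lemma common_subsequence:
  fixes P :: "'i \<Rightarrow> (nat \<Rightarrow> nat) \<Rightarrow> bool"
  assumes "finite I"
    and ex: "\<And>i (r :: nat \<Rightarrow> nat). i \<in> I \<Longrightarrow> strict_mono r \<Longrightarrow> \<exists>s. strict_mono s \<and> P i (r \<circ> s)"
    and sub: "\<And>i (r :: nat \<Rightarrow> nat) s. i \<in> I \<Longrightarrow> P i r \<Longrightarrow> strict_mono s \<Longrightarrow> P i (r \<circ> s)"
  obtains r :: "nat \<Rightarrow> nat" where "strict_mono r" "\<And>i. i \<in> I \<Longrightarrow> P i r"
proof -
  have "\<exists>r :: nat \<Rightarrow> nat. strict_mono r \<and> (\<forall>i\<in>I. P i r)"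
    using assms
  proof (induction I)
    case empty
    then show ?case using strict_mono_id by blast
  next
    case (insert i I)
    have "\<exists>r :: nat \<Rightarrow> nat. strict_mono r \<and> (\<forall>i\<in>I. P i r)" using insert.prems by (intro insert.IH) auto
    then obtain r where r: "strict_mono r" "\<And>i. i \<in> I \<Longrightarrow> P i r" by blast
    obtain s where s: "strict_mono s" "P i (r \<circ> s)" using insert.prems(1)[of i r] r by blast
    have "strict_mono (r \<circ> s)" using r s by (simp add: strict_mono_o)
    then show ?case using r s insert.prems(2) by blast
  qed
  then show thesis using that by blast
qed

section \<open>The graph as a glued family of intervals\<close>

locale finite_metric_graph =
  fixes G :: "('v, 'e) metric_graph"
  assumes metric_graph: "is_metric_graph G"
begin

sublocale fin_digraph "dgraph G"
  using metric_graph by (simp add: is_metric_graph_def)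

abbreviation "V \<equiv> verts (dgraph G)"
abbreviation "E \<equiv> arcs (dgraph G)"
abbreviation "X \<equiv> points G"
abbreviation along :: "(('v, 'e) point \<Rightarrow> real) \<Rightarrow> 'e \<Rightarrow> real \<Rightarrow> real" where
  "along f e \<equiv> (\<lambda>t. f (edge_point G e t))"
abbreviation q :: "(('v, 'e) point \<Rightarrow> real) \<Rightarrow> (('v, 'e) point \<Rightarrow> real) \<Rightarrow> real" where
  "q \<equiv> energy G"

abbreviation Q :: "(('v, 'e) point \<Rightarrow> real) \<Rightarrow> real" where
  "Q f \<equiv> q f f"

abbreviation uconv :: "(nat \<Rightarrow> ('v, 'e) point \<Rightarrow> real) \<Rightarrow> (('v, 'e) point \<Rightarrow> real) \<Rightarrow> bool" where
  "uconv f g \<equiv> uniform_limit X f g sequentially"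
abbreviation cont :: "(('v, 'e) point \<Rightarrow> real) \<Rightarrow> bool" where
  "cont f \<equiv> continuous_map (graph_topology G) euclideanreal f"

lemma len_pos: "e \<in> E \<Longrightarrow> 0 < len G e"
  using metric_graph by (simp add: is_metric_graph_def)

lemma reachable: "u \<in> V \<Longrightarrow> v \<in> V \<Longrightarrow> u \<rightarrow>\<^sup>*\<^bsub>mk_symmetric (dgraph G)\<^esub> v"
  using metric_graph unfolding is_metric_graph_def connected_def strongly_connected_def
  by (simp)

lemma edge_point_in: "e \<in> E \<Longrightarrow> edge_point G e t \<in> X"
  by (auto simp: edge_point_def points_def)

lemma points_cases:
  assumes "x \<in> X"
  obtains (vertex) v where "v \<in> V" "x = Vertex v"
  | (edge) e t where "e \<in> E" "t \<in> {0<..<len G e}" "x = edge_point G e t"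
  using assms by (auto simp: points_def edge_point_def)

lemma edge_point_0 [simp]: "edge_point G e 0 = Vertex (tail (dgraph G) e)"
  by (simp add: edge_point_def)

lemma edge_point_len [simp]: "e \<in> E \<Longrightarrow> edge_point G e (len G e) = Vertex (head (dgraph G) e)"
  using len_pos[of e] by (simp add: edge_point_def)

text \<open>The universal property of the gluing topology; from here on, continuity is handled one
  edge at a time.\<close>

lemma continuous_map_graph_iff:
  "cont f \<longleftrightarrow> (\<forall>e\<in>E. continuous_on {0..len G e} (along f e))"
proof -
  have pre: "{t \<in> {0..len G e}. edge_point G e t \<in> {x \<in> X. f x \<in> U}} = {t \<in> {0..len G e}. along f e t \<in> U}"
    if "e \<in> E" for e U using edge_point_in[OF that] by auto
  have "cont f \<longleftrightarrow>
     (\<forall>U. open U \<longrightarrow> (\<forall>e\<in>E. openin (top_of_set {0..len G e}) {t \<in> {0..len G e}. along f e t \<in> U}))"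
    by (simp add: continuous_map_def topspace_graph_topology[OF metric_graph] openin_graph_topology pre)
      (use pre in auto)
  also have "\<dots> \<longleftrightarrow> (\<forall>e\<in>E. continuous_map (top_of_set {0..len G e}) euclideanreal (along f e))"
    by (auto simp: continuous_map_def)
  finally show ?thesis by simp
qed

lemma cont_uniform_limit:
  assumes f: "\<And>n. cont (f n)" and lim: "uconv f g"
  shows "cont g"
  unfolding continuous_map_graph_iff
proof
  fix e assume e: "e \<in> E"
  have "uniform_limit {0..len G e} (\<lambda>n. along (f n) e) (along g e) sequentially"
    using uniform_limit_compose'[OF lim, of "edge_point G e" "{0..len G e}"] edge_point_in[OF e] by auto
  then show "continuous_on {0..len G e} (along g e)"
    by (rule uniform_limit_theorem[rotated]) (use f e in \<open>auto simp: continuous_map_graph_iff\<close>)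
qed

lemma H1_iff:
  "f \<in> H1 G \<longleftrightarrow> (\<forall>e\<in>E. continuous_on {0..len G e} (along f e) \<and> along f e \<in> sobolev_H1 (len G e))"
  by (auto simp: H1_def continuous_map_graph_iff)

lemma H1_lincomb: "f \<in> H1 G \<Longrightarrow> g \<in> H1 G \<Longrightarrow> (\<lambda>x. a * f x + b * g x) \<in> H1 G"
  unfolding H1_iff by (auto intro!: sobolev_H1_lincomb continuous_intros)

lemma energy_conv: "q f g = (\<Sum>e\<in>E. edge_energy (len G e) (along f e) (along g e))"
  by (simp add: energy_def edge_energy_def)

lemma energy_commute: "q f g = q g f"
  by (simp add: energy_conv edge_energy_commute)

lemma energy_nonneg: "0 \<le> Q f"
  by (simp add: energy_conv edge_energy_nonneg sum_nonneg)

lemma edge_energy_le: "e \<in> E \<Longrightarrow> edge_sq (len G e) (along f e) \<le> Q f"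
  unfolding energy_conv
  by (rule member_le_sum[of e E "\<lambda>e. edge_sq (len G e) (along f e)"]) (auto simp: edge_energy_nonneg)

lemma energy_lincomb_left:
  assumes "f \<in> H1 G" "g \<in> H1 G" "h \<in> H1 G"
  shows "q (\<lambda>x. a * f x + b * g x) h = a * q f h + b * q g h"
proof -
  have "edge_energy (len G e) (along (\<lambda>x. a * f x + b * g x) e) (along h e) =
     a * edge_energy (len G e) (along f e) (along h e) + b * edge_energy (len G e) (along g e) (along h e)"
    if "e \<in> E" for e
    using assms that len_pos[OF that] by (intro edge_energy_lincomb) (auto simp: H1_iff)
  then show ?thesis by (simp add: energy_conv sum.distrib sum_distrib_left)
qed

lemma energy_lincomb_right:
  "f \<in> H1 G \<Longrightarrow> g \<in> H1 G \<Longrightarrow> h \<in> H1 G \<Longrightarrow> q h (\<lambda>x. a * f x + b * g x) = a * q h f + b * q h g"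
  using energy_lincomb_left by (simp add: energy_commute[of h])

lemma H1_Hoelder:
  assumes f: "f \<in> H1 G" and e: "e \<in> E" and st: "s \<in> {0..len G e}" "t \<in> {0..len G e}"
  shows "\<bar>along f e s - along f e t\<bar> \<le> sqrt \<bar>s - t\<bar> * sqrt (Q f)"
proof -
  have *: "(along f e t - along f e s)^2 \<le> (t - s) * Q f" if "s \<le> t" "0 \<le> s" "t \<le> len G e" for s t
  proof -
    have "(along f e t - along f e s)^2 \<le> (t - s) * edge_sq (len G e) (along f e)"
      using f e that by (intro edge_energy_Hoelder) (auto simp: H1_iff)
    also have "\<dots> \<le> (t - s) * Q f" using that edge_energy_le[OF e] by (intro mult_left_mono) auto
    finally show ?thesis .
  qed
  have "(along f e s - along f e t)^2 \<le> \<bar>s - t\<bar> * Q f"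
    using *[of s t] *[of t s] st by (cases "s \<le> t") (auto simp: power2_commute)
  then show ?thesis by (simp add: real_sqrt_mult[symmetric] real_le_rsqrt)
qed

text \<open>Along one edge the Hoelder bound controls the oscillation by the square root of the
  length. Undirected paths chain these bounds from vertex to vertex, and every point lies on an edge
  or is a vertex.\<close>

lemma H1_oscillation:
  obtains C where "0 \<le> C" "\<And>f x y. f \<in> H1 G \<Longrightarrow> x \<in> X \<Longrightarrow> y \<in> X \<Longrightarrow> \<bar>f x - f y\<bar> \<le> C * sqrt (Q f)"
proof -
  interpret sym: pair_wf_digraph "mk_symmetric (dgraph G)" by (rule wellformed_mk_symmetric)
  \<comment> \<open>Quantifying over \<open>f\<close> inside the relation makes the constant
    independent of \<open>f\<close>, so constants add up along paths.\<close>
  define R where "R C x y \<longleftrightarrow> 0 \<le> C \<and> (\<forall>f\<in>H1 G. \<bar>f x - f y\<bar> \<le> C * sqrt (Q f))" for C :: real and x y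
  have R_trans: "R (C + D) x z" if "R C x y" "R D y z" for C D x y z
    unfolding R_def
  proof (intro conjI ballI)
    fix f assume "f \<in> H1 G"
    then have "\<bar>f x - f y\<bar> \<le> C * sqrt (Q f)" "\<bar>f y - f z\<bar> \<le> D * sqrt (Q f)"
      using that by (auto simp: R_def)
    then show "\<bar>f x - f z\<bar> \<le> (C + D) * sqrt (Q f)" by (simp add: distrib_right)
  qed (use that in \<open>auto simp: R_def\<close>)
  have R_sym: "R C x y \<Longrightarrow> R C y x" for C x y by (simp add: R_def abs_minus_commute)
  have R_edge: "R (sqrt (len G e)) (edge_point G e s) (edge_point G e t)"
    if "e \<in> E" "s \<in> {0..len G e}" "t \<in> {0..len G e}" for e s t
    unfolding R_def
  proof (intro conjI ballI)
    fix f assume "f \<in> H1 G"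
    then have "\<bar>along f e s - along f e t\<bar> \<le> sqrt \<bar>s - t\<bar> * sqrt (Q f)" using H1_Hoelder that by blast
    also have "\<dots> \<le> sqrt (len G e) * sqrt (Q f)"
      using that energy_nonneg by (intro mult_right_mono) auto
    finally show "\<bar>along f e s - along f e t\<bar> \<le> sqrt (len G e) * sqrt (Q f)" .
  qed (use len_pos that in \<open>simp add: less_imp_le\<close>)
  have R_vertex: "\<exists>C. R C (Vertex u) (Vertex v)" if "u \<in> V" "v \<in> V" for u v
    using reachable[OF that]
  proof (induction rule: sym.reachable_induct)
    case base
    have "R 0 (Vertex u) (Vertex u)" by (simp add: R_def)
    then show ?case by blast
  next
    case (step x y)
    then obtain C where C: "R C (Vertex u) (Vertex x)" by blast
    obtain e where e: "e \<in> E" "(x, y) = (tail (dgraph G) e, head (dgraph G) e) \<or> (x, y) = (head (dgraph G) e, tail (dgraph G) e)"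
      using step(2) by (auto simp: parcs_mk_symmetric)
    have "R (sqrt (len G e)) (Vertex (tail (dgraph G) e)) (Vertex (head (dgraph G) e))"
      using R_edge[OF e(1), of 0 "len G e"] len_pos[OF e(1)] e(1) by simp
    then have "R (sqrt (len G e)) (Vertex x) (Vertex y)" using e(2) R_sym by auto
    then show ?case using R_trans[OF C] by blast
  qed
  then obtain c where c: "\<And>u v. u \<in> V \<Longrightarrow> v \<in> V \<Longrightarrow> R (c u v) (Vertex u) (Vertex v)" by metis
  have c0: "0 \<le> c u v" if "u \<in> V" "v \<in> V" for u v using c[OF that] by (simp add: R_def)
  define L where "L = (\<Sum>e\<in>E. sqrt (len G e))"
  \<comment> \<open>A sum of nonnegative constants over the finitely many pairs of vertices
    dominates each of them.\<close>
  define K where "K = (\<Sum>u\<in>V. \<Sum>v\<in>V. c u v)"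
  have L: "sqrt (len G e) \<le> L" if "e \<in> E" for e
    unfolding L_def using that len_pos by (intro member_le_sum) (auto simp: less_imp_le)
  have K: "c u v \<le> K" if "u \<in> V" "v \<in> V" for u v
  proof -
    have "c u v \<le> (\<Sum>v\<in>V. c u v)" using that c0 by (intro member_le_sum) auto
    also have "\<dots> \<le> K" unfolding K_def
      using that c0 by (intro member_le_sum[of u V "\<lambda>u. \<Sum>v\<in>V. c u v"] sum_nonneg) auto
    finally show ?thesis .
  qed
  have R_mono: "R C x y \<Longrightarrow> C \<le> D \<Longrightarrow> R D x y" for C D x y
    unfolding R_def by (meson mult_right_mono order_trans real_sqrt_ge_zero energy_nonneg)
  have L0: "0 \<le> L" unfolding L_def using len_pos by (intro sum_nonneg) (auto simp: less_imp_le)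
  have near: "\<exists>v\<in>V. R L x (Vertex v)" if "x \<in> X" for x
    using that
  proof (cases rule: points_cases)
    case (vertex v)
    then have "R L x (Vertex v)" using L0 energy_nonneg by (simp add: R_def)
    then show ?thesis using vertex by blast
  next
    case (edge e t)
    have "R (sqrt (len G e)) x (Vertex (tail (dgraph G) e))"
      using R_edge[OF edge(1), of t 0] edge by auto
    then show ?thesis using R_mono L edge by (meson tail_in_verts)
  qed
  have "R (L + (K + L)) x y" if "x \<in> X" "y \<in> X" for x y
  proof -
    obtain u v where uv: "u \<in> V" "v \<in> V" "R L x (Vertex u)" "R L y (Vertex v)" using near \<open>x \<in> X\<close> \<open>y \<in> X\<close> by blast
    show ?thesis
      using R_trans[OF uv(3) R_trans[OF R_mono[OF c[OF uv(1,2)] K[OF uv(1,2)]] R_sym[OF uv(4)]]] .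
  qed
  \<comment> \<open>Some point is needed to read off from \<open>R\<close> that the constant is
    nonnegative.\<close>
  moreover obtain v where "v \<in> V"
    using metric_graph unfolding is_metric_graph_def connected_def strongly_connected_def by auto
  then have "Vertex v \<in> X" by (simp add: points_def)
  ultimately show thesis using that[of "L + (K + L)"] unfolding R_def by blast
qed

text \<open>Vertices are listed separately because a connected graph may be a single vertex without
  edges.\<close>

lemma points_eq: "X = (\<Union>v\<in>V. {Vertex v}) \<union> (\<Union>e\<in>E. edge_point G e ` {0..len G e})"
  by (auto simp: points_def image_iff edge_point_def)

text \<open>Each edge energy is dominated by the total energy, so the closedness on single edges
  applies to all of them at once.\<close>

lemma H1_closed:
  assumes f: "\<And>n. f n \<in> H1 G" and lim: "uconv f g"
    and Cauchy: "\<And>e. 0 < e \<Longrightarrow> \<exists>N. \<forall>m\<ge>N. \<forall>n\<ge>N. Q (\<lambda>x. f m x - f n x) < e"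
  shows "g \<in> H1 G" "(\<lambda>n. Q (\<lambda>x. f n x - g x)) \<longlonglongrightarrow> 0"
proof -
  have edge: "continuous_on {0..len G e} (along g e)" "along g e \<in> sobolev_H1 (len G e)"
      "(\<lambda>n. edge_sq (len G e) (\<lambda>t. along (f n) e t - along g e t)) \<longlonglongrightarrow> 0"
    if e: "e \<in> E" for e
  proof -
    have fe: "continuous_on {0..len G e} (along (f n) e)" "along (f n) e \<in> sobolev_H1 (len G e)" for n
      using f[of n] e by (auto simp: H1_iff)
    have ul: "uniform_limit {0..len G e} (\<lambda>n. along (f n) e) (along g e) sequentially"
      using uniform_limit_compose'[OF lim, of "edge_point G e" "{0..len G e}"] edge_point_in[OF e] by auto
    have C: "\<exists>N. \<forall>m\<ge>N. \<forall>n\<ge>N. edge_sq (len G e) (\<lambda>t. along (f m) e t - along (f n) e t) < d"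
      if "0 < d" for d
      using Cauchy[OF that] edge_energy_le[OF e] by (meson le_less_trans)
    show "continuous_on {0..len G e} (along g e)"
      by (rule uniform_limit_theorem[OF _ ul]) (use fe in auto)
    show "along g e \<in> sobolev_H1 (len G e)"
      "(\<lambda>n. edge_sq (len G e) (\<lambda>t. along (f n) e t - along g e t)) \<longlonglongrightarrow> 0"
      by (rule sobolev_H1_closed[OF len_pos[OF e] fe ul C]; assumption)+
  qed
  then show "g \<in> H1 G" by (simp add: H1_iff)
  show "(\<lambda>n. Q (\<lambda>x. f n x - g x)) \<longlonglongrightarrow> 0"
    unfolding energy_conv using tendsto_sum[of E, OF edge(3)] by simp
qed

text \<open>A common energy bound gives equicontinuity through the Hoelder estimate, so
  Arzela-Ascoli applies on every parameter interval. The graph is finite, hence one subsequence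
  serves all edges and vertices.\<close>

lemma H1_precompact:
  assumes f: "\<And>n. f n \<in> H1 G" and qf: "\<And>n. Q (f n) \<le> K" and bd: "\<And>n x. x \<in> X \<Longrightarrow> \<bar>f n x\<bar> \<le> K"
  obtains g and r :: "nat \<Rightarrow> nat" where "strict_mono r" "uconv (\<lambda>n. f (r n)) g"
proof -
  define piece where "piece i = (case i of Inl v \<Rightarrow> {Vertex v} | Inr e \<Rightarrow> edge_point G e ` {0..len G e})"
    for i :: "'v + 'e"
  define I where "I = Inl ` V \<union> Inr ` E"
  have X: "X = \<Union> (piece ` I)" unfolding points_eq I_def by (auto simp: piece_def)
  obtain r :: "nat \<Rightarrow> nat" where r: "strict_mono r"
    and conv: "\<And>i. i \<in> I \<Longrightarrow> \<exists>g. uniform_limit (piece i) (\<lambda>n. f (r n)) g sequentially"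
  proof (rule common_subsequence[of I "\<lambda>i (r :: nat \<Rightarrow> nat). \<exists>g. uniform_limit (piece i) (\<lambda>n. f (r n)) g sequentially"])
    show "finite I" by (simp add: I_def)
    fix i r assume i: "i \<in> I" and r: "strict_mono (r :: nat \<Rightarrow> nat)"
    show "\<exists>s. strict_mono s \<and> (\<exists>g. uniform_limit (piece i) (\<lambda>n. f ((r \<circ> s) n)) g sequentially)"
    proof (cases i)
      case (Inl v)
      then have v: "Vertex v \<in> X" using i by (auto simp: I_def points_def)
      have "bounded (range (\<lambda>n. f (r n) (Vertex v)))"
        unfolding bounded_iff using bd[OF v] by (intro exI[of _ K]) auto
      then obtain L s where s: "strict_mono (s :: nat \<Rightarrow> nat)" "((\<lambda>n. f (r n) (Vertex v)) \<circ> s) \<longlonglongrightarrow> L"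
        using bounded_imp_convergent_subsequence by blast
      have "uniform_limit (piece i) (\<lambda>n. f ((r \<circ> s) n)) (\<lambda>_. L) sequentially"
        using s(2) by (simp add: Inl piece_def uniform_limit_singleton o_def)
      then show ?thesis using s(1) by blast
    next
      case (Inr e)
      then have e: "e \<in> E" using i by (auto simp: I_def)
      obtain g s where s: "strict_mono (s :: nat \<Rightarrow> nat)"
        and g: "\<And>d. 0 < d \<Longrightarrow> \<exists>N. \<forall>n t. N \<le> n \<and> t \<in> {0..len G e} \<longrightarrow> norm (along (f (r (s n))) e t - g t) < d"
      proof (rule Arzela_Ascoli[of "{0..len G e}" "\<lambda>n. along (f (r n)) e" K])
        show "norm (along (f (r n)) e t) \<le> K" for n t using bd[OF edge_point_in[OF e]] by simp
        fix t d :: real assume t: "t \<in> {0..len G e}" and d: "0 < d"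
        \<comment> \<open>Chosen so that sqrt \<delta> times \<open>sqrt \<bar>K\<bar> + 1\<close>
          equals \<open>d\<close>; the summand 1 avoids dividing by zero.\<close>
        define \<delta> where "\<delta> = (d / (sqrt \<bar>K\<bar> + 1))^2"
        have \<delta>: "0 < \<delta>" unfolding \<delta>_def using d by (intro zero_less_power divide_pos_pos) (auto simp: add_nonneg_pos)
        have "norm (along (f (r n)) e t - along (f (r n)) e t') < d"
          if "t' \<in> {0..len G e}" "norm (t - t') < \<delta>" for n t'
        proof -
          have "sqrt \<bar>t - t'\<bar> < sqrt \<delta>" using that by simp
          also have "sqrt \<delta> = d / (sqrt \<bar>K\<bar> + 1)" unfolding \<delta>_def using d by simp
          finally have *: "sqrt \<bar>t - t'\<bar> * (sqrt \<bar>K\<bar> + 1) < d" by (simp add: pos_less_divide_eq add_nonneg_pos)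
          have "\<bar>along (f (r n)) e t - along (f (r n)) e t'\<bar> \<le> sqrt \<bar>t - t'\<bar> * sqrt (Q (f (r n)))"
            using H1_Hoelder[OF f e t] that by blast
          also have "\<dots> \<le> sqrt \<bar>t - t'\<bar> * (sqrt \<bar>K\<bar> + 1)"
          proof (rule mult_left_mono)
            have "sqrt (Q (f (r n))) \<le> sqrt \<bar>K\<bar>"
              using qf[of "r n"] by (intro real_sqrt_le_mono) simp
            then show "sqrt (Q (f (r n))) \<le> sqrt \<bar>K\<bar> + 1" by linarith
          qed simp
          finally show ?thesis using * by simp
        qed
        then show "\<exists>\<delta>>0. \<forall>n t'. t' \<in> {0..len G e} \<and> norm (t - t') < \<delta> \<longrightarrow>
            norm (along (f (r n)) e t - along (f (r n)) e t') < d" using \<delta> by blast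
      qed auto
      \<comment> \<open>The Arzela-Ascoli limit is a function of the parameter, and on a loop two
        parameters name one point. The Cauchy property transfers to points without choosing a
        parameter.\<close>
      have "uniformly_Cauchy_on (piece i) (\<lambda>n. f ((r \<circ> s) n))"
        unfolding uniformly_Cauchy_on_def
      proof (intro allI impI)
        fix d :: real assume "0 < d"
        then obtain N where N: "\<And>n t. N \<le> n \<Longrightarrow> t \<in> {0..len G e} \<Longrightarrow> norm (along (f (r (s n))) e t - g t) < d / 2"
          using g[of "d / 2"] by auto
        have "dist (f ((r \<circ> s) m) x) (f ((r \<circ> s) n) x) < d" if x: "x \<in> piece i" and mn: "N \<le> m" "N \<le> n" for x m n
        proof -
          obtain t where "t \<in> {0..len G e}" "x = edge_point G e t" using x by (auto simp: Inr piece_def)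
          then show ?thesis using N[OF mn(1), of t] N[OF mn(2), of t]
            unfolding o_def dist_real_def real_norm_def by (smt (verit) field_sum_of_halves)
        qed
        then show "\<exists>M. \<forall>x\<in>piece i. \<forall>m\<ge>M. \<forall>n\<ge>M. dist (f ((r \<circ> s) m) x) (f ((r \<circ> s) n) x) < d" by blast
      qed
      then have "\<exists>g. uniform_limit (piece i) (\<lambda>n. f ((r \<circ> s) n)) g sequentially"
        unfolding uniformly_convergent_eq_Cauchy[symmetric] uniformly_convergent_on_def .
      then show ?thesis using s by blast
    qed
  next
    fix i and r s :: "nat \<Rightarrow> nat"
    assume "\<exists>g. uniform_limit (piece i) (\<lambda>n. f (r n)) g sequentially" "strict_mono s"
    then show "\<exists>g. uniform_limit (piece i) (\<lambda>n. f ((r \<circ> s) n)) g sequentially"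
      by (auto dest: filterlim_compose[OF _ filterlim_subseq])
  qed blast
  \<comment> \<open>Pointwise limits do not depend on the piece, so they glue the local limits
    together.\<close>
  define g where "g x = lim (\<lambda>n. f (r n) x)" for x
  have "uniform_limit (piece i) (\<lambda>n. f (r n)) g sequentially" if i: "i \<in> I" for i
  proof -
    obtain h where h: "uniform_limit (piece i) (\<lambda>n. f (r n)) h sequentially" using conv[OF i] by blast
    have "h x = g x" if "x \<in> piece i" for x
      unfolding g_def using limI[OF tendsto_uniform_limitI[OF h that]] by simp
    then show ?thesis using uniform_limit_cong'[of "piece i" "\<lambda>n. f (r n)" "\<lambda>n. f (r n)" h g] h by auto
  qed
  then have "uconv (\<lambda>n. f (r n)) g"
    unfolding X by (intro uniform_limit_on_UNION) (auto simp: I_def)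
  with r show thesis using that by blast
qed

text \<open>The polynomials on the edges are chosen independently. Each takes the prescribed values
  at both endpoints, whether or not the vertices belong to \<open>S\<close>, so they fit together
  continuously.\<close>

lemma H1_interpolation:
  assumes "finite S"
  obtains f where "f \<in> H1 G" "\<And>x. x \<in> S \<Longrightarrow> x \<in> X \<Longrightarrow> f x = y x"
proof -
  define T where "T e = {0, len G e} \<union> {t \<in> {0<..<len G e}. Inner e t \<in> S}" for e
  have "finite (T e)" for e
  proof -
    have "finite (Inner e -` S)" by (rule finite_vimageI[OF assms]) (auto simp: inj_def)
    then show ?thesis unfolding T_def by (auto simp: vimage_def elim: finite_subset[rotated])
  qed
  then have "\<exists>p. real_polynomial_function p \<and> (\<forall>t\<in>T e. p t = y (edge_point G e t))" for e
    using real_polynomial_interpolation[of "T e" "\<lambda>t. y (edge_point G e t)"] by metis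
  then obtain p where p: "\<And>e. real_polynomial_function (p e)" "\<And>e t. t \<in> T e \<Longrightarrow> p e t = y (edge_point G e t)"
    by metis
  define f where "f x = (case x of Vertex v \<Rightarrow> y (Vertex v) | Inner e t \<Rightarrow> p e t)" for x
  have along: "along f e t = p e t" if "e \<in> E" "t \<in> {0..len G e}" for e t
    using p(2)[of 0 e] p(2)[of "len G e" e] that len_pos[OF that(1)]
    by (auto simp: f_def edge_point_def T_def)
  have "f \<in> H1 G"
    unfolding H1_iff
  proof (intro ballI conjI)
    fix e assume e: "e \<in> E"
    obtain p' where p': "real_polynomial_function p'" "\<And>t. (p e has_real_derivative p' t) (at t)"
      using has_real_derivative_polynomial_function[OF p(1)] by blast
    have c: "isCont p' t" "isCont (p e) t" for t
      using p' has_real_derivative_polynomial_function[OF p'(1)] DERIV_isCont by blast+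
    have "continuous_on {0..len G e} (p e)" using c by (intro isCont_continuous_on)
    then show "continuous_on {0..len G e} (along f e)"
      using along[OF e] by (simp cong: continuous_on_cong_simp)
    have "p e \<in> sobolev_H1 (len G e)" by (rule C1_in_sobolev_H1[OF len_pos[OF e] p'(2) c(1)])
    then show "along f e \<in> sobolev_H1 (len G e)"
      using along[OF e] by (subst sobolev_H1_cong[of _ _ "p e"]) auto
  qed
  moreover have "f x = y x" if "x \<in> S" "x \<in> X" for x
    using that(2)
  proof (cases rule: points_cases)
    case (vertex v)
    then show ?thesis by (simp add: f_def)
  next
    case (edge e t)
    then show ?thesis using along[of e t] p(2)[of t e] that(1) by (auto simp: T_def edge_point_def)
  qed
  ultimately show thesis using that by blast
qed

end

section \<open>Measures on a metric graph\<close>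

text \<open>Gaussian elimination. Later the unknowns are coefficients of a linear combination, and
  the equations are orthogonality conditions or relations between coefficient vectors.\<close>

lemma homogeneous_system_nontrivial_solution:
  fixes a :: "'i \<Rightarrow> 'j \<Rightarrow> real"
  assumes "finite J" "finite I" "card J < card I"
  shows "\<exists>c. (\<exists>i\<in>I. c i \<noteq> 0) \<and> (\<forall>j\<in>J. (\<Sum>i\<in>I. c i * a i j) = 0)"
  using assms
proof (induction J arbitrary: I a)
  case empty
  then obtain i where "i \<in> I" by fastforce
  then show ?case by (intro exI[of _ "\<lambda>_. 1"]) auto
next
  case (insert j J)
  show ?case
  proof (cases "\<forall>i\<in>I. a i j = 0")
    case True
    obtain c where "\<exists>i\<in>I. c i \<noteq> 0" "\<forall>j\<in>J. (\<Sum>i\<in>I. c i * a i j) = 0"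
      using insert.IH[of I a] insert.prems insert.hyps by auto
    then show ?thesis using True by (intro exI[of _ c]) auto
  next
    case False
    then obtain p where p: "p \<in> I" "a p j \<noteq> 0" by blast
    \<comment> \<open>Coefficients after the pivot \<open>p\<close> has been used to clear equation
      \<open>j\<close>.\<close>
    define b where "b i l = a i l - a i j / a p j * a p l" for i l
    have "card J < card (I - {p})" using insert.prems insert.hyps p by simp
    then obtain c where c: "\<exists>i\<in>I - {p}. c i \<noteq> 0" "\<And>l. l \<in> J \<Longrightarrow> (\<Sum>i\<in>I - {p}. c i * b i l) = 0"
      using insert.IH[of "I - {p}" b] insert.prems by auto
    \<comment> \<open>Back substitution: the value at \<open>p\<close> is the one that solves
      equation \<open>j\<close>.\<close>
    define d where "d i = (if i = p then - (\<Sum>i\<in>I - {p}. c i * a i j) / a p j else c i)" for i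
    have sum_d: "(\<Sum>i\<in>I. d i * a i l) = (\<Sum>i\<in>I - {p}. c i * b i l)" for l
    proof -
      have "(\<Sum>i\<in>I. d i * a i l) = d p * a p l + (\<Sum>i\<in>I - {p}. d i * a i l)"
        using p insert.prems by (simp add: sum.remove)
      also have "(\<Sum>i\<in>I - {p}. d i * a i l) = (\<Sum>i\<in>I - {p}. c i * a i l)"
        by (intro sum.cong) (auto simp: d_def)
      also have "d p * a p l = - (\<Sum>i\<in>I - {p}. c i * (a i j / a p j * a p l))"
        by (simp add: d_def sum_divide_distrib sum_distrib_right mult.assoc)
      finally show ?thesis by (simp add: b_def right_diff_distrib sum_subtractf)
    qed
    have "(\<Sum>i\<in>I. d i * a i l) = 0" if "l \<in> insert j J" for l
      unfolding sum_d using that c p by (auto simp: b_def)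
    moreover have "\<exists>i\<in>I. d i \<noteq> 0" using c(1) by (auto simp: d_def)
    ultimately show ?thesis by blast
  qed
qed

lemma L2_dim_ge:
  assumes "\<And>i. i < n \<Longrightarrow> f i \<in> S" "L2_independent M n f"
  shows "enat n \<le> L2_dim M S"
  unfolding L2_dim_def using assms by (intro Sup_upper) blast

text \<open>More than \<open>card J\<close> functions in the span have linearly dependent
  coefficient vectors, and that relation holds for the functions almost everywhere.\<close>

lemma L2_dim_le:
  assumes J: "finite J"
    and span: "\<And>f. f \<in> S \<Longrightarrow> \<exists>c. AE x in M. f x = (\<Sum>j\<in>J. c j * g j x)"
  shows "L2_dim M S \<le> enat (card J)"
  unfolding L2_dim_def
proof (rule Sup_least, clarify)
  fix n f assume f: "\<forall>i<n. f i \<in> S" "L2_independent M n f"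
  have "\<exists>a. \<forall>i<n. AE x in M. f i x = (\<Sum>j\<in>J. a i j * g j x)"
    using span f(1) by (intro choice) metis
  then obtain a where a: "\<And>i. i < n \<Longrightarrow> AE x in M. f i x = (\<Sum>j\<in>J. a i j * g j x)" by blast
  have "\<not> card J < n"
  proof
    assume "card J < n"
    then obtain c where c: "\<exists>i\<in>{..<n}. c i \<noteq> 0" "\<forall>j\<in>J. (\<Sum>i\<in>{..<n}. c i * a i j) = 0"
      using homogeneous_system_nontrivial_solution[OF J, of "{..<n}" a] by auto
    have "AE x in M. \<forall>i\<in>{..<n}. f i x = (\<Sum>j\<in>J. a i j * g j x)"
      using a by (intro AE_finite_allI) auto
    then have "AE x in M. (\<Sum>i<n. c i * f i x) = 0"
    proof eventually_elim
      fix x assume x: "\<forall>i\<in>{..<n}. f i x = (\<Sum>j\<in>J. a i j * g j x)"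
      have "(\<Sum>i<n. c i * f i x) = (\<Sum>i<n. \<Sum>j\<in>J. c i * a i j * g j x)"
        using x by (simp add: sum_distrib_left mult.assoc)
      also have "\<dots> = (\<Sum>j\<in>J. (\<Sum>i<n. c i * a i j) * g j x)"
        by (subst sum.swap) (simp add: sum_distrib_right)
      also have "\<dots> = 0" using c(2) by simp
      finally show "(\<Sum>i<n. c i * f i x) = 0" .
    qed
    then show False using f(2) c(1) unfolding L2_independent_def by blast
  qed
  then show "enat n \<le> enat (card J)" by simp
qed

section \<open>Algebra and continuity of the energy form\<close>

context finite_metric_graph
begin

lemma H1_continuous: "f \<in> H1 G \<Longrightarrow> cont f"
  by (simp add: H1_def)

lemma continuous_map_bounded:
  assumes "cont f"
  obtains K where "0 \<le> K" "\<And>x. x \<in> X \<Longrightarrow> \<bar>f x\<bar> \<le> K"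
proof -
  have "bounded (f ` X)"
  proof -
    have "f ` X = (\<Union>v\<in>V. {f (Vertex v)}) \<union> (\<Union>e\<in>E. along f e ` {0..len G e})"
      unfolding points_eq by (simp add: image_Un image_UN image_image)
    moreover have "bounded (along f e ` {0..len G e})" if "e \<in> E" for e
      using assms that unfolding continuous_map_graph_iff
      by (intro compact_imp_bounded compact_continuous_image) auto
    ultimately show ?thesis by (auto intro!: bounded_UN)
  qed
  then obtain K where "\<And>x. x \<in> X \<Longrightarrow> \<bar>f x\<bar> \<le> K" unfolding bounded_iff by (metis imageI real_norm_def)
  then show thesis using that[of "max K 0"] by fastforce
qed

lemma H1_diff: "f \<in> H1 G \<Longrightarrow> g \<in> H1 G \<Longrightarrow> (\<lambda>x. f x - g x) \<in> H1 G"
  using H1_lincomb[of f g 1 "-1"] by simp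

lemma H1_add_scaled: "f \<in> H1 G \<Longrightarrow> g \<in> H1 G \<Longrightarrow> (\<lambda>x. f x + t * g x) \<in> H1 G"
  using H1_lincomb[of f g 1 t] by simp

lemma H1_scale: "f \<in> H1 G \<Longrightarrow> (\<lambda>x. t * f x) \<in> H1 G"
  using H1_lincomb[of f f t 0] by simp

lemma H1_zero: "(\<lambda>x. 0) \<in> H1 G"
proof -
  obtain f where "f \<in> H1 G" using H1_interpolation[of "{}"] by blast
  from H1_scale[OF this, of 0] show ?thesis by simp
qed

lemma H1_sum: "(\<And>i. i \<in> I \<Longrightarrow> f i \<in> H1 G) \<Longrightarrow> (\<lambda>x. \<Sum>i\<in>I. c i * f i x) \<in> H1 G"
proof (induction I rule: infinite_finite_induct)
  case (insert i I)
  then show ?case using H1_lincomb[of "f i" "\<lambda>x. \<Sum>i\<in>I. c i * f i x" "c i" 1] by simp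
qed (use H1_zero in auto)

lemma energy_zero_left: "g \<in> H1 G \<Longrightarrow> q (\<lambda>x. 0) g = 0"
  using energy_lincomb_left[of g g g 0 0] by simp

lemma energy_sum_left:
  assumes "\<And>i. i \<in> I \<Longrightarrow> f i \<in> H1 G" "g \<in> H1 G"
  shows "q (\<lambda>x. \<Sum>i\<in>I. c i * f i x) g = (\<Sum>i\<in>I. c i * q (f i) g)"
  using assms(1)
proof (induction I rule: infinite_finite_induct)
  case (insert i I)
  then show ?case
    using energy_lincomb_left[of "f i" "\<lambda>x. \<Sum>i\<in>I. c i * f i x" g "c i" 1] assms(2) H1_sum[of I f c] by simp
qed (use energy_zero_left[OF assms(2)] in auto)

lemma energy_diff_left:
  "f \<in> H1 G \<Longrightarrow> g \<in> H1 G \<Longrightarrow> h \<in> H1 G \<Longrightarrow> q (\<lambda>x. f x - g x) h = q f h - q g h"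
  using energy_lincomb_left[of f g h 1 "-1"] by simp

lemma energy_square_lincomb:
  assumes "f \<in> H1 G" "g \<in> H1 G"
  shows "Q (\<lambda>x. a * f x + b * g x) = a^2 * Q f + 2 * a * b * q f g + b^2 * Q g"
  using assms H1_lincomb[OF assms, of a b] energy_commute[of g f]
  by (simp add: energy_lincomb_left energy_lincomb_right power2_eq_square algebra_simps)

lemma energy_add_scaled:
  assumes "f \<in> H1 G" "g \<in> H1 G"
  shows "Q (\<lambda>x. f x + t * g x) = Q f + 2 * t * q f g + t^2 * Q g"
  using energy_square_lincomb[OF assms, of 1 t] by simp

lemma energy_Cauchy_Schwarz:
  assumes "f \<in> H1 G" "g \<in> H1 G"
  shows "(q f g)^2 \<le> Q f * Q g"
proof (rule quadratic_nonneg_imp_le[OF _ energy_nonneg])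
  show "0 \<le> Q f + 2 * t * q f g + t^2 * Q g" for t
    using energy_nonneg[of "\<lambda>x. f x + t * g x"] energy_add_scaled[OF assms] by simp
qed

lemma energy_tendsto:
  assumes f: "\<And>n. f n \<in> H1 G" "g \<in> H1 G" and lim: "(\<lambda>n. Q (\<lambda>x. f n x - g x)) \<longlonglongrightarrow> 0"
  shows "\<phi> \<in> H1 G \<Longrightarrow> (\<lambda>n. q (f n) \<phi>) \<longlonglongrightarrow> q g \<phi>" "(\<lambda>n. Q (f n)) \<longlonglongrightarrow> Q g"
proof -
  have d: "(\<lambda>x. f n x - g x) \<in> H1 G" for n using f by (intro H1_diff)
  have 1: "(\<lambda>n. q (\<lambda>x. f n x - g x) \<phi>) \<longlonglongrightarrow> 0" if "\<phi> \<in> H1 G" for \<phi>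
  proof (rule Lim_null_comparison)
    show "\<forall>\<^sub>F n in sequentially. norm (q (\<lambda>x. f n x - g x) \<phi>)
        \<le> sqrt (Q (\<lambda>x. f n x - g x) * q \<phi> \<phi>)"
      using energy_Cauchy_Schwarz[OF d that] by (intro always_eventually allI) (simp add: real_le_rsqrt)
    show "(\<lambda>n. sqrt (Q (\<lambda>x. f n x - g x) * q \<phi> \<phi>)) \<longlonglongrightarrow> 0"
      using tendsto_real_sqrt[OF tendsto_mult_left_zero[OF lim]] by simp
  qed
  show 2: "(\<lambda>n. q (f n) \<phi>) \<longlonglongrightarrow> q g \<phi>" if "\<phi> \<in> H1 G" for \<phi>
    using 1[OF that] f that by (simp add: energy_diff_left LIM_zero_iff)
  have "Q (f n) = Q (\<lambda>x. f n x - g x) + 2 * q (\<lambda>x. f n x - g x) g + Q g" for n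
    using energy_add_scaled[OF d f(2), of n 1] by simp
  then show "(\<lambda>n. Q (f n)) \<longlonglongrightarrow> Q g"
    using tendsto_add[OF tendsto_add[OF lim tendsto_mult_left[OF 1[OF f(2)], of 2]] tendsto_const[of "Q g"]] by simp
qed

text \<open>Written with the midpoint, which stays admissible in a convex class of competitors and
  hence cannot have energy below the infimum; near-minimisers are therefore close to each other in
  energy.\<close>

lemma energy_parallelogram:
  assumes "f \<in> H1 G" "g \<in> H1 G"
  shows "Q (\<lambda>x. f x - g x) =
    2 * Q f + 2 * Q g - 4 * Q (\<lambda>x. (1/2) * f x + (1/2) * g x)"
  using energy_square_lincomb[OF assms, of 1 "-1"] energy_square_lincomb[OF assms, of "1/2" "1/2"]
  by (simp add: power2_eq_square)

end

section \<open>Borel measures on the graph and their supports\<close>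

locale graph_measure = finite_metric_graph G for G :: "('v, 'e) metric_graph" +
  fixes \<mu> :: "('v, 'e) point measure"
  assumes nonzero_finite_measure: "\<mu> \<in> nonzero_finite_measures G"
begin

sublocale finite_measure \<mu>
  using nonzero_finite_measure by (simp add: nonzero_finite_measures_def)

lemma open_subset_points: "openin (graph_topology G) U \<Longrightarrow> U \<subseteq> X"
  by (simp add: openin_graph_topology)

lemma openin_points: "openin (graph_topology G) X"
  using openin_topspace[of "graph_topology G"] topspace_graph_topology[OF metric_graph] by simp

lemma sets_eq: "sets \<mu> = sigma_sets X {U. openin (graph_topology G) U}"
  using nonzero_finite_measure by (simp add: nonzero_finite_measures_def)

lemma space_eq [simp]: "space \<mu> = X"
proof
  show "space \<mu> \<subseteq> X"
    using sets.top[of \<mu>] sigma_sets_into_sp[of "{U. openin (graph_topology G) U}" X "space \<mu>"] open_subset_points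
    unfolding sets_eq by blast
  have "X \<in> sets \<mu>" unfolding sets_eq using openin_points by (intro sigma_sets.Basic) simp
  then show "X \<subseteq> space \<mu>" by (rule sets.sets_into_space)
qed

lemma open_in_sets: "openin (graph_topology G) U \<Longrightarrow> U \<in> sets \<mu>"
  unfolding sets_eq by (intro sigma_sets.Basic) simp

lemma measure_space_pos: "0 < measure \<mu> X"
  using nonzero_finite_measure emeasure_eq_measure[of X]
  by (auto simp: nonzero_finite_measures_def zero_less_measure_iff simp flip: space_eq)

lemma continuous_map_measurable:
  assumes "cont f"
  shows "f \<in> borel_measurable \<mu>"
proof (rule borel_measurableI)
  fix S :: "real set" assume "open S"
  then have "openin (graph_topology G) {x \<in> X. f x \<in> S}"
    using assms topspace_graph_topology[OF metric_graph] by (auto simp: continuous_map_def)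
  moreover have "{x \<in> X. f x \<in> S} = f -` S \<inter> space \<mu>" by auto
  ultimately show "f -` S \<inter> space \<mu> \<in> sets \<mu>" using open_in_sets by metis
qed

lemma continuous_map_L2:
  assumes "cont f"
  shows "f \<in> L2 \<mu>"
proof -
  obtain K where "\<And>x. x \<in> X \<Longrightarrow> \<bar>f x\<bar> \<le> K" using continuous_map_bounded[OF assms] by blast
  then show ?thesis by (intro bounded_in_L2[of _ K] continuous_map_measurable[OF assms]) auto
qed

lemma H1_L2: "f \<in> H1 G \<Longrightarrow> f \<in> L2 \<mu>"
  by (intro continuous_map_L2 H1_continuous)

lemma openin_Inner_image:
  assumes e: "e \<in> E" and J: "open J" "J \<subseteq> {0<..<len G e}"
  shows "openin (graph_topology G) (Inner e ` J)"
  unfolding openin_graph_topology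
proof (intro conjI ballI)
  show "Inner e ` J \<subseteq> X" using e J(2) by (auto simp: points_def)
  fix e' assume "e' \<in> E"
  have "{t \<in> {0..len G e'}. edge_point G e' t \<in> Inner e ` J} = (if e' = e then J else {})"
    using J(2) by (auto simp: edge_point_def split: if_splits)
  moreover have "openin (top_of_set {0..len G e}) J"
  proof -
    have "{0..len G e} \<inter> J = J" using J(2) by auto
    then show ?thesis using openin_open_Int[OF J(1), of "{0..len G e}"] by simp
  qed
  ultimately show "openin (top_of_set {0..len G e'}) {t \<in> {0..len G e'}. edge_point G e' t \<in> Inner e ` J}"
    by simp
qed

lemma null_neighbourhood:
  assumes "x \<in> X" "x \<notin> supp G \<mu>"
  obtains U where "openin (graph_topology G) U" "x \<in> U" "U \<in> null_sets \<mu>"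
proof -
  obtain U where "openin (graph_topology G) U" "x \<in> U" "\<not> 0 < emeasure \<mu> U"
    using assms by (auto simp: supp_def)
  then show thesis using that open_in_sets by (auto simp: null_sets_def)
qed

text \<open>The complement of the support is covered by null open sets, and Lindelof's theorem on
  the parameter interval of each edge leaves countably many of them. The finitely many vertices are
  treated one by one.\<close>

lemma AE_supp: "AE x in \<mu>. x \<in> supp G \<mu>"
proof -
  have "\<exists>N\<in>null_sets \<mu>. {Vertex v} - supp G \<mu> \<subseteq> N" if "v \<in> V" for v
  proof (cases "Vertex v \<in> supp G \<mu>")
    case False
    moreover have "Vertex v \<in> X" using that by (simp add: points_def)
    ultimately obtain U where "Vertex v \<in> U" "U \<in> null_sets \<mu>" using null_neighbourhood by blast
    then show ?thesis by auto
  qed auto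
  then obtain NV where NV: "\<And>v. v \<in> V \<Longrightarrow> NV v \<in> null_sets \<mu>" "\<And>v. v \<in> V \<Longrightarrow> {Vertex v} - supp G \<mu> \<subseteq> NV v"
    by metis
  have "\<exists>N\<in>null_sets \<mu>. Inner e ` {0<..<len G e} - supp G \<mu> \<subseteq> N" if e: "e \<in> E" for e
  proof -
    \<comment> \<open>The covering is expressed by open sets of parameters, so that Lindelof's
      theorem is needed only on the real line.\<close>
    define \<F> where "\<F> = {J. open J \<and> J \<subseteq> {0<..<len G e} \<and> Inner e ` J \<in> null_sets \<mu>}"
    obtain \<F>' where F': "\<F>' \<subseteq> \<F>" "countable \<F>'" "\<Union>\<F>' = \<Union>\<F>"
      using Lindelof[of \<F>] by (auto simp: \<F>_def)
    have "t \<in> \<Union>\<F>" if t: "t \<in> {0<..<len G e}" "Inner e t \<notin> supp G \<mu>" for t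
    proof -
      have "Inner e t \<in> X" using t e by (auto simp: points_def)
      then obtain U where U: "openin (graph_topology G) U" "Inner e t \<in> U" "U \<in> null_sets \<mu>"
        using t null_neighbourhood by blast
      obtain T where T: "open T" "{t \<in> {0..len G e}. edge_point G e t \<in> U} = {0..len G e} \<inter> T"
        using U(1) e unfolding openin_graph_topology openin_open by blast
      \<comment> \<open>Removing the endpoints leaves parameters at which \<open>edge_point\<close>
        is \<open>Inner\<close>.\<close>
      define J where "J = T \<inter> {0<..<len G e}"
      have J: "open J" "J \<subseteq> {0<..<len G e}" using T by (auto simp: J_def)
      have "s \<in> {t \<in> {0..len G e}. edge_point G e t \<in> U} \<longleftrightarrow> Inner e s \<in> U" if "s \<in> {0<..<len G e}" for s
        using that by (auto simp: edge_point_def)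
      then have sJ: "s \<in> J \<longleftrightarrow> Inner e s \<in> U" if "s \<in> {0<..<len G e}" for s
        using that unfolding T(2) J_def by auto
      have "Inner e ` J \<subseteq> U" using sJ J(2) by blast
      then have "Inner e ` J \<in> null_sets \<mu>"
        using U(3) open_in_sets[OF openin_Inner_image[OF e J]] by (rule null_sets_subset[rotated 2])
      then have "J \<in> \<F>" using J by (simp add: \<F>_def)
      moreover have "t \<in> J" using sJ[OF t(1)] U(2) by simp
      ultimately show ?thesis by blast
    qed
    then have "Inner e ` {0<..<len G e} - supp G \<mu> \<subseteq> (\<Union>J\<in>\<F>'. Inner e ` J)"
      unfolding image_Union[symmetric] F'(3) by blast
    moreover have "(\<Union>J\<in>\<F>'. Inner e ` J) \<in> null_sets \<mu>"
      using F' by (intro null_sets_UN') (auto simp: \<F>_def)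
    ultimately show ?thesis by blast
  qed
  then obtain NE where NE: "\<And>e. e \<in> E \<Longrightarrow> NE e \<in> null_sets \<mu>"
      "\<And>e. e \<in> E \<Longrightarrow> Inner e ` {0<..<len G e} - supp G \<mu> \<subseteq> NE e"
    by metis
  have "(\<Union>v\<in>V. NV v) \<union> (\<Union>e\<in>E. NE e) \<in> null_sets \<mu>"
    by (intro null_sets.Un null_sets_UN' NV NE) (auto intro: countable_finite)
  moreover have "{x \<in> space \<mu>. x \<notin> supp G \<mu>} \<subseteq> (\<Union>v\<in>V. NV v) \<union> (\<Union>e\<in>E. NE e)"
  proof
    fix x assume x: "x \<in> {x \<in> space \<mu>. x \<notin> supp G \<mu>}"
    then have "x \<in> X" by simp
    then consider v where "v \<in> V" "x = Vertex v" | e t where "e \<in> E" "t \<in> {0<..<len G e}" "x = Inner e t"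
      by (auto simp: points_def)
    then show "x \<in> (\<Union>v\<in>V. NV v) \<union> (\<Union>e\<in>E. NE e)"
    proof cases
      case 1
      then show ?thesis using NV(2)[of v] x by blast
    next
      case 2
      then show ?thesis using NE(2)[of e] x by blast
    qed
  qed
  ultimately show ?thesis by (rule AE_I'[rotated, rotated])
qed

lemma supp_nonempty: "supp G \<mu> \<noteq> {}"
proof
  assume "supp G \<mu> = {}"
  then have "AE x in \<mu>. False" using AE_supp by simp
  then have "emeasure \<mu> (space \<mu>) = 0" using AE_iff_null[of \<mu> "\<lambda>_. False"] sets.top[of \<mu>] by (simp add: null_sets_def)
  then show False using nonzero_finite_measure by (simp add: nonzero_finite_measures_def)
qed

lemma supp_subset: "supp G \<mu> \<subseteq> X" by (auto simp: supp_def)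

text \<open>The set where a continuous function is nonzero is open, so it has positive measure as
  soon as it meets the support. This is how equality almost everywhere becomes pointwise
  information.\<close>

lemma AE_zero_iff:
  assumes f: "cont f"
  shows "(AE x in \<mu>. f x = 0) \<longleftrightarrow> (\<forall>x\<in>supp G \<mu>. f x = 0)"
proof
  assume ae: "AE x in \<mu>. f x = 0"
  show "\<forall>x\<in>supp G \<mu>. f x = 0"
  proof (rule ballI, rule ccontr)
    fix x assume x: "x \<in> supp G \<mu>" "f x \<noteq> 0"
    define U where "U = {x \<in> X. f x \<in> - {0}}"
    have U: "openin (graph_topology G) U" unfolding U_def
      using f topspace_graph_topology[OF metric_graph] by (auto simp: continuous_map_def)
    moreover have "x \<in> U" using x supp_subset by (auto simp: U_def)
    ultimately have "0 < emeasure \<mu> U" using x by (auto simp: supp_def)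
    moreover have "emeasure \<mu> U = 0"
      using AE_iff_measurable[OF open_in_sets[OF U], of "\<lambda>x. f x = 0"] ae by (auto simp: U_def)
    ultimately show False by simp
  qed
next
  assume "\<forall>x\<in>supp G \<mu>. f x = 0"
  then show "AE x in \<mu>. f x = 0" using AE_supp by (auto elim: eventually_mono)
qed

lemma integral_square_zero_iff:
  assumes f: "f \<in> H1 G"
  shows "(\<integral>x. f x * f x \<partial>\<mu>) = 0 \<longleftrightarrow> (\<forall>x\<in>supp G \<mu>. f x = 0)"
proof -
  have "(\<integral>x. f x * f x \<partial>\<mu>) = 0 \<longleftrightarrow> (AE x in \<mu>. f x * f x = 0)"
    using L2_mult_integrable[OF H1_L2[OF f] H1_L2[OF f]] by (intro integral_nonneg_eq_0_iff_AE) auto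
  then show ?thesis using AE_zero_iff[OF H1_continuous[OF f]] by simp
qed

end

section \<open>The eigenvalue equation\<close>

context finite_metric_graph
begin

lemma energy_nonneg_perturbation_imp_zero:
  assumes "g \<in> H1 G" "\<psi> \<in> H1 G" and "\<And>t. Q g \<le> Q (\<lambda>x. g x + t * \<psi> x)"
  shows "q g \<psi> = 0"
proof -
  have "(q g \<psi>)^2 \<le> 0 * q \<psi> \<psi>"
  proof (rule quadratic_nonneg_imp_le[OF _ energy_nonneg])
    show "0 \<le> 0 + 2 * t * q g \<psi> + t^2 * q \<psi> \<psi>" for t
      using assms(3)[of t] energy_add_scaled[OF assms(1,2), of t] by simp
  qed
  then show ?thesis by simp
qed

lemma minimizing_sequence:
  fixes F :: "'c \<Rightarrow> real"
  assumes "S \<noteq> {}" "\<And>f. f \<in> S \<Longrightarrow> 0 \<le> F f"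
  obtains f m where "\<And>n. f n \<in> S" "(\<lambda>n :: nat. F (f n)) \<longlonglongrightarrow> m" "\<And>g. g \<in> S \<Longrightarrow> m \<le> F g"
    "\<And>n. F (f n) \<le> m + 1 / real (Suc n)"
proof -
  define m where "m = Inf (F ` S)"
  have bdd: "bdd_below (F ` S)" using assms(2) by (auto intro!: bdd_belowI[of _ 0])
  have lb: "m \<le> F g" if "g \<in> S" for g unfolding m_def using that bdd by (intro cInf_lower) auto
  have "\<exists>f\<in>S. F f < m + 1 / real (Suc n)" for n
  proof -
    have "Inf (F ` S) < m + 1 / real (Suc n)" by (simp add: m_def)
    then show ?thesis using cInf_less_iff[of "F ` S"] bdd assms(1) by auto
  qed
  then obtain f where f: "\<And>n. f n \<in> S" "\<And>n. F (f n) < m + 1 / real (Suc n)" by metis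
  have "(\<lambda>n. F (f n)) \<longlonglongrightarrow> m"
  proof (rule tendsto_sandwich[of "\<lambda>_. m" _ _ "\<lambda>n. m + 1 / real (Suc n)"])
    show "(\<lambda>n. m + 1 / real (Suc n)) \<longlonglongrightarrow> m"
      using tendsto_add[OF tendsto_const LIMSEQ_Suc[OF lim_1_over_n], of m] by simp
  qed (use f lb in \<open>auto intro!: always_eventually less_imp_le\<close>)
  then show thesis using that[of f m] f lb by (meson less_imp_le)
qed

text \<open>The common end of both minimisations: \<open>D m n\<close> is the energy of a
  difference, and \<open>d n\<close> measures by how much the \<open>n\<close>-th competitor misses
  the minimum.\<close>

lemma Cauchy_from_defect:
  fixes d :: "nat \<Rightarrow> real" and D :: "nat \<Rightarrow> nat \<Rightarrow> real"
  assumes "d \<longlonglongrightarrow> 0" "\<And>m n. D m n \<le> d m + d n" "0 < e"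
  shows "\<exists>N. \<forall>m\<ge>N. \<forall>n\<ge>N. D m n < e"
proof -
  have "\<forall>\<^sub>F n in sequentially. d n < e / 2" using assms(1,3) by (intro order_tendstoD) auto
  then obtain N where "\<And>n. N \<le> n \<Longrightarrow> d n < e / 2" by (auto simp: eventually_sequentially)
  then have "D m n < e" if "N \<le> m" "N \<le> n" for m n
    using assms(2)[of m n] that by (smt (verit) field_sum_of_halves)
  then show ?thesis by blast
qed

text \<open>The replacement minimises the energy among the functions with the given values on \<open>S\<close>.\<close>

lemma harmonic_replacement:
  assumes S: "S \<noteq> {}" "S \<subseteq> X" and \<phi>: "\<phi> \<in> H1 G"
  obtains g where "g \<in> H1 G" "\<And>x. x \<in> S \<Longrightarrow> g x = \<phi> x" "harmonic_on G (X - S) g"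
proof -
  define Z where "Z = {\<psi> \<in> H1 G. \<forall>x\<in>S. \<psi> x = \<phi> x}"
  have "Z \<noteq> {}" using \<phi> by (auto simp: Z_def)
  then obtain f m where f: "\<And>n. f n \<in> Z" and lim: "(\<lambda>n :: nat. Q (f n)) \<longlonglongrightarrow> m"
    and m: "\<And>g. g \<in> Z \<Longrightarrow> m \<le> Q g"
    by (rule minimizing_sequence[of Z "\<lambda>f. Q f"]) (use energy_nonneg in auto)
  have fH: "f n \<in> H1 G" for n using f by (simp add: Z_def)
  have Cauchy: "\<exists>N. \<forall>i\<ge>N. \<forall>j\<ge>N. Q (\<lambda>x. f i x - f j x) < e" if "0 < e" for e
  proof (rule Cauchy_from_defect[OF _ _ that])
    show "(\<lambda>n. 2 * (Q (f n) - m)) \<longlonglongrightarrow> 0"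
      using tendsto_mult_right_zero[of "\<lambda>n. Q (f n) - m" sequentially 2] lim by (simp add: LIM_zero)
    fix i j
    \<comment> \<open>The midpoint keeps the prescribed values, so its energy is at least
      \<open>m\<close>, and the parallelogram identity bounds the energy of the difference.\<close>
    have "(\<lambda>x. (1/2) * f i x + (1/2) * f j x) \<in> Z"
      using f[of i] f[of j] H1_lincomb[of "f i" "f j" "1/2" "1/2"] by (simp add: Z_def)
    then show "Q (\<lambda>x. f i x - f j x) \<le> 2 * (Q (f i) - m) + 2 * (Q (f j) - m)"
      using m energy_parallelogram[OF fH fH, of i j] by fastforce
  qed
  obtain C where C: "0 \<le> C" "\<And>f x y. f \<in> H1 G \<Longrightarrow> x \<in> X \<Longrightarrow> y \<in> X \<Longrightarrow> \<bar>f x - f y\<bar> \<le> C * sqrt (Q f)"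
    using H1_oscillation by blast
  \<comment> \<open>All \<open>f n\<close> agree at this anchor point. Differences vanish there, so
    the oscillation bound turns closeness in energy into uniform closeness.\<close>
  obtain s where s: "s \<in> S" using S by blast
  have "uniformly_Cauchy_on X f"
    unfolding uniformly_Cauchy_on_def
  proof (intro allI impI)
    fix e :: real assume e: "0 < e"
    obtain N where N: "\<And>i j. N \<le> i \<Longrightarrow> N \<le> j \<Longrightarrow> Q (\<lambda>x. f i x - f j x) < (e / (C + 1))^2"
      using Cauchy[of "(e / (C + 1))^2"] e C(1) by auto
    have "dist (f i x) (f j x) < e" if "x \<in> X" "N \<le> i" "N \<le> j" for x i j
    proof -
      have "f i s = f j s" using f s by (simp add: Z_def)
      then have "\<bar>f i x - f j x\<bar> \<le> C * sqrt (Q (\<lambda>x. f i x - f j x))"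
        using C(2)[OF H1_diff[OF fH fH] that(1), of s i j] s S(2) by auto
      also have "\<dots> \<le> C * (e / (C + 1))"
        using N[OF that(2,3)] e C(1) real_sqrt_le_mono[OF less_imp_le[OF N[OF that(2,3)]]]
        by (intro mult_left_mono) auto
      also have "\<dots> < e" using e C(1) by (simp add: field_simps)
      finally show ?thesis by (simp add: dist_real_def)
    qed
    then show "\<exists>M. \<forall>x\<in>X. \<forall>m\<ge>M. \<forall>n\<ge>M. dist (f m x) (f n x) < e" by blast
  qed
  then obtain g where ul: "uconv f g"
    unfolding uniformly_convergent_eq_Cauchy[symmetric] uniformly_convergent_on_def by blast
  note g = H1_closed[OF fH ul Cauchy]
  have qg: "Q g = m" using LIMSEQ_unique[OF energy_tendsto(2)[OF fH g] lim] .
  have gS: "g x = \<phi> x" if "x \<in> S" for x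
  proof -
    have "(\<lambda>n. f n x) \<longlonglongrightarrow> g x" using tendsto_uniform_limitI[OF ul] that S by blast
    moreover have "f n x = \<phi> x" for n using f that by (simp add: Z_def)
    ultimately show ?thesis by (simp add: LIMSEQ_const_iff)
  qed
  have "q g \<psi> = 0" if "\<psi> \<in> H1 G" "\<forall>x\<in>X - (X - S). \<psi> x = 0" for \<psi>
  proof (rule energy_nonneg_perturbation_imp_zero[OF g(1) that(1)])
    fix t
    have "(\<lambda>x. g x + t * \<psi> x) \<in> Z"
      using H1_add_scaled[OF g(1) that(1), of t] that(2) gS S(2) by (auto simp: Z_def)
    then show "Q g \<le> Q (\<lambda>x. g x + t * \<psi> x)" using m qg by simp
  qed
  then have "harmonic_on G (X - S) g" using g(1) by (simp add: harmonic_on_def)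
  then show thesis using that g(1) gS by blast
qed

end

section \<open>Inner product, eigenspaces and orthonormal systems of one measure\<close>

context graph_measure
begin

abbreviation ip :: "(('v, 'e) point \<Rightarrow> real) \<Rightarrow> (('v, 'e) point \<Rightarrow> real) \<Rightarrow> real" where
  "ip f g \<equiv> integral\<^sup>L \<mu> (\<lambda>x. f x * g x)"

lemma ip_integrable: "f \<in> H1 G \<Longrightarrow> g \<in> H1 G \<Longrightarrow> integrable \<mu> (\<lambda>x. f x * g x)"
  by (intro L2_mult_integrable H1_L2)

lemma ip_commute: "ip f g = ip g f" by (simp add: mult.commute)

lemma ip_lincomb_left:
  assumes "f \<in> H1 G" "g \<in> H1 G" "h \<in> H1 G"
  shows "ip (\<lambda>x. a * f x + b * g x) h = a * ip f h + b * ip g h"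
proof -
  have "ip (\<lambda>x. a * f x + b * g x) h = (\<integral>x. a * (f x * h x) + b * (g x * h x) \<partial>\<mu>)"
    by (simp add: algebra_simps)
  then show ?thesis using ip_integrable[OF assms(1,3)] ip_integrable[OF assms(2,3)] by simp
qed

lemma ip_sum_left:
  assumes "\<And>i. i \<in> I \<Longrightarrow> f i \<in> H1 G" "g \<in> H1 G"
  shows "ip (\<lambda>x. \<Sum>i\<in>I. c i * f i x) g = (\<Sum>i\<in>I. c i * ip (f i) g)"
proof -
  have "ip (\<lambda>x. \<Sum>i\<in>I. c i * f i x) g = (\<integral>x. (\<Sum>i\<in>I. c i * (f i x * g x)) \<partial>\<mu>)"
    by (simp add: sum_distrib_right mult.assoc)
  also have "\<dots> = (\<Sum>i\<in>I. c i * ip (f i) g)"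
    using assms ip_integrable by (subst Bochner_Integration.integral_sum) auto
  finally show ?thesis .
qed

lemma ip_diff_left: "f \<in> H1 G \<Longrightarrow> g \<in> H1 G \<Longrightarrow> h \<in> H1 G \<Longrightarrow> ip (\<lambda>x. f x - g x) h = ip f h - ip g h"
  using ip_lincomb_left[of f g h 1 "-1"] by simp

lemma ip_nonneg: "0 \<le> ip f f" by simp

lemma ip_add_scaled:
  assumes "f \<in> H1 G" "g \<in> H1 G"
  shows "ip (\<lambda>x. f x + t * g x) (\<lambda>x. f x + t * g x) = ip f f + 2 * t * ip f g + t^2 * ip g g"
  using L2_integral_square_lincomb[OF H1_L2[OF assms(1)] H1_L2[OF assms(2)], of t]
  by (simp add: power2_eq_square)

text \<open>If the value at \<open>x\<close> exceeds the possible oscillation by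
  \<open>m > 0\<close>, then the modulus of \<open>f\<close> is at least \<open>m\<close>
  everywhere, and integrating the square bounds \<open>m\<close>.\<close>

lemma H1_sup_bound:
  assumes C: "0 \<le> C" "\<And>f x y. f \<in> H1 G \<Longrightarrow> x \<in> X \<Longrightarrow> y \<in> X \<Longrightarrow> \<bar>f x - f y\<bar> \<le> C * sqrt (Q f)"
    and f: "f \<in> H1 G" and x: "x \<in> X"
  shows "\<bar>f x\<bar> \<le> C * sqrt (Q f) + sqrt (ip f f / measure \<mu> X)"
proof (cases "\<bar>f x\<bar> \<le> C * sqrt (Q f)")
  case True
  then show ?thesis using measure_space_pos ip_nonneg[of f] by (simp add: add_increasing2)
next
  case False
  define m where "m = \<bar>f x\<bar> - C * sqrt (Q f)"
  have m: "0 < m" using False by (simp add: m_def)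
  have "m^2 * measure \<mu> X = (\<integral>x. m^2 \<partial>\<mu>)" by simp
  also have "\<dots> \<le> ip f f"
  proof (rule integral_mono)
    fix y assume "y \<in> space \<mu>"
    then have "m \<le> \<bar>f y\<bar>" using C(2)[OF f x, of y] by (simp add: m_def)
    then have "m^2 \<le> \<bar>f y\<bar>^2" using m by (intro power_mono) auto
    then show "m^2 \<le> f y * f y" by (simp add: power2_eq_square)
  qed (use ip_integrable[OF f f] in auto)
  finally have "m^2 \<le> ip f f / measure \<mu> X" using measure_space_pos by (simp add: pos_le_divide_eq)
  then have "m \<le> sqrt (ip f f / measure \<mu> X)" by (rule real_le_rsqrt)
  then show ?thesis by (simp add: m_def)
qed

definition eigenspace :: "real \<Rightarrow> (('v, 'e) point \<Rightarrow> real) set" where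
  "eigenspace a = {f \<in> H1 G. \<forall>\<phi>\<in>H1 G. q f \<phi> = a * ip f \<phi>}"

lemma H_op_iff_eigenspace: "H_op G \<mu> f (\<lambda>x. a * f x) \<longleftrightarrow> f \<in> eigenspace a"
proof
  assume H: "H_op G \<mu> f (\<lambda>x. a * f x)"
  then have f: "f \<in> H1 G" "harmonic_on G (X - supp G \<mu>) f" by (auto simp: H_op_def H1_mu_def)
  have "q f \<phi> = a * ip f \<phi>" if \<phi>: "\<phi> \<in> H1 G" for \<phi>
  proof -
    \<comment> \<open>\<open>H_op\<close> admits only test functions harmonic off the support.
      Replacing \<open>\<phi>\<close> by \<open>g\<close> changes neither side: the inner product
      sees only the support, and \<phi> - g vanishes there, so it is energy-orthogonal to the
      harmonic \<open>f\<close>.\<close>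
    obtain g where g: "g \<in> H1 G" "\<And>x. x \<in> supp G \<mu> \<Longrightarrow> g x = \<phi> x" "harmonic_on G (X - supp G \<mu>) g"
      using harmonic_replacement[OF supp_nonempty supp_subset \<phi>] by blast
    have "q f g = a * ip f g"
      using H g by (auto simp: H_op_def H1_mu_def mult.assoc)
    moreover have "ip f g = ip f \<phi>"
      by (rule Bochner_Integration.integral_cong_AE)
        (use AE_supp g H1_L2[OF f(1)] H1_L2[OF g(1)] H1_L2[OF \<phi>] in
          \<open>auto intro!: borel_measurable_times elim: eventually_mono\<close>)
    moreover have "q f (\<lambda>x. \<phi> x - g x) = 0"
      using f(2) H1_diff[OF \<phi> g(1)] g(2) by (auto simp: harmonic_on_def)
    then have "q f \<phi> = q f g"
      using energy_diff_left[OF \<phi> g(1) f(1)] by (simp add: energy_commute[of f])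
    ultimately show ?thesis by simp
  qed
  then show "f \<in> eigenspace a" using f by (simp add: eigenspace_def)
next
  assume "f \<in> eigenspace a"
  then have f: "f \<in> H1 G" "\<And>\<phi>. \<phi> \<in> H1 G \<Longrightarrow> q f \<phi> = a * ip f \<phi>" by (auto simp: eigenspace_def)
  have "q f \<phi> = 0" if \<phi>: "\<phi> \<in> H1 G" "\<forall>x\<in>X - (X - supp G \<mu>). \<phi> x = 0" for \<phi>
  proof -
    have "AE x in \<mu>. f x * \<phi> x = 0" using AE_supp
      by eventually_elim (use \<phi>(2) supp_subset in auto)
    then have "ip f \<phi> = 0" by (rule integral_eq_zero_AE)
    then show ?thesis using f \<phi> by simp
  qed
  then have "harmonic_on G (X - supp G \<mu>) f" using f by (simp add: harmonic_on_def)
  then have "f \<in> H1_mu G \<mu>" using f by (simp add: H1_mu_def)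
  moreover have "(\<lambda>x. a * f x) \<in> L2 \<mu>" by (intro H1_L2 H1_scale f)
  ultimately show "H_op G \<mu> f (\<lambda>x. a * f x)"
    using f by (auto simp: H_op_def H1_mu_def mult.assoc)
qed

lemma eigenspace_H1: "f \<in> eigenspace a \<Longrightarrow> f \<in> H1 G" by (simp add: eigenspace_def)

lemma eigenspace_energy: "f \<in> eigenspace a \<Longrightarrow> \<phi> \<in> H1 G \<Longrightarrow> q f \<phi> = a * ip f \<phi>"
  by (simp add: eigenspace_def)

lemma eigenspace_orthogonal:
  assumes "f \<in> eigenspace a" "g \<in> eigenspace b" "a \<noteq> b"
  shows "ip f g = 0"
proof -
  have "a * ip f g = b * ip f g"
    using eigenspace_energy[OF assms(1) eigenspace_H1[OF assms(2)]]
      eigenspace_energy[OF assms(2) eigenspace_H1[OF assms(1)]] energy_commute[of f g] ip_commute[of f g] by metis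
  then show ?thesis using assms(3) by (metis mult_cancel_right)
qed

lemma eigenspace_lincomb:
  assumes "f \<in> eigenspace a" "g \<in> eigenspace a"
  shows "(\<lambda>x. s * f x + t * g x) \<in> eigenspace a"
proof -
  have f: "f \<in> H1 G" "g \<in> H1 G" using assms by (auto dest: eigenspace_H1)
  have "q (\<lambda>x. s * f x + t * g x) \<phi> = a * ip (\<lambda>x. s * f x + t * g x) \<phi>" if "\<phi> \<in> H1 G" for \<phi>
    unfolding energy_lincomb_left[OF f that] ip_lincomb_left[OF f that]
      eigenspace_energy[OF assms(1) that] eigenspace_energy[OF assms(2) that]
    by (simp only: distrib_left mult_ac)
  then show ?thesis using H1_lincomb[OF f] by (simp add: eigenspace_def)
qed

definition orthonormal :: "nat \<Rightarrow> (nat \<Rightarrow> ('v, 'e) point \<Rightarrow> real) \<Rightarrow> bool" where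
  "orthonormal n v \<longleftrightarrow> (\<forall>i<n. v i \<in> H1 G) \<and> (\<forall>i<n. \<forall>j<n. ip (v i) (v j) = (if i = j then 1 else 0))"

lemma orthonormal_ip_sum:
  assumes "orthonormal n v" "j < n"
  shows "ip (\<lambda>x. \<Sum>i<n. c i * v i x) (v j) = c j"
proof -
  have "ip (\<lambda>x. \<Sum>i<n. c i * v i x) (v j) = (\<Sum>i<n. c i * ip (v i) (v j))"
    using assms by (intro ip_sum_left) (auto simp: orthonormal_def)
  also have "\<dots> = (\<Sum>i<n. if i = j then c i else 0)"
    using assms by (intro sum.cong) (auto simp: orthonormal_def)
  also have "\<dots> = c j" using assms by simp
  finally show ?thesis .
qed

lemma orthonormal_independent:
  assumes "orthonormal n v"
  shows "L2_independent \<mu> n v"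
  unfolding L2_independent_def
proof (intro allI impI)
  fix c and i :: nat assume ae: "AE x in \<mu>. (\<Sum>i<n. c i * v i x) = 0" and i: "i < n"
  have "ip (\<lambda>x. \<Sum>i<n. c i * v i x) (v i) = 0"
    using ae by (intro integral_eq_zero_AE) (auto elim: eventually_mono)
  then show "c i = 0" using orthonormal_ip_sum[OF assms i] by simp
qed

lemma projection_orthogonal:
  assumes "orthonormal n v" "\<phi> \<in> H1 G" "j < n"
  shows "ip (\<lambda>x. \<phi> x - (\<Sum>i<n. ip \<phi> (v i) * v i x)) (v j) = 0"
  using assms orthonormal_ip_sum[OF assms(1,3), of "\<lambda>i. ip \<phi> (v i)"]
  by (subst ip_diff_left) (auto simp: orthonormal_def intro!: H1_sum)

end

context finite_metric_graph
begin

text \<open>In this context an unfixed \<open>\<mu>\<close> would denote the shortest path length of \<open>Graph_Theory\<close>.\<close>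

lemma weak_star_integral_tendsto:
  fixes \<mu> :: "('v, 'e) point measure"
  assumes \<mu>s: "\<And>m. \<mu>s m \<in> nonzero_finite_measures G" and \<mu>: "\<mu> \<in> nonzero_finite_measures G"
    and ws: "weak_star_conv G \<mu>s \<mu>"
    and h: "\<And>m. cont (h m)"
    and H: "cont H" "uconv h H"
  shows "(\<lambda>m. integral\<^sup>L (\<mu>s m) (h m)) \<longlonglongrightarrow> integral\<^sup>L \<mu> H"
proof (rule LIMSEQ_I)
  interpret M: graph_measure G \<mu> by unfold_locales (rule \<mu>)
  fix e :: real assume e: "0 < e"
  \<comment> \<open>The masses converge, so \<open>K\<close> eventually bounds them all, and
    replacing \<open>h m\<close> by \<open>H\<close> costs at most \<open>e / 2\<close>.\<close>
  define K where "K = measure \<mu> X + 1"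
  have K: "0 < K" by (simp add: K_def add_nonneg_pos)
  have "(\<lambda>m. integral\<^sup>L (\<mu>s m) (\<lambda>x. 1 :: real)) \<longlonglongrightarrow> integral\<^sup>L \<mu> (\<lambda>x. 1 :: real)"
    by (rule ws[unfolded weak_star_conv_def, rule_format]) simp
  moreover have "integral\<^sup>L (\<mu>s m) (\<lambda>x. 1 :: real) = measure (\<mu>s m) X" for m
  proof -
    interpret graph_measure G "\<mu>s m" by unfold_locales (rule \<mu>s)
    show ?thesis by simp
  qed
  ultimately have "(\<lambda>m. measure (\<mu>s m) X) \<longlonglongrightarrow> measure \<mu> X" by simp
  then have 1: "\<forall>\<^sub>F m in sequentially. measure (\<mu>s m) X < K" by (rule order_tendstoD) (simp add: K_def)
  have 2: "\<forall>\<^sub>F m in sequentially. \<forall>x\<in>X. \<bar>h m x - H x\<bar> < e / 2 / K"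
    using uniform_limitD[OF H(2), of "e / 2 / K"] e K by (simp add: dist_real_def)
  have "(\<lambda>m. integral\<^sup>L (\<mu>s m) H) \<longlonglongrightarrow> integral\<^sup>L \<mu> H" using ws H(1) by (simp add: weak_star_conv_def)
  then have 3: "\<forall>\<^sub>F m in sequentially. \<bar>integral\<^sup>L (\<mu>s m) H - integral\<^sup>L \<mu> H\<bar> < e / 2"
    unfolding dist_real_def[symmetric] by (rule tendstoD) (use e in simp)
  have "\<forall>\<^sub>F m in sequentially. norm (integral\<^sup>L (\<mu>s m) (h m) - integral\<^sup>L \<mu> H) < e"
    using 1 2 3
  proof eventually_elim
    fix m assume m: "measure (\<mu>s m) X < K" "\<forall>x\<in>X. \<bar>h m x - H x\<bar> < e / 2 / K"
      "\<bar>integral\<^sup>L (\<mu>s m) H - integral\<^sup>L \<mu> H\<bar> < e / 2"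
    interpret graph_measure G "\<mu>s m" by unfold_locales (rule \<mu>s)
    have i: "integrable (\<mu>s m) (h m)" "integrable (\<mu>s m) H"
      using L2_integrable[OF continuous_map_L2] h H(1) by blast+
    have "\<bar>\<integral>x. h m x - H x \<partial>\<mu>s m\<bar> \<le> (\<integral>x. \<bar>h m x - H x\<bar> \<partial>\<mu>s m)" by (rule integral_abs_bound)
    also have "\<dots> \<le> (\<integral>x. e / 2 / K \<partial>\<mu>s m)"
      by (rule integral_mono) (use i m(2) in \<open>auto simp: less_imp_le\<close>)
    also have "\<dots> = e / 2 / K * measure (\<mu>s m) X" by simp
    also have "\<dots> \<le> e / 2 / K * K" using e K m(1) by (intro mult_left_mono) auto
    also have "\<dots> = e / 2" using K by simp
    finally have "\<bar>integral\<^sup>L (\<mu>s m) (h m) - integral\<^sup>L (\<mu>s m) H\<bar> \<le> e / 2"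
      unfolding Bochner_Integration.integral_diff[OF i] .
    then show "norm (integral\<^sup>L (\<mu>s m) (h m) - integral\<^sup>L \<mu> H) < e"
      unfolding real_norm_def using m(3) by linarith
  qed
  then show "\<exists>N. \<forall>m\<ge>N. norm (integral\<^sup>L (\<mu>s m) (h m) - integral\<^sup>L \<mu> H) < e"
    by (simp add: eventually_sequentially)
qed

text \<open>Both functions and the measure may vary together: products of uniformly convergent
  sequences converge uniformly because the limits are bounded on the graph.\<close>

lemma weak_star_ip_tendsto:
  fixes \<mu> :: "('v, 'e) point measure"
  assumes "\<And>m. \<mu>s m \<in> nonzero_finite_measures G" "\<mu> \<in> nonzero_finite_measures G" "weak_star_conv G \<mu>s \<mu>"
    and f: "\<And>n. f n \<in> H1 G" "uconv f F" "F \<in> H1 G"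
    and g: "\<And>n. g n \<in> H1 G" "uconv g H" "H \<in> H1 G"
  shows "(\<lambda>m. \<integral>x. f m x * g m x \<partial>\<mu>s m) \<longlonglongrightarrow> (\<integral>x. F x * H x \<partial>\<mu>)"
proof (rule weak_star_integral_tendsto[OF assms(1-3)])
  have bdd: "bounded (h ` X)" if h: "h \<in> H1 G" for h
  proof -
    obtain K where "\<And>x. x \<in> X \<Longrightarrow> \<bar>h x\<bar> \<le> K" using continuous_map_bounded[OF H1_continuous[OF h]] by blast
    then show ?thesis by (auto simp: bounded_iff)
  qed
  show "uconv (\<lambda>n x. f n x * g n x) (\<lambda>x. F x * H x)"
    by (intro uniform_lim_mult f g bdd)
qed (use f g H1_continuous in \<open>auto intro!: continuous_map_real_mult\<close>)

end

context graph_measure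
begin

lemma ip_tendsto_uniform:
  assumes "\<And>n. f n \<in> H1 G" "uconv f F" "F \<in> H1 G"
    and "\<And>n. g n \<in> H1 G" "uconv g H" "H \<in> H1 G"
  shows "(\<lambda>n. ip (f n) (g n)) \<longlonglongrightarrow> ip F H"
  by (rule weak_star_ip_tendsto[OF nonzero_finite_measure nonzero_finite_measure _ assms])
    (simp add: weak_star_conv_def)

section \<open>Variational construction of the eigenvalues\<close>

text \<open>Minimisation of the Rayleigh quotient on the orthogonal complement of the earlier
  eigenfunctions. The unit sphere is not convex, but a midpoint misses norm one only by a quarter of
  the squared distance, which tends to zero once the sequence converges uniformly.\<close>

lemma eigenfunction_minimizer_exists:
  assumes on: "orthonormal k v" and ev: "\<And>i. i < k \<Longrightarrow> v i \<in> eigenspace (l i)"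
    and h: "h \<in> H1 G" "\<And>i. i < k \<Longrightarrow> ip h (v i) = 0" "ip h h \<noteq> 0"
  obtains a w where "w \<in> eigenspace a" "ip w w = 1" "\<And>i. i < k \<Longrightarrow> ip w (v i) = 0"
    "\<And>f. f \<in> H1 G \<Longrightarrow> (\<And>i. i < k \<Longrightarrow> ip f (v i) = 0) \<Longrightarrow> a * ip f f \<le> Q f"
proof -
  have vH: "v i \<in> H1 G" if "i < k" for i using ev[OF that] by (rule eigenspace_H1)
  define W where "W = {f \<in> H1 G. \<forall>i<k. ip f (v i) = 0}"
  define S where "S = {f \<in> W. ip f f = 1}"
  have W_lincomb: "(\<lambda>x. s * f x + t * g x) \<in> W" if "f \<in> W" "g \<in> W" for f g s t
    using that vH by (auto simp: W_def H1_lincomb ip_lincomb_left)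
  have ip_scale: "ip (\<lambda>x. c * f x) (\<lambda>x. c * f x) = c^2 * ip f f" for c f
    by (simp add: power2_eq_square mult_ac flip: Bochner_Integration.integral_mult_right_zero)
  have normalize: "\<exists>c. c^2 * ip f f = 1 \<and> (\<lambda>x. c * f x) \<in> S" if "f \<in> W" "ip f f \<noteq> 0" for f
  proof -
    have pos: "0 < ip f f" using that(2) ip_nonneg[of f] by linarith
    define c where "c = 1 / sqrt (ip f f)"
    have c: "c^2 * ip f f = 1" using pos by (simp add: c_def power_divide)
    have "(\<lambda>x. c * f x) \<in> W" using W_lincomb[OF that(1,1), of c 0] by simp
    then show ?thesis using c ip_scale[of c f] by (auto simp: S_def)
  qed
  have "S \<noteq> {}" using normalize[of h] h by (auto simp: W_def)
  then obtain f a where f: "\<And>n. f n \<in> S" and lim: "(\<lambda>n :: nat. Q (f n)) \<longlonglongrightarrow> a"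
    and min: "\<And>g. g \<in> S \<Longrightarrow> a \<le> Q g" and le: "\<And>n. Q (f n) \<le> a + 1 / real (Suc n)"
    by (rule minimizing_sequence[of S "\<lambda>f. Q f"]) (use energy_nonneg in auto)
  have fW: "f n \<in> W" and fH: "f n \<in> H1 G" and f1: "ip (f n) (f n) = 1" for n
    using f by (auto simp: S_def W_def)
  have Rayleigh: "a * ip g g \<le> Q g" if "g \<in> W" for g
  proof (cases "ip g g = 0")
    case True
    then show ?thesis using energy_nonneg by simp
  next
    case False
    obtain c where c: "c^2 * ip g g = 1" "(\<lambda>x. c * g x) \<in> S" using normalize[OF \<open>g \<in> W\<close> False] by blast
    have "a \<le> c^2 * Q g"
      using min[OF c(2)] energy_square_lincomb[of g g c 0] \<open>g \<in> W\<close> by (simp add: W_def)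
    then have "a * ip g g \<le> c^2 * Q g * ip g g" by (rule mult_right_mono) simp
    also have "\<dots> = c^2 * ip g g * Q g" by (simp only: mult_ac)
    finally show ?thesis using c(1) by simp
  qed
  obtain C where C: "0 \<le> C" "\<And>f x y. f \<in> H1 G \<Longrightarrow> x \<in> X \<Longrightarrow> y \<in> X \<Longrightarrow> \<bar>f x - f y\<bar> \<le> C * sqrt (Q f)"
    using H1_oscillation by blast
  \<comment> \<open>The first entry bounds the energies, the second the suprema, by
    \<open>H1_sup_bound\<close> for functions of norm one.\<close>
  define K where "K = max (a + 1) (C * sqrt (a + 1) + sqrt (1 / measure \<mu> X))"
  have qf: "Q (f n) \<le> a + 1" for n using le[of n] by (smt (verit) divide_le_eq_1_pos of_nat_Suc of_nat_0_le_iff)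
  obtain w r where r: "strict_mono (r :: nat \<Rightarrow> nat)" and ul: "uconv (\<lambda>n. f (r n)) w"
  proof (rule H1_precompact[of f K])
    show "f n \<in> H1 G" "Q (f n) \<le> K" for n using fH qf[of n] by (auto simp: K_def)
    show "\<bar>f n x\<bar> \<le> K" if "x \<in> X" for n x
    proof -
      have "\<bar>f n x\<bar> \<le> C * sqrt (Q (f n)) + sqrt (1 / measure \<mu> X)"
        using H1_sup_bound[OF C fH that, of n] f1[of n] by simp
      also have "\<dots> \<le> C * sqrt (a + 1) + sqrt (1 / measure \<mu> X)"
        using qf[of n] C(1) by (intro add_right_mono mult_left_mono real_sqrt_le_mono) auto
      finally show ?thesis by (simp add: K_def)
    qed
  qed blast
  define g where "g n = f (r n)" for n
  have gH: "g n \<in> H1 G" and gW: "g n \<in> W" and g1: "ip (g n) (g n) = 1" for n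
    using fH fW f1 by (auto simp: g_def)
  have g_ul: "uconv g w" using ul by (simp add: g_def[abs_def])
  have lim_r: "(\<lambda>n. Q (g n)) \<longlonglongrightarrow> a" using LIMSEQ_subseq_LIMSEQ[OF lim r] by (simp add: o_def g_def)
  \<comment> \<open>Before the energy estimate, \<open>w\<close> is known only to be continuous;
    membership in \<open>H1 G\<close> is a consequence of that estimate.\<close>
  have wc: "cont w" by (rule cont_uniform_limit[OF H1_continuous[OF gH] g_ul])
  \<comment> \<open>Parallelogram identity and Rayleigh bound at the midpoint bound the energy of
    g_i - g_j by twice both energies minus 4 a, plus \<open>a\<close> times the squared distance;
    the latter is split at \<open>w\<close>.\<close>
  define d where "d n = 2 * (Q (g n) - a) + 2 * a * (\<integral>x. (g n x - w x)^2 \<partial>\<mu>)" for n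
  have a0: "0 \<le> a" using lim energy_nonneg by (intro LIMSEQ_le_const[OF lim]) auto
  have wL: "w \<in> L2 \<mu>" by (rule continuous_map_L2[OF wc])
  have d0: "d \<longlonglongrightarrow> 0"
  proof -
    have "(\<lambda>n. \<integral>x. (g n x - w x)^2 \<partial>\<mu>) \<longlonglongrightarrow> (\<integral>x. 0 \<partial>\<mu>)"
    proof (rule weak_star_integral_tendsto[OF nonzero_finite_measure nonzero_finite_measure])
      show "weak_star_conv G (\<lambda>_. \<mu>) \<mu>" by (simp add: weak_star_conv_def)
      show "cont (\<lambda>x. (g n x - w x)^2)" for n
        by (intro continuous_intros H1_continuous gH wc)
      show "uconv (\<lambda>n x. (g n x - w x)^2) (\<lambda>x. 0)"
      proof -
        have "uconv (\<lambda>n x. g n x - w x) (\<lambda>x. w x - w x)"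
          by (intro uniform_limit_intros g_ul)
        then have "uconv (\<lambda>n x. (g n x - w x) * (g n x - w x)) (\<lambda>x. (w x - w x) * (w x - w x))"
          by (intro uniform_lim_mult) (auto simp: image_constant_conv)
        then show ?thesis by (simp add: power2_eq_square)
      qed
    qed auto
    then have "(\<lambda>n. 2 * (Q (g n) - a) + 2 * a * (\<integral>x. (g n x - w x)^2 \<partial>\<mu>)) \<longlonglongrightarrow> 2 * (a - a) + 2 * a * 0"
      by (intro tendsto_intros lim_r) simp
    then show ?thesis by (simp add: d_def[abs_def])
  qed
  have Cauchy: "\<exists>N. \<forall>i\<ge>N. \<forall>j\<ge>N. Q (\<lambda>x. g i x - g j x) < e" if "0 < e" for e
  proof (rule Cauchy_from_defect[OF d0 _ that])
    fix i j
    define m where "m x = (1/2) * g i x + (1/2) * g j x" for x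
    have "m \<in> W" unfolding m_def using W_lincomb[OF gW gW] .
    then have e1: "a * ip m m \<le> Q m" by (rule Rayleigh)
    have e2: "4 * ip m m = 4 - (\<integral>x. (g i x - g j x)^2 \<partial>\<mu>)"
    proof -
      have "4 * ip m m = ip (\<lambda>x. g i x + 1 * g j x) (\<lambda>x. g i x + 1 * g j x)"
        by (simp add: m_def field_simps flip: Bochner_Integration.integral_mult_right_zero)
      also have "\<dots> = 2 + 2 * ip (g i) (g j)" using ip_add_scaled[OF gH gH, of i 1 j] g1[of i] g1[of j] by simp
      also have "\<dots> = 4 - ip (\<lambda>x. g i x + (-1) * g j x) (\<lambda>x. g i x + (-1) * g j x)"
        using ip_add_scaled[OF gH gH, of i "-1" j] g1[of i] g1[of j] by simp
      finally show ?thesis by (simp add: power2_eq_square)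
    qed
    have "(\<integral>x. (g i x - g j x)^2 \<partial>\<mu>) \<le> 2 * (\<integral>x. (g i x - w x)^2 \<partial>\<mu>) + 2 * (\<integral>x. (g j x - w x)^2 \<partial>\<mu>)"
      using L2_square_integral_add_le[OF L2_diff[OF H1_L2[OF gH] wL] L2_diff[OF wL H1_L2[OF gH]], of i j]
      by (simp add: power2_commute[of "w _"])
    then have e3: "a * (\<integral>x. (g i x - g j x)^2 \<partial>\<mu>) \<le> a * (2 * (\<integral>x. (g i x - w x)^2 \<partial>\<mu>) + 2 * (\<integral>x. (g j x - w x)^2 \<partial>\<mu>))"
      using a0 by (rule mult_left_mono)
    have e4: "Q (\<lambda>x. g i x - g j x) = 2 * Q (g i) + 2 * Q (g j) - 4 * Q m"
      unfolding m_def by (rule energy_parallelogram[OF gH gH])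
    have "4 * (a * ip m m) = a * (4 * ip m m)" by simp
    also have "\<dots> = 4 * a - a * (\<integral>x. (g i x - g j x)^2 \<partial>\<mu>)"
      unfolding e2 by (simp add: right_diff_distrib)
    finally have e5: "4 * (a * ip m m) = 4 * a - a * (\<integral>x. (g i x - g j x)^2 \<partial>\<mu>)" .
    have e6: "d i + d j = 2 * Q (g i) + 2 * Q (g j) - 4 * a +
        a * (2 * (\<integral>x. (g i x - w x)^2 \<partial>\<mu>) + 2 * (\<integral>x. (g j x - w x)^2 \<partial>\<mu>))"
      unfolding d_def by (simp add: algebra_simps)
    show "Q (\<lambda>x. g i x - g j x) \<le> d i + d j"
      using e1 e3 e5 unfolding e4 e6 by linarith
  qed
  have w: "w \<in> H1 G" "(\<lambda>n. Q (\<lambda>x. g n x - w x)) \<longlonglongrightarrow> 0"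
    using H1_closed[OF gH g_ul Cauchy] by blast+
  have qw: "Q w = a" using LIMSEQ_unique[OF energy_tendsto(2)[OF gH w] lim_r] .
  have w1: "ip w w = 1"
    using ip_tendsto_uniform[OF gH g_ul w(1) gH g_ul w(1)] g1 by (simp add: LIMSEQ_const_iff)
  have w_orth: "ip w (v i) = 0" if i: "i < k" for i
  proof -
    have "(\<lambda>n. ip (g n) (v i)) \<longlonglongrightarrow> ip w (v i)"
      by (rule ip_tendsto_uniform[OF gH g_ul w(1) vH[OF i] _ vH[OF i]]) (rule uniform_limitI, simp)
    then show ?thesis using gW i by (simp add: W_def LIMSEQ_const_iff)
  qed
  have wW: "w \<in> W" using w(1) w_orth by (simp add: W_def)
  \<comment> \<open>In the Rayleigh bound at w + t \<phi> the constant terms cancel because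
    \<open>Q w = a\<close> and \<open>w\<close> has norm one; the linear coefficient must then
    vanish.\<close>
  have EL: "q w \<phi> = a * ip w \<phi>" if \<phi>: "\<phi> \<in> W" for \<phi>
  proof -
    have \<phi>H: "\<phi> \<in> H1 G" using \<phi> by (simp add: W_def)
    have "(q w \<phi> - a * ip w \<phi>)^2 \<le> 0 * (q \<phi> \<phi> - a * ip \<phi> \<phi>)"
    proof (rule quadratic_nonneg_imp_le)
      show "0 \<le> 0 + 2 * t * (q w \<phi> - a * ip w \<phi>) + t^2 * (q \<phi> \<phi> - a * ip \<phi> \<phi>)" for t
      proof -
        have "(\<lambda>x. w x + t * \<phi> x) \<in> W" using W_lincomb[OF wW \<phi>, of 1 t] by simp
        from Rayleigh[OF this] show ?thesis
          unfolding energy_add_scaled[OF w(1) \<phi>H] ip_add_scaled[OF w(1) \<phi>H] qw w1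
          by (simp only: algebra_simps)
      qed
      show "0 \<le> q \<phi> \<phi> - a * ip \<phi> \<phi>" using Rayleigh[OF \<phi>] by simp
    qed
    then show ?thesis by simp
  qed
  have "q w \<phi> = a * ip w \<phi>" if \<phi>: "\<phi> \<in> H1 G" for \<phi>
  proof -
    \<comment> \<open>The projection to the earlier eigenfunctions extends the equation from
      \<open>W\<close> to all of \<open>H1 G\<close>: both sides vanish at \<open>p\<close>, since
      each \<open>v i\<close> is an eigenfunction orthogonal to \<open>w\<close>.\<close>
    define p where "p x = (\<Sum>i<k. ip \<phi> (v i) * v i x)" for x
    have pH: "p \<in> H1 G" unfolding p_def using vH by (intro H1_sum) auto
    have "(\<lambda>x. \<phi> x - p x) \<in> W"
      using projection_orthogonal[OF on \<phi>] H1_diff[OF \<phi> pH] by (simp add: W_def p_def)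
    then have 1: "q w (\<lambda>x. \<phi> x - p x) = a * ip w (\<lambda>x. \<phi> x - p x)" by (rule EL)
    have "q p w = 0"
    proof -
      have "q (v i) w = 0" if "i < k" for i
        using eigenspace_energy[OF ev[OF that] w(1)] w_orth[OF that] ip_commute[of w "v i"] by simp
      then show ?thesis unfolding p_def using vH w(1) by (subst energy_sum_left) auto
    qed
    moreover have "ip p w = 0"
    proof -
      have "ip (v i) w = 0" if "i < k" for i using w_orth[OF that] ip_commute[of w "v i"] by simp
      then show ?thesis unfolding p_def using vH w(1) by (subst ip_sum_left) auto
    qed
    ultimately show ?thesis
      using 1 energy_diff_left[OF \<phi> pH w(1)] ip_diff_left[OF \<phi> pH w(1)]
      unfolding energy_commute[of w] ip_commute[of w] by simp
  qed
  then have "w \<in> eigenspace a" using w(1) by (simp add: eigenspace_def)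
  then show thesis using that[of w a] w1 w_orth Rayleigh by (auto simp: W_def)
qed

text \<open>The outcome of \<open>n\<close> successive minimisations, kept as explicit data. The
  last clause is the minimum property on the complement of the earlier functions; the order of the
  \<open>l i\<close> and the multiplicities below \<open>l k\<close> are deduced from it.\<close>

definition spectral :: "nat \<Rightarrow> (nat \<Rightarrow> real) \<Rightarrow> (nat \<Rightarrow> ('v, 'e) point \<Rightarrow> real) \<Rightarrow> bool" where
  "spectral n l v \<longleftrightarrow> orthonormal n v \<and> (\<forall>i<n. v i \<in> eigenspace (l i)) \<and>
     (\<forall>i<n. \<forall>f\<in>H1 G. (\<forall>j<i. ip f (v j) = 0) \<longrightarrow> l i * ip f f \<le> Q f)"

lemma finite_support_separation:
  assumes "finite T" "T \<subseteq> supp G \<mu>"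
  obtains f where "\<And>t. t \<in> T \<Longrightarrow> f t \<in> H1 G" "\<And>s t. s \<in> T \<Longrightarrow> t \<in> T \<Longrightarrow> f s t = (if s = t then 1 else 0)"
proof -
  have "\<exists>g. g \<in> H1 G \<and> (\<forall>t\<in>T. g t = (if s = t then 1 else 0))" for s
    using H1_interpolation[OF assms(1), of "\<lambda>t. if s = t then 1 else 0"] assms(2) supp_subset by (metis subset_iff)
  then show thesis using that by metis
qed

text \<open>Functions separating the points of \<open>T\<close> are independent on the support.
  While \<open>n < card T\<close>, some combination of them is nonzero and orthogonal to the
  \<open>n\<close> functions found so far, so the next minimisation has a competitor.\<close>

lemma spectral_exists:
  assumes T: "finite T" "T \<subseteq> supp G \<mu>" and n: "n \<le> card T"
  shows "\<exists>l v. spectral n l v"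
  using n
proof (induction n)
  case 0
  then show ?case by (simp add: spectral_def orthonormal_def)
next
  case (Suc n)
  then obtain l v where sp: "spectral n l v" by auto
  obtain f where f: "\<And>t. t \<in> T \<Longrightarrow> f t \<in> H1 G" "\<And>s t. s \<in> T \<Longrightarrow> t \<in> T \<Longrightarrow> f s t = (if s = t then 1 else 0)"
    using finite_support_separation[OF T] by blast
  \<comment> \<open>There are \<open>card T\<close> coefficients and only \<open>n\<close>
    orthogonality conditions.\<close>
  obtain c where c: "\<exists>t\<in>T. c t \<noteq> 0" "\<forall>j\<in>{..<n}. (\<Sum>t\<in>T. c t * ip (f t) (v j)) = 0"
    using homogeneous_system_nontrivial_solution[of "{..<n}" T "\<lambda>t j. ip (f t) (v j)"] T Suc.prems by auto
  define h where "h x = (\<Sum>t\<in>T. c t * f t x)" for x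
  have hH: "h \<in> H1 G" unfolding h_def using f by (intro H1_sum) auto
  have h0: "ip h (v j) = 0" if "j < n" for j
  proof -
    have "v j \<in> H1 G" using sp that by (auto simp: spectral_def orthonormal_def)
    then show ?thesis unfolding h_def using f c(2) that by (subst ip_sum_left) auto
  qed
  have h1: "ip h h \<noteq> 0"
  proof
    assume "ip h h = 0"
    then have z: "\<forall>x\<in>supp G \<mu>. h x = 0" using integral_square_zero_iff[OF hH] by simp
    obtain t where t: "t \<in> T" "c t \<noteq> 0" using c(1) by blast
    \<comment> \<open>The value of the combination at \<open>t\<close> is the coefficient
      \<open>c t\<close>, and \<open>t\<close> lies in the support.\<close>
    have "h t = (\<Sum>s\<in>T. if s = t then c s else 0)" unfolding h_def by (intro sum.cong) (use f t in auto)
    then show False using t T z by auto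
  qed
  obtain a w where w: "w \<in> eigenspace a" "ip w w = 1" "\<And>i. i < n \<Longrightarrow> ip w (v i) = 0"
    "\<And>f. f \<in> H1 G \<Longrightarrow> (\<And>i. i < n \<Longrightarrow> ip f (v i) = 0) \<Longrightarrow> a * ip f f \<le> Q f"
  proof (rule eigenfunction_minimizer_exists[of n v l h])
    show "orthonormal n v" "\<And>i. i < n \<Longrightarrow> v i \<in> eigenspace (l i)" using sp by (auto simp: spectral_def)
  qed (use hH h0 h1 in blast)+
  have w': "ip (v i) w = 0" if "i < n" for i using w(3)[OF that] ip_commute[of w "v i"] by simp
  have "spectral (Suc n) (l(n := a)) (v(n := w))"
    using sp w w' eigenspace_H1[OF w(1)]
    by (auto simp: spectral_def orthonormal_def less_Suc_eq)
  then show ?case by blast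
qed

text \<open>The function \<open>v j\<close> is an admissible competitor in the earlier minimisation
  number \<open>i\<close>.\<close>

lemma spectral_mono:
  assumes "spectral n l v" "i \<le> j" "j < n"
  shows "l i \<le> l j"
proof (cases "i = j")
  case False
  have v: "v j \<in> H1 G" "ip (v j) (v j) = 1" "\<forall>s<i. ip (v j) (v s) = 0" "v j \<in> eigenspace (l j)"
    using assms False by (auto simp: spectral_def orthonormal_def)
  have "i < n" using assms by simp
  then have "l i * ip (v j) (v j) \<le> Q (v j)" using assms(1) v(1,3) unfolding spectral_def by blast
  then show ?thesis using v eigenspace_energy[OF v(4,1)] by simp
qed simp

text \<open>The dimension is the number of support points, possibly infinite. Indicators of points
  span when the support is finite, and every finite subset of the support carries an orthonormal
  system of its size.\<close>

lemma L2_dim_le_iff: "L2_dim \<mu> (L2 \<mu>) \<le> enat k \<longleftrightarrow> finite (supp G \<mu>) \<and> card (supp G \<mu>) \<le> k"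
proof
  assume *: "finite (supp G \<mu>) \<and> card (supp G \<mu>) \<le> k"
  have "L2_dim \<mu> (L2 \<mu>) \<le> enat (card (supp G \<mu>))"
  proof (rule L2_dim_le)
    fix f :: "('v, 'e) point \<Rightarrow> real"
    have "AE x in \<mu>. f x = (\<Sum>s\<in>supp G \<mu>. f s * (if x = s then 1 else 0))"
      using AE_supp by eventually_elim (use * in \<open>auto simp: if_distrib cong: if_cong\<close>)
    then show "\<exists>c. AE x in \<mu>. f x = (\<Sum>s\<in>supp G \<mu>. c s * (if x = s then 1 else 0))" by blast
  qed (use * in simp)
  then show "L2_dim \<mu> (L2 \<mu>) \<le> enat k" using * by (meson enat_ord_simps(1) order_trans)
next
  assume *: "L2_dim \<mu> (L2 \<mu>) \<le> enat k"
  have "card T \<le> k" if T: "finite T" "T \<subseteq> supp G \<mu>" for T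
  proof -
    obtain l v where "spectral (card T) l v" using spectral_exists[OF T] by blast
    then have on: "orthonormal (card T) v" by (simp add: spectral_def)
    then have "enat (card T) \<le> L2_dim \<mu> (L2 \<mu>)"
      by (intro L2_dim_ge[of _ v] orthonormal_independent) (auto simp: orthonormal_def H1_L2)
    then show ?thesis using * by (meson enat_ord_simps(1) order_trans)
  qed
  then show "finite (supp G \<mu>) \<and> card (supp G \<mu>) \<le> k"
    by (metis card_subset_eq finite_if_finite_subsets_card_bdd subset_refl)
qed

section \<open>Counting eigenvalues with multiplicity\<close>

lemma eigen_mult_eq: "eigen_mult G \<mu> a = L2_dim \<mu> (eigenspace a)"
  by (simp add: eigen_mult_def H_op_iff_eigenspace)

text \<open>Only orthonormality and the equations enter, no minimum property; therefore the bound
  applies to limits of eigenfunctions. Grouping the system by eigenvalue bounds each multiplicity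
  from below.\<close>

lemma eigval_le:
  assumes on: "orthonormal (Suc k) v" and ev: "\<And>i. i \<le> k \<Longrightarrow> v i \<in> eigenspace (l i)" and l: "\<And>i. i \<le> k \<Longrightarrow> l i \<le> a"
  shows "eigval G \<mu> k \<le> ereal a"
proof -
  have "enat (Suc k) \<le> L2_dim \<mu> (L2 \<mu>)"
    using on by (intro L2_dim_ge[of _ v] orthonormal_independent) (auto simp: orthonormal_def H1_L2)
  then have dim: "\<not> L2_dim \<mu> (L2 \<mu>) \<le> enat k" by (meson Suc_ile_eq leD)
  define F where "F = l ` {..k}"
  have mult: "enat (card {i. i \<le> k \<and> l i = b}) \<le> eigen_mult G \<mu> b" for b
  proof -
    define I where "I = {i. i \<le> k \<and> l i = b}"
    have "finite I" by (auto simp: I_def)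
    then obtain f where f: "bij_betw f {..<card I} I" by (metis ex_bij_betw_nat_finite atLeast0LessThan)
    have fI: "f i \<in> I" if "i < card I" for i using f that by (auto simp: bij_betw_def)
    have "orthonormal (card I) (\<lambda>i. v (f i))"
      unfolding orthonormal_def
    proof (intro conjI allI impI)
      fix i j assume ij: "i < card I" "j < card I"
      then have "f i = f j \<longleftrightarrow> i = j" using f by (auto simp: bij_betw_def inj_on_def)
      moreover have "f i < Suc k" "f j < Suc k" using fI ij by (auto simp: I_def less_Suc_eq_le)
      ultimately show "ip (v (f i)) (v (f j)) = (if i = j then 1 else 0)"
        using on by (auto simp: orthonormal_def)
    qed (use on fI in \<open>auto simp: orthonormal_def I_def less_Suc_eq_le\<close>)
    then show ?thesis unfolding eigen_mult_eq I_def[symmetric]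
      by (intro L2_dim_ge[of _ "\<lambda>i. v (f i)"] orthonormal_independent) (use fI ev in \<open>auto simp: I_def\<close>)
  qed
  have "Suc k = card {..k}" by simp
  \<comment> \<open>The indices up to \<open>k\<close> are partitioned by their eigenvalue.\<close>
  also have "\<dots> = (\<Sum>b\<in>F. card {i. i \<le> k \<and> l i = b})"
  proof -
    have "card (\<Union>b\<in>F. {i. i \<le> k \<and> l i = b}) = (\<Sum>b\<in>F. card {i. i \<le> k \<and> l i = b})"
      by (rule card_UN_disjoint) (auto simp: F_def)
    moreover have "(\<Union>b\<in>F. {i. i \<le> k \<and> l i = b}) = {..k}" by (auto simp: F_def)
    ultimately show ?thesis by simp
  qed
  finally have "enat (Suc k) = (\<Sum>b\<in>F. enat (card {i. i \<le> k \<and> l i = b}))"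
    unfolding of_nat_eq_enat[symmetric] by (simp only: of_nat_sum)
  also have "\<dots> \<le> (\<Sum>b\<in>F. eigen_mult G \<mu> b)" by (intro sum_mono mult)
  finally have "enat (Suc k) \<le> (\<Sum>b\<in>F. eigen_mult G \<mu> b)" .
  then have "\<exists>F. finite F \<and> F \<subseteq> {..a} \<and> enat k < (\<Sum>b\<in>F. eigen_mult G \<mu> b)"
    using l by (intro exI[of _ F]) (auto simp: F_def Suc_ile_eq)
  then show ?thesis unfolding eigval_def using dim by (auto intro!: Inf_lower)
qed

text \<open>For the lower bound, subtract from an eigenfunction for \<open>b < l k\<close> its
  projection to the first \<open>k\<close> functions. The remainder solves the equation for
  \<open>b\<close> and competes in minimisation number \<open>k\<close>, hence is zero in mean
  square. So the total multiplicity below \<open>l k\<close> is at most \<open>k\<close>.\<close>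

lemma eigval_eq:
  assumes sp: "spectral n l v" and k: "k < n"
  shows "eigval G \<mu> k = ereal (l k)"
proof (rule antisym)
  have on: "orthonormal n v" using sp by (simp add: spectral_def)
  show "eigval G \<mu> k \<le> ereal (l k)"
    by (rule eigval_le[of k v l]) (use sp k spectral_mono[OF sp] in \<open>auto simp: spectral_def orthonormal_def\<close>)
  have mult: "eigen_mult G \<mu> b \<le> enat (card {i. i < k \<and> l i = b})" if b: "b < l k" for b
    unfolding eigen_mult_eq
  proof (rule L2_dim_le)
    fix f assume f: "f \<in> eigenspace b"
    define J where "J = {i. i < k \<and> l i = b}"
    have fH: "f \<in> H1 G" using f by (rule eigenspace_H1)
    define p where "p x = (\<Sum>i<k. ip f (v i) * v i x)" for x
    have on_k: "orthonormal k v" using on k by (auto simp: orthonormal_def)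
    have v: "v i \<in> eigenspace (l i)" if "i < k" for i using sp that k by (simp add: spectral_def)
    have vH: "v i \<in> H1 G" if "i < k" for i using v[OF that] by (rule eigenspace_H1)
    \<comment> \<open>Components for other eigenvalues vanish by orthogonality, so the projection
      stays in the eigenspace for \<open>b\<close>.\<close>
    have z: "ip f (v i) = 0" if "i < k" "l i \<noteq> b" for i
      using eigenspace_orthogonal[OF f v[OF that(1)]] that by simp
    have p_J: "p x = (\<Sum>i\<in>J. ip f (v i) * v i x)" for x
      unfolding p_def J_def using z by (intro sum.mono_neutral_right) auto
    have p_sum: "(\<lambda>x. \<Sum>i\<in>I. c i * v i x) \<in> eigenspace b" if "I \<subseteq> J" for I c
    proof -
      have "finite I" using that by (rule finite_subset) (simp add: J_def)
      then show ?thesis using that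
      proof (induction I)
        case empty
        then show ?case using eigenspace_lincomb[OF f f, of 0 0] by simp
      next
        case (insert i I)
        then have "v i \<in> eigenspace b" using v[of i] by (auto simp: J_def)
        then show ?case using insert eigenspace_lincomb[of "v i" b "\<lambda>x. \<Sum>i\<in>I. c i * v i x" "c i" 1] by simp
      qed
    qed
    have "p = (\<lambda>x. \<Sum>i\<in>J. ip f (v i) * v i x)" using p_J by (rule ext)
    then have pE: "p \<in> eigenspace b" using p_sum[of J "\<lambda>i. ip f (v i)"] by simp
    define h where "h x = f x - p x" for x
    have hE: "h \<in> eigenspace b" using eigenspace_lincomb[OF f pE, of 1 "-1"] by (simp add: h_def[abs_def])
    have hH: "h \<in> H1 G" using hE by (rule eigenspace_H1)
    have "ip h (v j) = 0" if "j < k" for j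
      using projection_orthogonal[OF on_k fH that] by (simp add: h_def p_def)
    then have "l k * ip h h \<le> Q h" using sp k hH by (auto simp: spectral_def)
    also have "Q h = b * ip h h" by (rule eigenspace_energy[OF hE hH])
    finally have "(l k - b) * ip h h \<le> 0" by (simp add: left_diff_distrib)
    then have "ip h h \<le> 0" using b by (simp add: mult_le_0_iff)
    then have "ip h h = 0" using ip_nonneg[of h] by simp
    then have "\<forall>x\<in>supp G \<mu>. h x = 0" using integral_square_zero_iff[OF hH] by simp
    then have "AE x in \<mu>. f x = (\<Sum>i\<in>J. ip f (v i) * v i x)"
      using AE_supp by (auto simp: h_def p_J elim: eventually_mono)
    then show "\<exists>c. AE x in \<mu>. f x = (\<Sum>i\<in>{i. i < k \<and> l i = b}. c i * v i x)"
      unfolding J_def by (rule exI[of _ "\<lambda>i. ip f (v i)"])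
  qed simp
  \<comment> \<open>For distinct values in \<open>F\<close> the index sets are disjoint subsets of
    \<open>{..<k}\<close>, so their sizes cannot add up to more than \<open>k\<close>.\<close>
  have lower: "ereal (l k) \<le> ereal a" if F: "finite F" "F \<subseteq> {..a}" "enat k < (\<Sum>b\<in>F. eigen_mult G \<mu> b)" for a F
  proof (rule ccontr)
    assume "\<not> ereal (l k) \<le> ereal a"
    then have "(\<Sum>b\<in>F. eigen_mult G \<mu> b) \<le> (\<Sum>b\<in>F. enat (card {i. i < k \<and> l i = b}))"
      using F by (intro sum_mono mult) auto
    also have "\<dots> = enat (\<Sum>b\<in>F. card {i. i < k \<and> l i = b})"
      unfolding of_nat_eq_enat[symmetric] by (simp only: of_nat_sum)
    also have "(\<Sum>b\<in>F. card {i. i < k \<and> l i = b}) = card (\<Union>b\<in>F. {i. i < k \<and> l i = b})"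
      by (rule card_UN_disjoint[symmetric]) (use F in auto)
    also have "enat \<dots> \<le> enat k"
      using card_mono[of "{..<k}" "\<Union>b\<in>F. {i. i < k \<and> l i = b}"] by (simp add: UN_subset_iff subset_iff)
    finally show False using F(3) by simp
  qed
  have "\<not> L2_dim \<mu> (L2 \<mu>) \<le> enat k"
  proof -
    have "enat n \<le> L2_dim \<mu> (L2 \<mu>)"
      using on by (intro L2_dim_ge[of _ v] orthonormal_independent) (auto simp: orthonormal_def H1_L2)
    then show ?thesis using k by (meson enat_ord_simps(2) leD order_less_le_trans)
  qed
  then show "ereal (l k) \<le> eigval G \<mu> k"
    unfolding eigval_def using lower by (auto intro!: Inf_greatest)
qed

lemma spectral_if_L2_dim:
  assumes "\<not> L2_dim \<mu> (L2 \<mu>) \<le> enat k"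
  obtains l v where "spectral (Suc k) l v"
proof -
  have "infinite (supp G \<mu>) \<or> Suc k \<le> card (supp G \<mu>)" using assms unfolding L2_dim_le_iff by auto
  then obtain T where "T \<subseteq> supp G \<mu>" "finite T" "card T = Suc k"
    by (metis infinite_arbitrarily_large obtain_subset_with_card_n)
  then show thesis using spectral_exists[of T "Suc k"] that by auto
qed

lemma spectral_if_eigval_finite:
  assumes "eigval G \<mu> k < \<infinity>"
  obtains l v where "spectral (Suc k) l v"
  using spectral_if_L2_dim[of k thesis] assms by (cases "L2_dim \<mu> (L2 \<mu>) \<le> enat k") (auto simp: eigval_def)

end

section \<open>Convergence\<close>

context finite_metric_graph
begin

lemma mass_tendsto:
  fixes \<mu> :: "('v, 'e) point measure"
  assumes \<mu>s: "\<And>m. \<mu>s m \<in> nonzero_finite_measures G" and \<mu>: "\<mu> \<in> nonzero_finite_measures G"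
    and ws: "weak_star_conv G \<mu>s \<mu>"
  shows "(\<lambda>m. measure (\<mu>s m) X) \<longlonglongrightarrow> measure \<mu> X"
proof -
  have mass: "(\<integral>x. (1 :: real) \<partial>\<nu>) = measure \<nu> X" if "\<nu> \<in> nonzero_finite_measures G" for \<nu>
  proof -
    interpret graph_measure G \<nu> by unfold_locales (rule that)
    show ?thesis by simp
  qed
  have "(\<lambda>m. integral\<^sup>L (\<mu>s m) (\<lambda>x. 1 :: real)) \<longlonglongrightarrow> integral\<^sup>L \<mu> (\<lambda>x. 1 :: real)"
    by (rule ws[unfolded weak_star_conv_def, rule_format]) simp
  then show ?thesis using mass \<mu>s \<mu> by simp
qed

lemma weak_star_conv_subseq:
  "weak_star_conv G \<mu>s \<nu> \<Longrightarrow> strict_mono r \<Longrightarrow> weak_star_conv G (\<lambda>n. \<mu>s (r n)) \<nu>"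
  unfolding weak_star_conv_def using filterlim_compose[OF _ filterlim_subseq] by fast

text \<open>The energy of a difference \<open>h\<close> of two eigenfunctions is a difference of two
  equations tested with \<open>h\<close>, for different measures. The terms need not be compared:
  each is small because \<open>h\<close> is uniformly small.\<close>

lemma eigenfunctions_precompact:
  fixes \<mu> :: "('v, 'e) point measure"
  assumes \<mu>s: "\<And>m. \<mu>s m \<in> nonzero_finite_measures G" and \<mu>: "\<mu> \<in> nonzero_finite_measures G"
    and ws: "weak_star_conv G \<mu>s \<mu>"
    and on: "\<And>m. graph_measure.orthonormal G (\<mu>s m) (Suc k) (v m)"
    and ev: "\<And>m j. j \<le> k \<Longrightarrow> v m j \<in> graph_measure.eigenspace G (\<mu>s m) (l m j)"
    and bound: "\<And>m j. j \<le> k \<Longrightarrow> l m j \<le> C"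
  obtains r w L where "strict_mono (r :: nat \<Rightarrow> nat)" "\<And>j. j \<le> k \<Longrightarrow> (\<lambda>n. l (r n) j) \<longlonglongrightarrow> L j"
    "\<And>j. j \<le> k \<Longrightarrow> uconv (\<lambda>n. v (r n) j) (w j)"
    "graph_measure.orthonormal G \<mu> (Suc k) w" "\<And>j. j \<le> k \<Longrightarrow> w j \<in> graph_measure.eigenspace G \<mu> (L j)"
proof -
  interpret M: graph_measure G \<mu> by unfold_locales (rule \<mu>)
  have gm: "graph_measure G (\<mu>s m)" for m by unfold_locales (rule \<mu>s)
  have vH: "v m j \<in> H1 G" and v_ip: "\<And>i. i \<le> k \<Longrightarrow> (\<integral>x. v m i x * v m j x \<partial>\<mu>s m) = (if i = j then 1 else 0)"
    if "j \<le> k" for m j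
    using on[of m] that unfolding graph_measure.orthonormal_def[OF gm] by (auto simp: less_Suc_eq_le)
  have v_eq: "q (v m j) \<phi> = l m j * (\<integral>x. v m j x * \<phi> x \<partial>\<mu>s m)" if "j \<le> k" "\<phi> \<in> H1 G" for m j \<phi>
    using graph_measure.eigenspace_energy[OF gm ev[OF that(1)] that(2)] .
  have ql: "Q (v m j) = l m j" if "j \<le> k" for m j
    using v_eq[OF that vH[OF that]] v_ip[OF that that] by simp
  have l0: "0 \<le> l m j" if "j \<le> k" for m j
    using ql[OF that, of m] energy_nonneg[of "v m j"] by simp
  have C0: "0 \<le> C" using l0[of 0 0] bound[of 0 0] by simp
  note mass = mass_tendsto[OF \<mu>s \<mu> ws]
  have "Bseq (\<lambda>m. measure (\<mu>s m) X)" using mass by (intro convergent_imp_Bseq convergentI)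
  then obtain A where A: "\<And>m. measure (\<mu>s m) X \<le> A" unfolding Bseq_def by (metis abs_le_D1 real_norm_def)
  \<comment> \<open>The nonzero limit keeps the masses away from zero, as the sup bound for
    normalised functions requires.\<close>
  have "(\<lambda>m. 1 / measure (\<mu>s m) X) \<longlonglongrightarrow> 1 / measure \<mu> X"
    using mass M.measure_space_pos by (intro tendsto_intros) auto
  then have "Bseq (\<lambda>m. 1 / measure (\<mu>s m) X)" by (intro convergent_imp_Bseq convergentI)
  then obtain B where B: "\<And>m. 1 / measure (\<mu>s m) X \<le> B" unfolding Bseq_def by (metis abs_le_D1 real_norm_def)
  obtain C' where C': "0 \<le> C'" "\<And>f x y. f \<in> H1 G \<Longrightarrow> x \<in> X \<Longrightarrow> y \<in> X \<Longrightarrow> \<bar>f x - f y\<bar> \<le> C' * sqrt (Q f)"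
    using H1_oscillation by blast
  define K where "K = max C (C' * sqrt C + sqrt B)"
  have v_bound: "\<bar>v m j x\<bar> \<le> K" if "j \<le> k" "x \<in> X" for m j x
  proof -
    have "\<bar>v m j x\<bar> \<le> C' * sqrt (Q (v m j)) + sqrt ((\<integral>x. v m j x * v m j x \<partial>\<mu>s m) / measure (\<mu>s m) X)"
      using graph_measure.H1_sup_bound[OF gm C' vH[OF that(1)] that(2)] .
    also have "\<dots> \<le> C' * sqrt C + sqrt B"
      unfolding ql[OF that(1)] v_ip[OF that(1,1)] using C' bound[OF that(1)] B
      by (intro add_mono mult_left_mono real_sqrt_le_mono) auto
    finally show ?thesis by (simp add: K_def)
  qed
  have K0: "0 \<le> K" using C0 by (simp add: K_def)
  have A0: "0 \<le> A" using A[of 0] measure_nonneg order_trans by blast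
  obtain r :: "nat \<Rightarrow> nat" where r: "strict_mono r"
    and conv: "\<And>j. j \<in> {..k} \<Longrightarrow> (\<exists>a. (\<lambda>n. l (r n) j) \<longlonglongrightarrow> a) \<and> (\<exists>w. uconv (\<lambda>n. v (r n) j) w)"
  proof (rule common_subsequence[of "{..k}" "\<lambda>j (r :: nat \<Rightarrow> nat).
      (\<exists>a. (\<lambda>n. l (r n) j) \<longlonglongrightarrow> a) \<and> (\<exists>w. uconv (\<lambda>n. v (r n) j) w)"])
    fix j and r :: "nat \<Rightarrow> nat" assume "j \<in> {..k}" and r: "strict_mono r"
    then have j: "j \<le> k" by simp
    obtain w s where s: "strict_mono (s :: nat \<Rightarrow> nat)" "uconv (\<lambda>n. v (r (s n)) j) w"
      by (rule H1_precompact[of "\<lambda>n. v (r n) j" K]) (use vH[OF j] v_bound[OF j] ql[OF j] bound[OF j] in \<open>auto simp: K_def le_max_iff_disj\<close>)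
    have "bounded (range (\<lambda>n. l (r (s n)) j))"
      unfolding bounded_iff using l0[OF j] bound[OF j] by (intro exI[of _ C]) auto
    then obtain a t where t: "strict_mono (t :: nat \<Rightarrow> nat)" "((\<lambda>n. l (r (s n)) j) \<circ> t) \<longlonglongrightarrow> a"
      using bounded_imp_convergent_subsequence by blast
    have "uniform_limit X (\<lambda>n. v (r (s (t n))) j) w sequentially"
      by (rule filterlim_compose[OF s(2) filterlim_subseq[OF t(1)]])
    moreover have "strict_mono (s \<circ> t)" using s t by (simp add: strict_mono_o)
    ultimately show "\<exists>s. strict_mono s \<and> (\<exists>a. (\<lambda>n. l ((r \<circ> s) n) j) \<longlonglongrightarrow> a) \<and> (\<exists>w. uconv (\<lambda>n. v ((r \<circ> s) n) j) w)"
      using t(2) by (intro exI[of _ "s \<circ> t"]) (auto simp: o_def)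
  next
    fix j and r s :: "nat \<Rightarrow> nat"
    assume "(\<exists>a. (\<lambda>n. l (r n) j) \<longlonglongrightarrow> a) \<and> (\<exists>w. uconv (\<lambda>n. v (r n) j) w)" "strict_mono s"
    then show "(\<exists>a. (\<lambda>n. l ((r \<circ> s) n) j) \<longlonglongrightarrow> a) \<and> (\<exists>w. uconv (\<lambda>n. v ((r \<circ> s) n) j) w)"
      by (auto dest: filterlim_compose[OF _ filterlim_subseq])
  qed (simp, blast)
  then obtain L w where L: "\<And>j. j \<le> k \<Longrightarrow> (\<lambda>n. l (r n) j) \<longlonglongrightarrow> L j"
    and w: "\<And>j. j \<le> k \<Longrightarrow> uconv (\<lambda>n. v (r n) j) (w j)"
    by (metis atMost_iff)
  have ws_r: "weak_star_conv G (\<lambda>n. \<mu>s (r n)) \<mu>" by (rule weak_star_conv_subseq[OF ws r])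
  \<comment> \<open>Bounds the eigenvalue by \<open>C\<close>, the eigenfunction by \<open>K\<close>
    and the mass by \<open>A\<close>, all independently of \<open>m\<close>.\<close>
  have term_bound: "\<bar>l m j * (\<integral>x. v m j x * h x \<partial>\<mu>s m)\<bar> \<le> C * (K * d * A)"
    if j: "j \<le> k" and h: "h \<in> H1 G" "\<And>x. x \<in> X \<Longrightarrow> \<bar>h x\<bar> \<le> d" and d: "0 \<le> d" for m j h d
  proof -
    interpret N: graph_measure G "\<mu>s m" by (rule gm)
    have "\<bar>\<integral>x. v m j x * h x \<partial>\<mu>s m\<bar> \<le> (\<integral>x. \<bar>v m j x * h x\<bar> \<partial>\<mu>s m)" by (rule integral_abs_bound)
    also have "\<dots> \<le> (\<integral>x. K * d \<partial>\<mu>s m)"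
    proof (rule integral_mono)
      show "integrable (\<mu>s m) (\<lambda>x. \<bar>v m j x * h x\<bar>)"
        using N.ip_integrable[OF vH[OF j] h(1)] by simp
      show "\<bar>v m j x * h x\<bar> \<le> K * d" if "x \<in> space (\<mu>s m)" for x
        using v_bound[OF j, of x m] h(2)[of x] that K0 unfolding abs_mult by (intro mult_mono) auto
    qed simp
    also have "\<dots> = K * d * measure (\<mu>s m) X" by simp
    also have "\<dots> \<le> K * d * A" using A K0 d by (intro mult_left_mono) auto
    finally show ?thesis
      unfolding abs_mult using l0[OF j] bound[OF j] C0 by (intro mult_mono) auto
  qed
  have Cauchy: "\<exists>N. \<forall>m\<ge>N. \<forall>n\<ge>N. Q (\<lambda>x. v (r m) j x - v (r n) j x) < e"
    if j: "j \<le> k" and e: "0 < e" for j e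
  proof -
    \<comment> \<open>Two terms of size C K A d must stay below \<open>e\<close>; the summand 1
      keeps the divisor positive.\<close>
    define P where "P = 2 * C * K * A + 1"
    define d where "d = e / P / 2"
    have pos: "0 < P" unfolding P_def using C0 K0 A0 by (simp add: add_nonneg_pos)
    have d: "0 < d" using e pos by (simp add: d_def)
    have "uniformly_Cauchy_on X (\<lambda>n. v (r n) j)"
      using w[OF j] unfolding uniformly_convergent_eq_Cauchy[symmetric] uniformly_convergent_on_def by blast
    then obtain N where N: "\<And>x m n. x \<in> X \<Longrightarrow> N \<le> m \<Longrightarrow> N \<le> n \<Longrightarrow> \<bar>v (r m) j x - v (r n) j x\<bar> < d"
      using d unfolding uniformly_Cauchy_on_def dist_real_def by meson
    have "Q (\<lambda>x. v (r m) j x - v (r n) j x) < e" if mn: "N \<le> m" "N \<le> n" for m n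
    proof -
      define h where "h x = v (r m) j x - v (r n) j x" for x
      have hH: "h \<in> H1 G" unfolding h_def by (intro H1_diff vH j)
      have hd: "\<bar>h x\<bar> \<le> d" if "x \<in> X" for x using N[OF that mn] by (simp add: h_def)
      have "Q h = q (v (r m) j) h - q (v (r n) j) h"
        unfolding h_def by (intro energy_diff_left vH j hH[unfolded h_def])
      also have "\<dots> \<le> C * (K * d * A) + C * (K * d * A)"
        using term_bound[OF j hH hd less_imp_le[OF d], of "r m"] term_bound[OF j hH hd less_imp_le[OF d], of "r n"]
        unfolding v_eq[OF j hH] by linarith
      also have "\<dots> = (2 * C * K * A) * d" by (simp add: mult_ac)
      also have "\<dots> \<le> P * d" unfolding P_def using d by (simp add: distrib_right)
      also have "\<dots> = e / 2" unfolding d_def using pos by simp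
      also have "\<dots> < e" using e by simp
      finally show ?thesis by (simp add: h_def[abs_def])
    qed
    then show ?thesis by blast
  qed
  have wH: "w j \<in> H1 G" "(\<lambda>n. Q (\<lambda>x. v (r n) j x - w j x)) \<longlonglongrightarrow> 0" if j: "j \<le> k" for j
    using H1_closed[OF vH[OF j] w[OF j] Cauchy[OF j]] by blast+
  have "w j \<in> M.eigenspace (L j)" if j: "j \<le> k" for j
    unfolding M.eigenspace_def
  proof (intro CollectI conjI ballI)
    fix \<phi> assume \<phi>: "\<phi> \<in> H1 G"
    have "(\<lambda>n. \<integral>x. v (r n) j x * \<phi> x \<partial>\<mu>s (r n)) \<longlonglongrightarrow> M.ip (w j) \<phi>"
      by (rule weak_star_ip_tendsto[OF \<mu>s \<mu> ws_r vH[OF j] w[OF j] wH(1)[OF j] \<phi> _ \<phi>]) (rule uniform_limitI, simp)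
    then have "(\<lambda>n. q (v (r n) j) \<phi>) \<longlonglongrightarrow> L j * M.ip (w j) \<phi>"
      unfolding v_eq[OF j \<phi>] by (intro tendsto_mult L j)
    moreover have "(\<lambda>n. q (v (r n) j) \<phi>) \<longlonglongrightarrow> q (w j) \<phi>"
      by (rule energy_tendsto(1)[OF vH[OF j] wH[OF j] \<phi>])
    ultimately show "q (w j) \<phi> = L j * M.ip (w j) \<phi>" by (rule LIMSEQ_unique[symmetric])
  qed (rule wH[OF j])
  moreover have "M.orthonormal (Suc k) w"
    unfolding M.orthonormal_def
  proof (intro conjI allI impI)
    fix i j assume "i < Suc k" "j < Suc k"
    then have ij: "i \<le> k" "j \<le> k" by auto
    have "(\<lambda>n. \<integral>x. v (r n) i x * v (r n) j x \<partial>\<mu>s (r n)) \<longlonglongrightarrow> M.ip (w i) (w j)"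
      by (rule weak_star_ip_tendsto[OF \<mu>s \<mu> ws_r vH[OF ij(1)] w[OF ij(1)] wH(1)[OF ij(1)] vH[OF ij(2)] w[OF ij(2)] wH(1)[OF ij(2)]])
    then show "M.ip (w i) (w j) = (if i = j then 1 else 0)"
      unfolding v_ip[OF ij(2,1)] by (simp only: LIMSEQ_const_iff)
  qed (use wH in auto)
  ultimately show thesis using that[of r L w] r L w by blast
qed

text \<open>The eigenfunctions of the limit operator span a trial space of dimension
  \<open>k + 1\<close> whose energy form does not depend on \<open>m\<close>; only the norms change
  with the measure, and the strict gap below \<open>b\<close> absorbs that change.\<close>

lemma eigval_eventually_less:
  fixes \<mu> :: "('v, 'e) point measure"
  assumes \<mu>s: "\<And>m. \<mu>s m \<in> nonzero_finite_measures G" and \<mu>: "\<mu> \<in> nonzero_finite_measures G"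
    and ws: "weak_star_conv G \<mu>s \<mu>" and b: "eigval G \<mu> k < ereal b"
  shows "\<forall>\<^sub>F m in sequentially. eigval G (\<mu>s m) k < ereal b"
proof -
  interpret M: graph_measure G \<mu> by unfold_locales (rule \<mu>)
  obtain l v where sp: "M.spectral (Suc k) l v"
    using M.spectral_if_eigval_finite[of k] order_less_trans[OF b, of \<infinity>] by auto
  have lb: "l k < b" using b M.eigval_eq[OF sp, of k] by simp
  have vE: "v i \<in> M.eigenspace (l i)" and vH: "v i \<in> H1 G" if "i \<le> k" for i
    using sp that by (auto simp: M.spectral_def M.orthonormal_def)
  have v_ip: "M.ip (v i) (v j) = (if i = j then 1 else 0)" if "i \<le> k" "j \<le> k" for i j
    using sp that by (auto simp: M.spectral_def M.orthonormal_def)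
  \<comment> \<open>Total deviation of the Gram matrix of the trial functions from the
    identity.\<close>
  define \<epsilon> where "\<epsilon> m = (\<Sum>i\<le>k. \<Sum>j\<le>k. \<bar>(\<integral>x. v i x * v j x \<partial>\<mu>s m) - (if i = j then 1 else 0)\<bar>)" for m
  have "\<epsilon> \<longlonglongrightarrow> (\<Sum>i\<le>k. \<Sum>j\<le>k. \<bar>M.ip (v i) (v j) - (if i = j then 1 else 0)\<bar>)"
    unfolding \<epsilon>_def
    by (intro tendsto_intros weak_star_ip_tendsto[OF \<mu>s \<mu> ws] vH) (auto intro!: uniform_limitI)
  then have \<epsilon>: "\<epsilon> \<longlonglongrightarrow> 0" using v_ip by simp
  have "(\<lambda>m. b * (1 - \<epsilon> m)) \<longlonglongrightarrow> b * (1 - 0)" by (intro tendsto_intros \<epsilon>)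
  then have "\<forall>\<^sub>F m in sequentially. l k < b * (1 - \<epsilon> m)" using lb by (intro order_tendstoD) auto
  moreover have "\<forall>\<^sub>F m in sequentially. \<epsilon> m < 1" using \<epsilon> by (rule order_tendstoD) simp
  ultimately show ?thesis
  proof eventually_elim
    fix m assume m: "l k < b * (1 - \<epsilon> m)" "\<epsilon> m < 1"
    interpret N: graph_measure G "\<mu>s m" by unfold_locales (rule \<mu>s)
    define f where "f c x = (\<Sum>i\<le>k. c i * v i x)" for c x
    have fH: "f c \<in> H1 G" for c unfolding f_def using vH by (intro H1_sum) auto
    have f_ip: "N.ip (f c) h = (\<Sum>i\<le>k. c i * N.ip (v i) h)" if "h \<in> H1 G" for c h
      unfolding f_def using vH that by (intro N.ip_sum_left) auto
    \<comment> \<open>Every product of two coefficients is at most the sum of their squares, so the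
      error of the quadratic form is at most that sum times \<open>\<epsilon> m\<close>.\<close>
    have lower: "(1 - \<epsilon> m) * (\<Sum>i\<le>k. (c i)^2) \<le> N.ip (f c) (f c)" for c
    proof -
      define S where "S = (\<Sum>i\<le>k. (c i)^2)"
      have S: "\<bar>c i * c j\<bar> \<le> S" if "i \<le> k" "j \<le> k" for i j
      proof -
        have "(c i)^2 \<le> S" "(c j)^2 \<le> S" unfolding S_def using that
          by (auto intro!: member_le_sum[of _ _ "\<lambda>i. (c i)^2"])
        moreover have "2 * \<bar>c i * c j\<bar> \<le> (c i)^2 + (c j)^2"
          using sum_squares_bound[of "\<bar>c i\<bar>" "\<bar>c j\<bar>"] by (simp add: abs_mult mult.assoc)
        ultimately show ?thesis by linarith
      qed
      have "N.ip (f c) (f c) = (\<Sum>i\<le>k. \<Sum>j\<le>k. c i * c j * N.ip (v i) (v j))"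
      proof -
        have "N.ip (v i) (f c) = (\<Sum>j\<le>k. c j * N.ip (v i) (v j))" if "i \<le> k" for i
          using f_ip[OF vH[OF that], of c] by (simp add: N.ip_commute[of "v i"])
        then show ?thesis unfolding f_ip[OF fH] by (simp add: sum_distrib_left mult.assoc)
      qed
      moreover have "S = (\<Sum>i\<le>k. \<Sum>j\<le>k. c i * c j * (if i = j then 1 else 0))"
        unfolding S_def by (simp add: if_distrib power2_eq_square cong: if_cong)
      ultimately have "S - N.ip (f c) (f c) =
          (\<Sum>i\<le>k. \<Sum>j\<le>k. c i * c j * ((if i = j then 1 else 0) - N.ip (v i) (v j)))"
        by (simp add: sum_subtractf right_diff_distrib)
      also have "\<dots> \<le> (\<Sum>i\<le>k. \<Sum>j\<le>k. S * \<bar>N.ip (v i) (v j) - (if i = j then 1 else 0)\<bar>)"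
      proof (intro sum_mono)
        fix i j assume ij: "i \<in> {..k}" "j \<in> {..k}"
        define z where "z = (if i = j then 1 else 0) - N.ip (v i) (v j)"
        have "c i * c j * z \<le> \<bar>c i * c j\<bar> * \<bar>z\<bar>" by (metis abs_ge_self abs_mult)
        also have "\<dots> \<le> S * \<bar>z\<bar>" using S ij by (intro mult_right_mono) auto
        finally show "c i * c j * ((if i = j then 1 else 0) - N.ip (v i) (v j)) \<le> S * \<bar>N.ip (v i) (v j) - (if i = j then 1 else 0)\<bar>"
          unfolding z_def by (simp only: abs_minus_commute)
      qed
      also have "\<dots> = S * \<epsilon> m" by (simp add: \<epsilon>_def sum_distrib_left)
      finally show ?thesis by (simp add: S_def left_diff_distrib mult.commute)
    qed
    have less: "l' k < b" if sp': "N.spectral (Suc k) l' v'" for l' v'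
    proof -
      have v'H: "v' j \<in> H1 G" if "j \<le> k" for j using sp' that by (auto simp: N.spectral_def N.orthonormal_def)
      \<comment> \<open>A nonzero trial function orthogonal, for the measure
        \<open>\<mu>s m\<close>, to its first \<open>k\<close> eigenfunctions: \<open>k + 1\<close>
        unknowns, \<open>k\<close> conditions. It competes in minimisation number
        \<open>k\<close>.\<close>
      obtain c where c: "\<exists>i\<in>{..k}. c i \<noteq> 0" "\<forall>j\<in>{..<k}. (\<Sum>i\<in>{..k}. c i * N.ip (v i) (v' j)) = 0"
        using homogeneous_system_nontrivial_solution[of "{..<k}" "{..k}" "\<lambda>i j. N.ip (v i) (v' j)"] by auto
      define S where "S = (\<Sum>i\<le>k. (c i)^2)"
      have S: "0 < S"
      proof -
        obtain i where "i \<in> {..k}" "c i \<noteq> 0" using c(1) by blast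
        then show ?thesis unfolding S_def by (intro sum_pos2[of _ i]) auto
      qed
      have "N.ip (f c) (v' j) = 0" if "j < k" for j using f_ip[OF v'H, of j c] c(2) that by simp
      then have "l' k * N.ip (f c) (f c) \<le> Q (f c)" using sp' fH by (auto simp: N.spectral_def)
      also have "\<dots> \<le> l k * S"
      proof -
        have "q (v i) (f c) = l i * c i" if i: "i \<le> k" for i
        proof -
          have "M.ip (f c) (v i) = c i"
            using M.orthonormal_ip_sum[of "Suc k" v i c] sp i by (simp add: M.spectral_def f_def lessThan_Suc_atMost)
          then show ?thesis using M.eigenspace_energy[OF vE[OF i] fH] M.ip_commute[of "v i" "f c"] by simp
        qed
        then have "Q (f c) = (\<Sum>i\<le>k. c i * (l i * c i))"
          using energy_sum_left[of "{..k}" v "f c" c] vH fH by (simp add: f_def[abs_def])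
        also have "\<dots> \<le> (\<Sum>i\<le>k. l k * (c i)^2)"
        proof (rule sum_mono)
          fix i assume "i \<in> {..k}"
          then have "l i * (c i)^2 \<le> l k * (c i)^2" using M.spectral_mono[OF sp, of i k] by (intro mult_right_mono) auto
          then show "c i * (l i * c i) \<le> l k * (c i)^2" by (simp add: power2_eq_square mult_ac)
        qed
        finally show ?thesis by (simp add: S_def sum_distrib_left)
      qed
      also have "\<dots> < b * (1 - \<epsilon> m) * S" using m S by (intro mult_strict_right_mono)
      finally have 1: "l' k * N.ip (f c) (f c) < b * (1 - \<epsilon> m) * S" .
      \<comment> \<open>The sign is needed to multiply the lower bound for the norm by
        \<open>l' k\<close>.\<close>
      have "0 \<le> l' k"
      proof -
        have "v' k \<in> N.eigenspace (l' k)" "N.ip (v' k) (v' k) = 1" using sp' by (auto simp: N.spectral_def N.orthonormal_def)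
        then show ?thesis using N.eigenspace_energy[of "v' k" "l' k" "v' k"] v'H[of k] energy_nonneg[of "v' k"] by simp
      qed
      then have "l' k * ((1 - \<epsilon> m) * S) \<le> l' k * N.ip (f c) (f c)" using lower[of c] by (intro mult_left_mono) (auto simp: S_def)
      then have "l' k * ((1 - \<epsilon> m) * S) < b * ((1 - \<epsilon> m) * S)" using 1 by (simp add: mult.assoc)
      then show "l' k < b" using S m(2) by (simp add: mult_less_cancel_right_pos)
    qed
    \<comment> \<open>The trial functions stay independent for \<open>\<mu>s m\<close>, since the
      Gram form is positive definite; so the eigenvalue is not infinite by convention.\<close>
    have "\<not> L2_dim (\<mu>s m) (L2 (\<mu>s m)) \<le> enat k"
    proof -
      have "L2_independent (\<mu>s m) (Suc k) v"
        unfolding L2_independent_def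
      proof (intro allI impI)
        fix c and i :: nat assume ae: "AE x in \<mu>s m. (\<Sum>i<Suc k. c i * v i x) = 0" and i: "i < Suc k"
        have "N.ip (f c) (f c) = 0" unfolding f_def using ae
          by (intro integral_eq_zero_AE) (auto simp: lessThan_Suc_atMost elim: eventually_mono)
        then have "(\<Sum>i\<le>k. (c i)^2) \<le> 0" using lower[of c] m(2) by (simp add: mult_le_0_iff)
        moreover have "(c i)^2 \<le> (\<Sum>i\<le>k. (c i)^2)" using i by (intro member_le_sum) auto
        ultimately show "c i = 0" by (smt (verit) zero_eq_power2 zero_le_power2)
      qed
      then have "enat (Suc k) \<le> L2_dim (\<mu>s m) (L2 (\<mu>s m))"
        using vH N.H1_L2 by (intro L2_dim_ge[of _ v]) (auto simp: less_Suc_eq_le)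
      then show ?thesis by (meson Suc_ile_eq leD)
    qed
    then obtain l' v' where "N.spectral (Suc k) l' v'" by (rule N.spectral_if_L2_dim)
    then show "eigval G (\<mu>s m) k < ereal b" using N.eigval_eq[of "Suc k" l' v' k] less by simp
  qed
qed

lemma eigval_spectral:
  assumes \<nu>: "\<nu> \<in> nonzero_finite_measures G" and fin: "eigval G \<nu> k < \<infinity>"
  obtains l where "\<And>j. j \<le> k \<Longrightarrow> eigval G \<nu> j = ereal (l j)" "\<And>j. j \<le> k \<Longrightarrow> l j \<le> l k"
    "\<exists>v. graph_measure.orthonormal G \<nu> (Suc k) v \<and> (\<forall>j\<le>k. v j \<in> graph_measure.eigenspace G \<nu> (l j))"
proof -
  interpret N: graph_measure G \<nu> by unfold_locales (rule \<nu>)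
  obtain l v where sp: "N.spectral (Suc k) l v" using N.spectral_if_eigval_finite[OF fin] by blast
  show thesis
  proof (rule that[of l])
    show "eigval G \<nu> j = ereal (l j)" if "j \<le> k" for j using N.eigval_eq[OF sp] that by simp
    show "l j \<le> l k" if "j \<le> k" for j using N.spectral_mono[OF sp that] by simp
    show "\<exists>v. N.orthonormal (Suc k) v \<and> (\<forall>j\<le>k. v j \<in> N.eigenspace (l j))"
      using sp by (auto simp: N.spectral_def)
  qed
qed

text \<open>An infinite limit eigenvalue needs no separate case: if infinitely many eigenvalues were
  at most \<open>a\<close>, the \<open>k + 1\<close> orthonormal limits would bound the limit
  eigenvalue by \<open>a\<close>.\<close>

lemma eigval_eventually_greater:
  fixes \<mu> :: "('v, 'e) point measure"
  assumes \<mu>s: "\<And>m. \<mu>s m \<in> nonzero_finite_measures G" and \<mu>: "\<mu> \<in> nonzero_finite_measures G"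
    and ws: "weak_star_conv G \<mu>s \<mu>" and a: "ereal a < eigval G \<mu> k"
  shows "\<forall>\<^sub>F m in sequentially. ereal a < eigval G (\<mu>s m) k"
proof (rule ccontr)
  interpret M: graph_measure G \<mu> by unfold_locales (rule \<mu>)
  assume "\<not> ?thesis"
  then have "infinite {m. \<not> ereal a < eigval G (\<mu>s m) k}"
    unfolding eventually_sequentially infinite_nat_iff_unbounded_le by auto
  then obtain r :: "nat \<Rightarrow> nat" where r: "strict_mono r" "\<And>n. r n \<in> {m. \<not> ereal a < eigval G (\<mu>s m) k}"
    using infinite_enumerate by blast
  then have le: "eigval G (\<mu>s (r n)) k \<le> ereal a" for n by (simp add: not_less)
  have "\<exists>l v. (\<forall>j\<le>k. l j \<le> a) \<and> graph_measure.orthonormal G (\<mu>s (r n)) (Suc k) v \<and>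
      (\<forall>j\<le>k. v j \<in> graph_measure.eigenspace G (\<mu>s (r n)) (l j))" for n
  proof -
    have "eigval G (\<mu>s (r n)) k < \<infinity>" using le[of n] by (rule order_le_less_trans) simp
    then obtain l where l: "\<And>j. j \<le> k \<Longrightarrow> eigval G (\<mu>s (r n)) j = ereal (l j)" "\<And>j. j \<le> k \<Longrightarrow> l j \<le> l k"
      and v: "\<exists>v. graph_measure.orthonormal G (\<mu>s (r n)) (Suc k) v \<and>
        (\<forall>j\<le>k. v j \<in> graph_measure.eigenspace G (\<mu>s (r n)) (l j))"
      using eigval_spectral[OF \<mu>s] by blast
    have "l k \<le> a" using le[of n] l(1)[of k] by simp
    then have "\<forall>j\<le>k. l j \<le> a" using l(2) by (meson order_trans)
    then show ?thesis using v by blast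
  qed
  then obtain l v where lv: "\<And>n j. j \<le> k \<Longrightarrow> l n j \<le> a"
      "\<And>n. graph_measure.orthonormal G (\<mu>s (r n)) (Suc k) (v n)"
      "\<And>n j. j \<le> k \<Longrightarrow> v n j \<in> graph_measure.eigenspace G (\<mu>s (r n)) (l n j)"
    by metis
  obtain s w L where s: "\<And>j. j \<le> k \<Longrightarrow> (\<lambda>n. l (s n) j) \<longlonglongrightarrow> L j"
    "M.orthonormal (Suc k) w" "\<And>j. j \<le> k \<Longrightarrow> w j \<in> M.eigenspace (L j)"
    using eigenfunctions_precompact[OF \<mu>s \<mu> weak_star_conv_subseq[OF ws r(1)] lv(2,3,1)] by metis
  have "L j \<le> a" if "j \<le> k" for j using lv(1)[OF that] by (intro LIMSEQ_le_const2[OF s(1)[OF that]]) auto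
  then have "eigval G \<mu> k \<le> ereal a" using M.eigval_le[OF s(2,3)] by blast
  then show False using a by simp
qed

text \<open>Convergence is tested in the order of \<open>ereal\<close> against real thresholds,
  which also covers the value infinity.\<close>

lemma eigval_tendsto:
  fixes \<mu> :: "('v, 'e) point measure"
  assumes \<mu>s: "\<And>m. \<mu>s m \<in> nonzero_finite_measures G" and \<mu>: "\<mu> \<in> nonzero_finite_measures G"
    and ws: "weak_star_conv G \<mu>s \<mu>"
  shows "(\<lambda>m. eigval G (\<mu>s m) k) \<longlonglongrightarrow> eigval G \<mu> k"
  unfolding order_tendsto_iff
proof (intro conjI allI impI)
  fix y assume "y < eigval G \<mu> k"
  then obtain a where a: "y < ereal a" "ereal a < eigval G \<mu> k" using ereal_dense2 by blast
  show "\<forall>\<^sub>F m in sequentially. y < eigval G (\<mu>s m) k"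
    using eigval_eventually_greater[OF \<mu>s \<mu> ws a(2)] by eventually_elim (rule order_less_trans[OF a(1)])
next
  fix y assume "eigval G \<mu> k < y"
  then obtain b where b: "eigval G \<mu> k < ereal b" "ereal b < y" using ereal_dense2 by blast
  show "\<forall>\<^sub>F m in sequentially. eigval G (\<mu>s m) k < y"
    using eigval_eventually_less[OF \<mu>s \<mu> ws b(1)] by eventually_elim (rule order_less_trans[OF _ b(2)])
qed

lemma eigenfunctions_subsequence:
  fixes \<mu> :: "('v, 'e) point measure"
  assumes \<mu>s: "\<And>m. \<mu>s m \<in> nonzero_finite_measures G" and \<mu>: "\<mu> \<in> nonzero_finite_measures G"
    and ws: "weak_star_conv G \<mu>s \<mu>" and fin: "eigval G \<mu> k < \<infinity>"
    and v: "\<And>m. eigval G (\<mu>s m) k < \<infinity> \<Longrightarrow> orthonormal_eigenfunctions G (\<mu>s m) k (v m)"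
  obtains r w where "strict_mono (r :: nat \<Rightarrow> nat)" "\<And>m. eigval G (\<mu>s (r m)) k < \<infinity>"
    "orthonormal_eigenfunctions G \<mu> k w"
    "\<And>j. j \<le> k \<Longrightarrow> uconv (\<lambda>m. v (r m) j) (w j)"
proof -
  interpret M: graph_measure G \<mu> by unfold_locales (rule \<mu>)
  obtain b where b: "eigval G \<mu> k < ereal b" using fin ereal_dense2 by blast
  obtain N where N: "\<And>m. N \<le> m \<Longrightarrow> eigval G (\<mu>s m) k < ereal b"
    using eigval_eventually_less[OF \<mu>s \<mu> ws b] by (auto simp: eventually_sequentially)
  \<comment> \<open>Passing to a tail makes all eigenvalues in question finite and bounded by the
    single number \<open>b\<close>.\<close>
  define t where "t n = n + N" for n
  have t: "strict_mono t" by (simp add: t_def strict_mono_def)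
  have tb: "eigval G (\<mu>s (t n)) k < ereal b" for n by (rule N) (simp add: t_def)
  then have tfin: "eigval G (\<mu>s (t n)) k < \<infinity>" for n by (rule order_less_trans) simp
  have "\<exists>l. \<forall>j\<le>k. eigval G (\<mu>s (t n)) j = ereal (l j) \<and> l j \<le> b" for n
  proof -
    obtain l where l: "\<And>j. j \<le> k \<Longrightarrow> eigval G (\<mu>s (t n)) j = ereal (l j)" "\<And>j. j \<le> k \<Longrightarrow> l j \<le> l k"
      by (rule eigval_spectral[OF \<mu>s tfin[of n]]) metis
    have "l k \<le> b" using tb[of n] l(1)[of k] by simp
    then show ?thesis using l by (meson order_trans)
  qed
  then obtain l where l: "\<And>n j. j \<le> k \<Longrightarrow> eigval G (\<mu>s (t n)) j = ereal (l n j)" "\<And>n j. j \<le> k \<Longrightarrow> l n j \<le> b"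
    by metis
  have on: "graph_measure.orthonormal G (\<mu>s (t n)) (Suc k) (v (t n))"
    and ev: "j \<le> k \<Longrightarrow> v (t n) j \<in> graph_measure.eigenspace G (\<mu>s (t n)) (l n j)" for n j
  proof -
    interpret N: graph_measure G "\<mu>s (t n)" by unfold_locales (rule \<mu>s)
    have o: "orthonormal_eigenfunctions G (\<mu>s (t n)) k (v (t n))" by (rule v[OF tfin])
    show *: "v (t n) j \<in> N.eigenspace (l n j)" if "j \<le> k" for j
      using o that l(1)[OF that]
      by (auto simp: orthonormal_eigenfunctions_def eigenfunction_def N.H_op_iff_eigenspace)
    then show "N.orthonormal (Suc k) (v (t n))"
      using o N.eigenspace_H1 by (auto simp: orthonormal_eigenfunctions_def N.orthonormal_def less_Suc_eq_le)
  qed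
  obtain s w L where s: "strict_mono (s :: nat \<Rightarrow> nat)" and L: "\<And>j. j \<le> k \<Longrightarrow> (\<lambda>n. l (s n) j) \<longlonglongrightarrow> L j"
    and w: "\<And>j. j \<le> k \<Longrightarrow> uconv (\<lambda>n. v (t (s n)) j) (w j)"
    and w_on: "M.orthonormal (Suc k) w" and w_ev: "\<And>j. j \<le> k \<Longrightarrow> w j \<in> M.eigenspace (L j)"
  proof (rule eigenfunctions_precompact[OF \<mu>s \<mu> weak_star_conv_subseq[OF ws t] on ev l(2)])
    fix s w L
    assume "strict_mono s" "\<And>j. j \<le> k \<Longrightarrow> (\<lambda>n. l (s n) j) \<longlonglongrightarrow> L j"
      "\<And>j. j \<le> k \<Longrightarrow> uconv (\<lambda>n. v (t (s n)) j) (w j)"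
      "M.orthonormal (Suc k) w" "\<And>j. j \<le> k \<Longrightarrow> w j \<in> M.eigenspace (L j)"
    then show thesis by (rule that)
  qed
  have ts: "strict_mono (\<lambda>n. t (s n))" using s t by (auto simp: strict_mono_def)
  \<comment> \<open>Compactness shows that \<open>L j\<close> solves the limit equation but not
    which number it carries in the count; convergence of the eigenvalue with index \<open>j\<close>
    identifies it.\<close>
  have eigval_L: "eigval G \<mu> j = ereal (L j)" if "j \<le> k" for j
  proof (rule LIMSEQ_unique)
    show "(\<lambda>n. eigval G (\<mu>s (t (s n))) j) \<longlonglongrightarrow> eigval G \<mu> j"
      by (rule eigval_tendsto[OF \<mu>s \<mu> weak_star_conv_subseq[OF ws ts]])
    show "(\<lambda>n. eigval G (\<mu>s (t (s n))) j) \<longlonglongrightarrow> ereal (L j)"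
      unfolding l(1)[OF that] using L[OF that] by simp
  qed
  have "orthonormal_eigenfunctions G \<mu> k w"
    unfolding orthonormal_eigenfunctions_def
  proof (intro conjI allI impI)
    fix j assume j: "j \<le> k"
    have "\<not> (AE x in \<mu>. w j x = 0)"
    proof
      assume "AE x in \<mu>. w j x = 0"
      then have "M.ip (w j) (w j) = 0" by (intro integral_eq_zero_AE) (auto elim: eventually_mono)
      then show False using w_on j by (simp add: M.orthonormal_def)
    qed
    then show "eigenfunction G \<mu> (real_of_ereal (eigval G \<mu> j)) (w j)"
      using w_ev[OF j] eigval_L[OF j] by (simp add: eigenfunction_def M.H_op_iff_eigenspace)
  next
    fix i j assume "i \<le> k" "j \<le> k"
    then show "M.ip (w i) (w j) = (if i = j then 1 else 0)" using w_on by (simp add: M.orthonormal_def)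
  qed
  then show thesis using that[of "\<lambda>n. t (s n)" w] ts tfin w by blast
qed

end

theorem theorem4p1:
  fixes G :: "('v, 'e) metric_graph"
    and \<mu>s :: "nat \<Rightarrow> ('v, 'e) point measure"
    and \<mu> :: "('v, 'e) point measure"
    and k :: nat
  assumes "is_metric_graph G"
    and "\<And>m. \<mu>s m \<in> nonzero_finite_measures G"
    and "\<mu> \<in> nonzero_finite_measures G"
    and "weak_star_conv G \<mu>s \<mu>"
  shows "(\<lambda>m. eigval G (\<mu>s m) k) \<longlonglongrightarrow> eigval G \<mu> k \<and>
    (eigval G \<mu> k < \<infinity> \<longrightarrow>
      (\<forall>\<^sub>F m in sequentially. eigval G (\<mu>s m) k < \<infinity>) \<and>
      (\<forall>v :: nat \<Rightarrow> nat \<Rightarrow> ('v, 'e) point \<Rightarrow> real.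
        (\<forall>m. eigval G (\<mu>s m) k < \<infinity> \<longrightarrow> orthonormal_eigenfunctions G (\<mu>s m) k (v m)) \<longrightarrow>
        (\<exists>(r :: nat \<Rightarrow> nat) w.
          strict_mono r \<and> (\<forall>m. eigval G (\<mu>s (r m)) k < \<infinity>) \<and>
          orthonormal_eigenfunctions G \<mu> k w \<and>
          (\<forall>j\<le>k. uniform_limit (points G) (\<lambda>m. v (r m) j) (w j) sequentially))))"
proof -
  interpret finite_metric_graph G by unfold_locales (rule assms)
  have lim: "(\<lambda>m. eigval G (\<mu>s m) k) \<longlonglongrightarrow> eigval G \<mu> k"
    by (rule eigval_tendsto[OF assms(2-4)])
  moreover have "\<exists>(r :: nat \<Rightarrow> nat) w. strict_mono r \<and> (\<forall>m. eigval G (\<mu>s (r m)) k < \<infinity>) \<and>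
      orthonormal_eigenfunctions G \<mu> k w \<and>
      (\<forall>j\<le>k. uniform_limit (points G) (\<lambda>m. v (r m) j) (w j) sequentially)"
    if "eigval G \<mu> k < \<infinity>"
      and "\<forall>m. eigval G (\<mu>s m) k < \<infinity> \<longrightarrow> orthonormal_eigenfunctions G (\<mu>s m) k (v m)" for v
    using eigenfunctions_subsequence[OF assms(2-4) that(1), of v] that(2) by metis
  ultimately show ?thesis using order_tendstoD(2)[OF lim] by blast
qed

end
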